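(* Let $p \geq q$, let $r \in \{1, \ldots, q-1\}$, and let $\mathbf{Y} = (Y_{ij})$ be a random $p \times q$ real matrix with independent entries $Y_{ij} \sim \mathcal{N}(\mu_{ij}, \sigma^2)$, where $\mu = (\mu_{ij})$ is a fixed $p \times q$ matrix and $\sigma^2 > 0$. Let $\hat{\mu}(r)$ be the reduced rank estimator: for $\mathbf{Y}$ with singular value decomposition $\mathbf{Y} = \sum_{k=1}^q d_k u_k v_k^T$ and distinct singular values $d_1 > d_2 > \ldots > d_q \geq 0$, $$\hat{\mu}(r) = \sum_{k=1}^r d_k u_k v_k^T.$$ Then $$\mathrm{SURE} = \|\mathbf{Y} - \hat{\mu}(r)\|_F^2 - \sigma^2 pq + 2\sigma^2\, \nabla \cdot \hat{\mu}(r)$$ is an unbiased estimate of the risk, i.e. $E(\mathrm{SURE}) = E\|\hat{\mu}(r) - \mu\|_F^2$, and $$\nabla \cdot \hat{\mu}(r) = pr + \sum_{k=1}^r \sum_{l=r+1}^q \frac{d_k^2 + d_l^2}{d_k^2 - d_l^2}$$ whenever $\mathbf{Y}$ has $q$ distinct singular values.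
   Context: In the singular value decomposition, $u_1,\ldots,u_q \in \mathbb{R}^p$ are orthonormal, $v_1,\ldots,v_q \in \mathbb{R}^q$ are orthonormal, and $d_1,\ldots,d_q \ge 0$ are the $q$ singular values of $\mathbf{Y}$ (zero is allowed as a singular value). $\|\cdot\|_F$ is the Frobenius norm. For an estimator $\hat\mu = \hat\mu(\mathbf{Y})$ with values in the $p \times q$ matrices, the divergence is $\nabla \cdot \hat{\mu} = \sum_{i=1}^p\sum_{j=1}^q \partial \hat{\mu}_{ij}/\partial Y_{ij}$, i.e. the divergence under the identification of $p\times q$ matrices with $\mathbb{R}^{pq}$. The risk of $\hat\mu$ is $E\|\hat{\mu} - \mu\|_F^2$. The estimator and its divergence are considered on the set of matrices with $q$ distinct singular values; expectations are with respect to the distribution of $\mathbf{Y}$, and values on a Lebesgue null set are irrelevant. *)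

theory Defs
  imports "HOL-Probability.Probability"
begin

(* A p x q real matrix has type real^'q^'p, with p = CARD('p) and q = CARD('q).  The library norm on
   this type is the Frobenius norm, and axis i (axis j 1) is the matrix unit E_ij. *)

definition outer_product :: "real^'p \<Rightarrow> real^'q \<Rightarrow> real^'q^'p" where
  "outer_product u v = (\<chi> i j. u $ i * v $ j)"

definition orthonormal_on :: "nat set \<Rightarrow> (nat \<Rightarrow> 'a::real_inner) \<Rightarrow> bool" where
  "orthonormal_on K u \<longleftrightarrow> (\<forall>k\<in>K. \<forall>l\<in>K. u k \<bullet> u l = (if k = l then 1 else 0))"

(* Values of d, u and v outside the index set {1..q} are irrelevant.  No order on d is imposed here. *)
definition is_svd ::
  "real^'q^'p \<Rightarrow> (nat \<Rightarrow> real) \<Rightarrow> (nat \<Rightarrow> real^'p) \<Rightarrow> (nat \<Rightarrow> real^'q) \<Rightarrow> bool" where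
  "is_svd y d u v \<longleftrightarrow>
     orthonormal_on {1..CARD('q)} u \<and> orthonormal_on {1..CARD('q)} v \<and>
     (\<forall>k\<in>{1..CARD('q)}. 0 \<le> d k) \<and>
     y = (\<Sum>k=1..CARD('q). d k *\<^sub>R outer_product (u k) (v k))"

definition is_distinct_svd ::
  "real^'q^'p \<Rightarrow> (nat \<Rightarrow> real) \<Rightarrow> (nat \<Rightarrow> real^'p) \<Rightarrow> (nat \<Rightarrow> real^'q) \<Rightarrow> bool" where
  "is_distinct_svd y d u v \<longleftrightarrow>
     is_svd y d u v \<and>
     (\<forall>k\<in>{1..CARD('q)}. \<forall>l\<in>{1..CARD('q)}. k < l \<longrightarrow> d l < d k)"

definition distinct_singular_values :: "real^'q^'p \<Rightarrow> bool" where
  "distinct_singular_values y \<longleftrightarrow> (\<exists>d u v. is_distinct_svd y d u v)"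

(* When the singular values are distinct, u k and v k are determined up to a common sign for every k
   with d k > 0, so for r < q the truncated sum does not depend on the decomposition.
   The value 0 on the remaining Lebesgue null set is an arbitrary choice. *)
definition reduced_rank_estimator :: "nat \<Rightarrow> real^'q^'p \<Rightarrow> real^'q^'p" where
  "reduced_rank_estimator r y =
     (if distinct_singular_values y
      then (THE m. \<exists>d u v. is_distinct_svd y d u v \<and>
                     m = (\<Sum>k=1..r. d k *\<^sub>R outer_product (u k) (v k)))
      else 0)"

definition coord_section ::
  "(real^'q^'p \<Rightarrow> real^'q^'p) \<Rightarrow> real^'q^'p \<Rightarrow> 'p \<Rightarrow> 'q \<Rightarrow> real \<Rightarrow> real" where
  "coord_section f y i j t = f (y + t *\<^sub>R axis i (axis j 1)) $ i $ j"

(* deriv (coord_section f y i j) 0 is the partial derivative of the (i, j) entry of f with respect to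
   the (i, j) entry of its argument, at y; it is meaningful only where that derivative exists. *)
definition divergence :: "(real^'q^'p \<Rightarrow> real^'q^'p) \<Rightarrow> real^'q^'p \<Rightarrow> real" where
  "divergence f y = (\<Sum>i\<in>UNIV. \<Sum>j\<in>UNIV. deriv (coord_section f y i j) 0)"

definition divergence_exists :: "(real^'q^'p \<Rightarrow> real^'q^'p) \<Rightarrow> real^'q^'p \<Rightarrow> bool" where
  "divergence_exists f y \<longleftrightarrow> (\<forall>i j. coord_section f y i j field_differentiable at 0)"

(* As for the estimator, the value 0 off the set of matrices with distinct singular values is
   arbitrary: that set has full measure, and the divergence is only considered there. *)
definition SURE :: "real \<Rightarrow> nat \<Rightarrow> real^'q^'p \<Rightarrow> real" where
  "SURE \<sigma> r y =
     (if distinct_singular_values y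
      then (norm (y - reduced_rank_estimator r y))\<^sup>2 - \<sigma>\<^sup>2 * real CARD('p) * real CARD('q)
           + 2 * \<sigma>\<^sup>2 * divergence (reduced_rank_estimator r) y
      else 0)"

end

theory Submission
  imports Defs "HOL-Real_Asymp.Real_Asymp"
begin

text \<open>Write $A = y^T y$ and let $P$ be the orthogonal projection onto the span of the right singular
vectors $v_1, \ldots, v_r$. The truncated sum is then $yP$, so everything reduces to how $P$ depends
on $y$. This map is smooth where the singular values are distinct, but it can jump
where $d_r = d_{r+1}$, so Stein's identity needs an argument about the size of that singular set.

Derivative. For a second matrix $y'$ with data $A'$, $P'$, Ky Fan's maximum principle with its gap
term, applied once to $y$ and once to $y'$, gives
$(d_r^2 - d_{r+1}^2) \|(P' - P)v_k\|^2 \le 2r \|y - y'\| (\|y\| + \|y'\|)$ (frame_proj_perturbation).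
With $y' = y$ this says that $P$ does not depend on the chosen decomposition; with $y' \to y$ it gives
continuity. Since $P'$ commutes with $A'$, the entries of $P'$ in the basis $v$ satisfy
$(d_k^2 - d_l^2) \langle P' v_k, v_l \rangle =
\langle P' v_k, (A' - A) v_l \rangle - \langle (A' - A) v_k, P' v_l \rangle$
(top_projection_offdiag), and continuity of $P'$ turns this into a derivative. The diagonal entries
have derivative 0 because $P'$ is idempotent. Hence (estimator_partial)
\[ \frac{\partial \hat\mu_{ij}}{\partial Y_{ij}} = \sum_{k \le r} v_{kj}^2 +
   \sum_{k \le r < l} \frac{(d_k u_{ki} v_{lj} + d_l u_{li} v_{kj})^2}{d_k^2 - d_l^2}, \]
and summation over $i, j$ kills the mixed terms by orthonormality, which leaves the claimed
divergence.

Singular set. Almost every line parallel to a coordinate axis consists of matrices with distinct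
singular values only (AE_line_not_repeated). Moving along the $(i,j)$ axis changes row $i$ alone, and
$A = B + z z^T$ where $z$ is that row and $B$ comes from the other rows. For almost all choices of the
other rows, $B$ has simple spectrum (a Krylov determinant is a nonzero polynomial). Then a repeated
eigenvalue $\lambda$ of $B + z z^T$ forces two independent equations on $z$: it is orthogonal to the
$\lambda$-eigenvector of $B$, and a quadratic form in $z$ equals $-1$. One equation fixes the position
on the line, and the other one still confines the line to a null set.

Stein's identity. The displayed partial derivatives are nonnegative, so along a good line the
fundamental theorem of calculus and monotone convergence give integration by parts against the normal
density even though the derivative blows up near the singular set (stein_line). Integration over all
parallel lines gives $E[\hat\mu_{ij} (Y_{ij} - \mu_{ij})] = \sigma^2 E[\partial_{ij} \hat\mu_{ij}]$
including the integrability of the right-hand side (stein_estimator). Unbiasedness is then the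
expansion of $(\hat\mu - \mu)^2 = ((\hat\mu - Y) + (Y - \mu))^2$ entry by entry.\<close>

section \<open>Orthonormal bases and the Gram operator\<close>

definition gram :: "real^'q^'p \<Rightarrow> real^'q \<Rightarrow> real^'q" where
  "gram y x = transpose y *v (y *v x)"

lemma gram_inner: "gram y x \<bullet> w = (y *v x) \<bullet> (y *v w)"
  unfolding gram_def
  by (metis dot_lmul_matrix transpose_matrix_vector)

lemma gram_symmetric: "gram y x \<bullet> w = x \<bullet> gram y w"
  by (metis gram_inner inner_commute)

lemma linear_gram: "linear (gram y)"
  unfolding gram_def
  by (intro linearI) (simp_all add: matrix_vector_right_distrib matrix_vector_mult_scaleR)

lemma norm_matrix_vector_le: "norm (y *v x) \<le> norm y * norm x"
  for y :: "real^'q^'p"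
proof -
  have "(norm (y *v x))\<^sup>2 = (\<Sum>i\<in>UNIV. (y $ i \<bullet> x)\<^sup>2)"
    by (simp add: norm_eq_sqrt_inner inner_vec_def matrix_vector_mul_component power2_eq_square
        inner_sum_left sum_nonneg)
  also have "\<dots> \<le> (\<Sum>i\<in>UNIV. (norm (y $ i))\<^sup>2 * (norm x)\<^sup>2)"
    by (intro sum_mono) (metis Cauchy_Schwarz_ineq2 power_mult_distrib abs_ge_zero power_mono power2_abs)
  also have "\<dots> = (norm y * norm x)\<^sup>2"
    by (simp add: norm_vec_def L2_set_def sum_nonneg power_mult_distrib sum_distrib_right)
  finally show ?thesis
    by (simp add: power2_le_iff_abs_le)
qed

lemma orthonormal_onD:
  assumes "orthonormal_on K u" "k \<in> K" "l \<in> K"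
  shows "u k \<bullet> u l = (if k = l then 1 else 0)"
  using assms unfolding orthonormal_on_def by auto

lemma orthonormal_on_inj: "orthonormal_on K u \<Longrightarrow> inj_on u K"
  unfolding orthonormal_on_def inj_on_def by (metis one_neq_zero)

text \<open>An orthonormal family of full length is independent, hence spans. The sum stands on the
left so that the equation can be used for rewriting without looping.\<close>

lemma orthonormal_expand:
  fixes v :: "nat \<Rightarrow> real^'q"
  assumes "orthonormal_on {1..CARD('q)} v"
  shows "(\<Sum>k=1..CARD('q). (x \<bullet> v k) *\<^sub>R v k) = x"
proof -
  let ?K = "{1..CARD('q)}" and ?B = "v ` {1..CARD('q)}"
  have inj: "inj_on v ?K" using assms by (rule orthonormal_on_inj)
  have po: "pairwise orthogonal ?B"
    using assms unfolding pairwise_def orthogonal_def orthonormal_on_def by auto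
  have n1: "\<And>b. b \<in> ?B \<Longrightarrow> norm b = 1"
    using assms unfolding orthonormal_on_def norm_eq_sqrt_inner by auto
  have "independent ?B"
    using po n1 by (intro pairwise_orthogonal_independent) force+
  moreover have "card ?B = DIM(real^'q)"
    using inj by (simp add: card_image)
  ultimately have "span ?B = UNIV"
    using card_eq_dim[of ?B UNIV] by auto
  then have "(\<Sum>b\<in>?B. (x \<bullet> b) *\<^sub>R b) = x"
    by (intro orthonormal_basis_expand po n1) auto
  then show ?thesis
    using inj by (simp add: sum.reindex)
qed

lemma orthonormal_parseval:
  fixes v :: "nat \<Rightarrow> real^'q"
  assumes "orthonormal_on {1..CARD('q)} v"
  shows "x \<bullet> w = (\<Sum>k=1..CARD('q). (x \<bullet> v k) * (w \<bullet> v k))"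
proof -
  have "x \<bullet> w = (\<Sum>k=1..CARD('q). (x \<bullet> v k) *\<^sub>R v k) \<bullet> w"
    using orthonormal_expand[OF assms, of x] by simp
  also have "\<dots> = (\<Sum>k=1..CARD('q). (x \<bullet> v k) * (w \<bullet> v k))"
    unfolding inner_sum_left by (simp add: inner_commute)
  finally show ?thesis .
qed

lemma outer_product_mult: "outer_product u v *v x = (v \<bullet> x) *\<^sub>R u"
  by (simp add: outer_product_def vec_eq_iff matrix_vector_mult_def inner_vec_def sum_distrib_left
      mult_ac)

lemma sum_matrix_vector: "(\<Sum>k\<in>K. f k) *v x = (\<Sum>k\<in>K. f k *v x)"
  for f :: "_ \<Rightarrow> real^'q^'p"
  by (induction K rule: infinite_finite_induct) (auto simp: matrix_vector_mult_add_rdistrib)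

lemma scaleR_matrix_vector: "(c *\<^sub>R a) *v x = c *\<^sub>R (a *v x)" for a :: "real^'q^'p"
  by (simp add: scaleR_matrix_vector_assoc)

lemma svd_matrix_vector:
  fixes y :: "real^'q^'p"
  assumes "is_svd y d u v" "k \<in> {1..CARD('q)}"
  shows "y *v v k = d k *\<^sub>R u k"
proof -
  have on: "orthonormal_on {1..CARD('q)} v" and y: "y = (\<Sum>k=1..CARD('q). d k *\<^sub>R outer_product (u k) (v k))"
    using assms unfolding is_svd_def by auto
  have "y *v v k = (\<Sum>l=1..CARD('q). d l *\<^sub>R ((v l \<bullet> v k) *\<^sub>R u l))"
    by (subst y) (simp add: sum_matrix_vector scaleR_matrix_vector outer_product_mult del: scaleR_scaleR)
  also have "\<dots> = (\<Sum>l=1..CARD('q). if l = k then d k *\<^sub>R u k else 0)"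
    using assms(2) by (intro sum.cong) (auto simp: orthonormal_onD[OF on])
  finally show ?thesis using assms(2) by simp
qed

lemma matrix_eq_sum_outer:
  fixes y :: "real^'q^'p"
  assumes "orthonormal_on {1..CARD('q)} v"
  shows "y = (\<Sum>k=1..CARD('q). outer_product (y *v v k) (v k))"
proof -
  have "y *v x = (\<Sum>k=1..CARD('q). outer_product (y *v v k) (v k)) *v x" for x
  proof -
    have "y *v x = y *v (\<Sum>k=1..CARD('q). (x \<bullet> v k) *\<^sub>R v k)"
      using orthonormal_expand[OF assms, of x] by simp
    also have "\<dots> = (\<Sum>k=1..CARD('q). (x \<bullet> v k) *\<^sub>R (y *v v k))"
      by (simp only: linear_sum[OF matrix_vector_mul_linear] matrix_vector_mult_scaleR)
    also have "\<dots> = (\<Sum>k=1..CARD('q). outer_product (y *v v k) (v k)) *v x"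
      by (simp only: sum_matrix_vector outer_product_mult inner_commute)
    finally show ?thesis .
  qed
  then show ?thesis unfolding matrix_eq by blast
qed

lemma outer_product_scale: "outer_product (c *\<^sub>R u) v = c *\<^sub>R outer_product u v"
  by (simp add: outer_product_def vec_eq_iff)

text \<open>Phrased through eigenvectors of \<open>y\<^sup>T y\<close> so that it refers to no chosen decomposition and is visibly a
closed condition. For $q \le p$ it is the negation of \<^const>\<open>distinct_singular_values\<close>
(\<open>distinct_iff_not_repeated\<close>).\<close>

definition repeated_singular_value :: "real^'q^'p \<Rightarrow> bool" where
  "repeated_singular_value y \<longleftrightarrow> (\<exists>l x x'. norm x = 1 \<and> norm x' = 1 \<and> x \<bullet> x' = 0 \<and>
      gram y x = l *\<^sub>R x \<and> gram y x' = l *\<^sub>R x')"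

lemma svd_gram:
  fixes y :: "real^'q^'p"
  assumes "is_svd y d u v" "k \<in> {1..CARD('q)}"
  shows "gram y (v k) = (d k)\<^sup>2 *\<^sub>R v k"
proof -
  have on: "orthonormal_on {1..CARD('q)} v" and onu: "orthonormal_on {1..CARD('q)} u"
    using assms unfolding is_svd_def by auto
  have "gram y (v k) \<bullet> v l = (d k)\<^sup>2 *\<^sub>R v k \<bullet> v l" if "l \<in> {1..CARD('q)}" for l
    using that assms(2) svd_matrix_vector[OF assms(1)]
    by (auto simp: gram_inner orthonormal_onD[OF on] orthonormal_onD[OF onu] power2_eq_square)
  then have "(\<Sum>l=1..CARD('q). (gram y (v k) \<bullet> v l) *\<^sub>R v l) = (\<Sum>l=1..CARD('q). ((d k)\<^sup>2 *\<^sub>R v k \<bullet> v l) *\<^sub>R v l)"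
    by (intro sum.cong) auto
  then show ?thesis
    unfolding orthonormal_expand[OF on] .
qed

text \<open>An eigenvector of the Gram operator has a component only along those $v_k$ with $d_k^2$ equal to
its eigenvalue. As the $d_k$ are nonnegative and distinct, there is one such $k$, so two eigenvectors
for the same eigenvalue are parallel.\<close>

lemma distinct_not_repeated:
  fixes y :: "real^'q^'p"
  assumes "is_distinct_svd y d u v"
  shows "\<not> repeated_singular_value y"
proof
  assume "repeated_singular_value y"
  then obtain l x x' where x: "norm x = 1" "norm x' = 1" "x \<bullet> x' = 0"
    and e: "gram y x = l *\<^sub>R x" "gram y x' = l *\<^sub>R x'" unfolding repeated_singular_value_def by blast
  let ?K = "{1..CARD('q)}"
  have svd: "is_svd y d u v" and on: "orthonormal_on ?K v"
    and dp: "\<And>k. k \<in> ?K \<Longrightarrow> 0 \<le> d k"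
    and dd: "\<And>k l. k \<in> ?K \<Longrightarrow> l \<in> ?K \<Longrightarrow> k < l \<Longrightarrow> d l < d k"
    using assms unfolding is_distinct_svd_def is_svd_def by auto
  have ev: "l = (d k)\<^sup>2" if "gram y z = l *\<^sub>R z" "k \<in> ?K" "z \<bullet> v k \<noteq> 0" for z k
  proof -
    have "l * (z \<bullet> v k) = gram y z \<bullet> v k" using that by simp
    also have "\<dots> = (d k)\<^sup>2 * (z \<bullet> v k)"
      using svd_gram[OF svd that(2)] by (simp add: gram_symmetric)
    finally show ?thesis using that by simp
  qed
  have ex: "\<exists>k\<in>?K. z \<bullet> v k \<noteq> 0" if "norm z = 1" for z
  proof (rule ccontr)
    assume "\<not> ?thesis"
    then have "z = 0" using orthonormal_expand[OF on, of z] by simp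
    then show False using that by simp
  qed
  obtain k where k: "k \<in> ?K" "x \<bullet> v k \<noteq> 0" using ex x by blast
  have uniq: "m = k" if "m \<in> ?K" "z \<bullet> v m \<noteq> 0" "gram y z = l *\<^sub>R z" for m z
  proof (rule ccontr)
    assume "m \<noteq> k"
    then have "d m < d k \<or> d k < d m" using dd k that by (metis nat_neq_iff)
    moreover have "(d m)\<^sup>2 = (d k)\<^sup>2" using ev[OF that(3,1,2)] ev[OF e(1) k] by simp
    ultimately show False using dp k that by (metis power2_eq_iff_nonneg less_irrefl)
  qed
  have "x \<bullet> x' = (\<Sum>m\<in>?K. (x \<bullet> v m) * (x' \<bullet> v m))" by (rule orthonormal_parseval[OF on])
  also have "\<dots> = (\<Sum>m\<in>{k}. (x \<bullet> v m) * (x' \<bullet> v m))"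
  proof (rule sum.mono_neutral_right)
    show "\<forall>m\<in>?K - {k}. (x \<bullet> v m) * (x' \<bullet> v m) = 0"
      using uniq[OF _ _ e(1)] by (metis DiffD1 DiffD2 mult_zero_left singletonI)
  qed (use k(1) in simp_all)
  finally have "x' \<bullet> v k = 0" using x k by simp
  moreover obtain m where "m \<in> ?K" "x' \<bullet> v m \<noteq> 0" using ex x by blast
  ultimately show False using uniq[OF _ _ e(2)] by metis
qed

section \<open>Existence of singular value decompositions\<close>

lemma rayleigh_max_exists:
  fixes y :: "real^'q^'p"
  assumes "subspace W" "z \<in> W" "z \<noteq> 0"
  obtains v where "v \<in> W" "norm v = 1" "\<And>w. w \<in> W \<Longrightarrow> (norm (y *v w))\<^sup>2 \<le> (norm (y *v v))\<^sup>2 * (norm w)\<^sup>2"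
proof -
  let ?S = "sphere 0 1 \<inter> W"
  have "compact ?S" using assms by (intro compact_Int_closed closed_subspace) auto
  moreover have "(1 / norm z) *\<^sub>R z \<in> ?S"
    using assms by (auto simp: subspace_scale)
  moreover have "continuous_on ?S (\<lambda>v. (norm (y *v v))\<^sup>2)"
    by (intro continuous_intros linear_continuous_on matrix_vector_mul_bounded_linear)
  ultimately obtain v where v: "v \<in> ?S" "\<And>w. w \<in> ?S \<Longrightarrow> (norm (y *v w))\<^sup>2 \<le> (norm (y *v v))\<^sup>2"
    using continuous_attains_sup[of ?S] by (metis empty_iff)
  show ?thesis
  proof
    show "v \<in> W" "norm v = 1" using v by auto
    fix w assume w: "w \<in> W"
    show "(norm (y *v w))\<^sup>2 \<le> (norm (y *v v))\<^sup>2 * (norm w)\<^sup>2"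
    proof (cases "w = 0")
      case False
      then have "(1 / norm w) *\<^sub>R w \<in> ?S" using w assms by (auto simp: subspace_scale)
      from v(2)[OF this] show ?thesis
        using False by (simp add: matrix_vector_mult_scaleR power_mult_distrib power_divide field_simps)
    qed auto
  qed
qed

text \<open>The first variation of the Rayleigh quotient at a maximiser vanishes in every direction of $W$.
It is enough to test the residual $g = A v - l v$, which lies in $W$ since $W$ is invariant.\<close>

lemma rayleigh_max_eigen:
  fixes y :: "real^'q^'p"
  assumes W: "subspace W" and inv: "\<And>w. w \<in> W \<Longrightarrow> gram y w \<in> W"
    and v: "v \<in> W" "norm v = 1"
    and mx: "\<And>w. w \<in> W \<Longrightarrow> (norm (y *v w))\<^sup>2 \<le> (norm (y *v v))\<^sup>2 * (norm w)\<^sup>2"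
  shows "gram y v = (norm (y *v v))\<^sup>2 *\<^sub>R v"
proof -
  define l where "l = (norm (y *v v))\<^sup>2"
  define g where "g = gram y v - l *\<^sub>R v"
  have gW: "g \<in> W" unfolding g_def using W inv v by (intro subspace_diff subspace_scale) auto
  have "2 * t * (g \<bullet> g) \<le> t\<^sup>2 * (l * (g \<bullet> g))" for t
  proof -
    have "v + t *\<^sub>R g \<in> W" using W v gW by (intro subspace_add subspace_scale) auto
    from mx[OF this]
    have "(y *v v + t *\<^sub>R (y *v g)) \<bullet> (y *v v + t *\<^sub>R (y *v g)) \<le> l * ((v + t *\<^sub>R g) \<bullet> (v + t *\<^sub>R g))"
      by (simp add: power2_norm_eq_inner l_def matrix_vector_right_distrib matrix_vector_mult_scaleR)
    then have "(y *v v) \<bullet> (y *v v) + 2 * t * ((y *v v) \<bullet> (y *v g)) + t\<^sup>2 * ((y *v g) \<bullet> (y *v g))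
        \<le> l * (v \<bullet> v) + 2 * t * (l * (v \<bullet> g)) + t\<^sup>2 * (l * (g \<bullet> g))"
      by (simp add: inner_add_left inner_add_right inner_commute algebra_simps power2_eq_square)
    moreover have "(y *v v) \<bullet> (y *v v) = l * (v \<bullet> v)"
      using v(2) by (simp add: l_def flip: power2_norm_eq_inner)
    moreover have "(y *v v) \<bullet> (y *v g) = g \<bullet> g + l * (v \<bullet> g)"
      unfolding gram_inner[symmetric] by (simp add: g_def inner_diff_left)
    moreover have "0 \<le> t\<^sup>2 * ((y *v g) \<bullet> (y *v g))" by simp
    moreover have "2 * t * b' \<le> r" if "a + 2 * t * b + c \<le> a' + 2 * t * l' + r"
      "a = a'" "b = b' + l'" "0 \<le> c" for a a' b b' c l' r :: real
      using that by (simp add: distrib_left)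
    ultimately show ?thesis by blast
  qed
  note q = this
  have "g \<bullet> g = 0"
  proof (rule ccontr)
    assume "g \<bullet> g \<noteq> 0"
    then have gp: "g \<bullet> g > 0" by simp
    have lp: "l \<ge> 0" by (simp add: l_def)
    \<comment> \<open>At $t = 1/(l+1)$ the linear term dominates, as $t l < 1$.\<close>
    define s where "s = 1 / (l + 1)"
    have s: "s > 0" "s * (l + 1) = 1" using lp by (auto simp: s_def)
    have "2 * s \<le> s\<^sup>2 * l"
      by (rule mult_right_le_imp_le[OF _ gp]) (use q[of s] in \<open>simp add: mult.assoc\<close>)
    then have "s * 2 \<le> s * (s * l)" by (simp add: power2_eq_square)
    then have "2 \<le> s * l" using s(1) by simp
    then show False using s by (simp add: distrib_left)
  qed
  then show ?thesis by (simp add: g_def l_def)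
qed

lemma exists_orthogonal_to_few:
  fixes V :: "'a::euclidean_space set"
  assumes "finite V" "card V < DIM('a)"
  obtains z where "z \<noteq> 0" "\<And>b. b \<in> V \<Longrightarrow> z \<bullet> b = 0"
proof -
  have "dim (span V) < DIM('a)" using assms dim_le_card'[of V] by simp
  then obtain z where "z \<noteq> 0" "\<And>b. b \<in> span V \<Longrightarrow> orthogonal z b"
    using orthogonal_to_subspace_exists[of "span V"] by (metis span_span)
  then show ?thesis using that by (auto simp: orthogonal_def span_base)
qed

text \<open>The spectral theorem, by maximising $\|y w\|$ on the orthogonal complement of the
eigenvectors already found. The extremal property is carried along because it makes the resulting
singular values decrease.\<close>

lemma greedy_eigenvectors:
  fixes y :: "real^'q^'p"
  assumes "n \<le> CARD('q)"
  shows "\<exists>v. orthonormal_on {1..n} v \<and> (\<forall>k\<in>{1..n}. gram y (v k) = (norm (y *v v k))\<^sup>2 *\<^sub>R v k \<and>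
      (\<forall>w. (\<forall>l\<in>{1..<k}. w \<bullet> v l = 0) \<longrightarrow> (norm (y *v w))\<^sup>2 \<le> (norm (y *v v k))\<^sup>2 * (norm w)\<^sup>2))"
  using assms
proof (induction n)
  case 0
  then show ?case by (auto simp: orthonormal_on_def)
next
  case (Suc n)
  then obtain v where on: "orthonormal_on {1..n} v"
    and e: "\<And>k. k \<in> {1..n} \<Longrightarrow> gram y (v k) = (norm (y *v v k))\<^sup>2 *\<^sub>R v k"
    and m: "\<And>k w. k \<in> {1..n} \<Longrightarrow> (\<forall>l\<in>{1..<k}. w \<bullet> v l = 0) \<Longrightarrow>
       (norm (y *v w))\<^sup>2 \<le> (norm (y *v v k))\<^sup>2 * (norm w)\<^sup>2" by auto
  define W where "W = {w. \<forall>l\<in>{1..n}. w \<bullet> v l = 0}"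
  have W: "subspace W" unfolding W_def by (auto simp: subspace_def inner_add_left)
  have inv: "gram y w \<in> W" if "w \<in> W" for w
    using that e unfolding W_def by (auto simp: gram_symmetric)
  have "card (v ` {1..n}) < DIM(real^'q)"
    using Suc.prems card_image_le[of "{1..n}" v] by simp
  with finite_imageI[OF finite_atLeastAtMost] obtain z
    where "z \<noteq> 0" and zv: "\<And>b. b \<in> v ` {1..n} \<Longrightarrow> z \<bullet> b = 0"
    by (rule exists_orthogonal_to_few) blast
  have "z \<in> W" unfolding W_def using zv by blast
  obtain x where x: "x \<in> W" "norm x = 1"
    and mx: "\<And>w. w \<in> W \<Longrightarrow> (norm (y *v w))\<^sup>2 \<le> (norm (y *v x))\<^sup>2 * (norm w)\<^sup>2"
    using rayleigh_max_exists[OF W \<open>z \<in> W\<close> \<open>z \<noteq> 0\<close>] by blast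
  have ex: "gram y x = (norm (y *v x))\<^sup>2 *\<^sub>R x"
    by (rule rayleigh_max_eigen[OF W inv x mx])
  let ?v = "v(Suc n := x)"
  have "orthonormal_on {1..Suc n} ?v"
    using on x unfolding orthonormal_on_def W_def
    by (auto simp: le_Suc_eq inner_commute norm_eq_1)
  moreover have "gram y (?v k) = (norm (y *v ?v k))\<^sup>2 *\<^sub>R ?v k \<and>
      (\<forall>w. (\<forall>l\<in>{1..<k}. w \<bullet> ?v l = 0) \<longrightarrow> (norm (y *v w))\<^sup>2 \<le> (norm (y *v ?v k))\<^sup>2 * (norm w)\<^sup>2)"
    if k: "k \<in> {1..Suc n}" for k
  proof (cases "k = Suc n")
    case True
    have "w \<in> W" if "\<forall>l\<in>{1..<Suc n}. w \<bullet> ?v l = 0" for w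
      using that unfolding W_def by (auto simp: less_Suc_eq_le)
    then show ?thesis using True ex mx by simp
  next
    case False
    then have k: "k \<in> {1..n}" using k by auto
    then have "?v l = v l" if "l \<in> {1..<k}" for l using that by auto
    then show ?thesis using False e[OF k] m[OF k] by auto
  qed
  ultimately show ?case by blast
qed

text \<open>Simplicity of the spectrum makes the greedy singular values strictly decreasing. The left vectors
are $y v_k / d_k$ as long as $d_k \ne 0$.\<close>

lemma not_repeated_distinct_svd:
  fixes y :: "real^'q^'p"
  assumes "CARD('q) \<le> CARD('p)" "\<not> repeated_singular_value y"
  shows "\<exists>d u v. is_distinct_svd y d u v"
proof -
  let ?K = "{1..CARD('q)}"
  obtain v where on: "orthonormal_on ?K v"
    and e: "\<And>k. k \<in> ?K \<Longrightarrow> gram y (v k) = (norm (y *v v k))\<^sup>2 *\<^sub>R v k"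
    and m: "\<And>k w. k \<in> ?K \<Longrightarrow> (\<forall>l\<in>{1..<k}. w \<bullet> v l = 0) \<Longrightarrow>
       (norm (y *v w))\<^sup>2 \<le> (norm (y *v v k))\<^sup>2 * (norm w)\<^sup>2"
    using greedy_eigenvectors[of "CARD('q)" y] by (metis order_refl)
  define d where "d k = norm (y *v v k)" for k
  have n1: "norm (v k) = 1" if "k \<in> ?K" for k
    using orthonormal_onD[OF on that that] by (simp add: norm_eq_1)
  have dec: "d l < d k" if k: "k \<in> ?K" and l: "l \<in> ?K" and "k < l" for k l
  proof -
    have "(d l)\<^sup>2 \<le> (d k)\<^sup>2"
      using m[OF k, of "v l"] n1[OF l] k l \<open>k < l\<close> by (auto simp: d_def orthonormal_onD[OF on])
    then have "d l \<le> d k" by (rule power2_le_imp_le) (simp add: d_def)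
    moreover have "d l \<noteq> d k"
    proof
      assume "d l = d k"
      then have "repeated_singular_value y" unfolding repeated_singular_value_def
        using n1[OF k] n1[OF l] e[OF k] e[OF l] orthonormal_onD[OF on k l] \<open>k < l\<close>
        by (intro exI[of _ "(d k)\<^sup>2"] exI[of _ "v k"] exI[of _ "v l"]) (auto simp: d_def)
      then show False using assms by simp
    qed
    ultimately show ?thesis by simp
  qed
  define u0 where "u0 k = (1 / d k) *\<^sub>R (y *v v k)" for k
  have u0: "u0 k \<bullet> u0 l = (if k = l then 1 else 0)" if "k \<in> ?K" "l \<in> ?K" "d k \<noteq> 0" for k l
  proof -
    have "(y *v v k) \<bullet> (y *v v l) = (d k)\<^sup>2 * (if k = l then 1 else 0)"
      using that e[of k] orthonormal_onD[OF on that(1,2)] by (simp add: d_def flip: gram_inner)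
    then show ?thesis using that by (auto simp: u0_def power2_eq_square)
  qed
  let ?n = "CARD('q)"
  have pos: "d k > 0" if "k \<in> {1..<?n}" for k
  proof -
    have "d ?n < d k" using that by (intro dec) auto
    then show ?thesis by (metis d_def norm_ge_zero order.strict_trans1)
  qed
  have "card (u0 ` {1..<?n}) < DIM(real^'p)"
  proof -
    have "card (u0 ` {1..<?n}) \<le> ?n - 1" using card_image_le[of "{1..<?n}" u0] by simp
    moreover have "0 < ?n" by simp
    ultimately have "card (u0 ` {1..<?n}) < CARD('p)" using assms(1) by linarith
    then show ?thesis by simp
  qed
  with finite_imageI[OF finite_atLeastLessThan] obtain z
    where z0: "z \<noteq> 0" and zu: "\<And>b. b \<in> u0 ` {1..<?n} \<Longrightarrow> z \<bullet> b = 0"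
    by (rule exists_orthogonal_to_few) blast
  have z: "z \<noteq> 0" "\<And>k. k \<in> {1..<?n} \<Longrightarrow> z \<bullet> u0 k = 0" using z0 zu by blast+
  \<comment> \<open>Only $d_q$ can vanish. Its left vector is any unit vector orthogonal to the other $q - 1$ ones, which exists as $q \le p$.\<close>
  define u where "u k = (if d k = 0 then (1 / norm z) *\<^sub>R z else u0 k)" for k
  have d0: "k = ?n" if "k \<in> ?K" "d k = 0" for k
    using pos[of k] that by (cases "k = ?n") auto
  have un: "d k *\<^sub>R u k = y *v v k" for k
    by (cases "d k = 0") (auto simp: u_def u0_def d_def)
  have zz: "(1 / norm z) * ((1 / norm z) * (z \<bullet> z)) = 1"
    using z(1) by (simp add: power2_eq_square flip: power2_norm_eq_inner)
  have uo: "u k \<bullet> u l = (if k = l then 1 else 0)" if k: "k \<in> ?K" and l: "l \<in> ?K" for k l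
  proof (cases "d k = 0"; cases "d l = 0")
    assume "d k = 0" "d l = 0"
    then show ?thesis using d0 k l zz by (auto simp: u_def)
  next
    assume a: "d k = 0" "d l \<noteq> 0"
    then have "l \<in> {1..<?n}" "k \<noteq> l" using d0[of k] k l by (auto simp: order_less_le)
    then show ?thesis using a z by (auto simp: u_def)
  next
    assume a: "d k \<noteq> 0" "d l = 0"
    then have "k \<in> {1..<?n}" "k \<noteq> l" using d0[of l] k l by (auto simp: order_less_le)
    then show ?thesis using a z by (auto simp: u_def inner_commute)
  next
    assume a: "d k \<noteq> 0" "d l \<noteq> 0"
    then show ?thesis using u0[OF k l] by (simp add: u_def)
  qed
  have "y = (\<Sum>k\<in>?K. d k *\<^sub>R outer_product (u k) (v k))"
    using matrix_eq_sum_outer[OF on, of y] by (simp add: un flip: outer_product_scale)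
  then have "is_distinct_svd y d u v"
    unfolding is_distinct_svd_def is_svd_def using on uo dec
    by (auto simp: orthonormal_on_def d_def)
  then show ?thesis by blast
qed

lemma distinct_iff_not_repeated:
  fixes y :: "real^'q^'p"
  assumes "CARD('q) \<le> CARD('p)"
  shows "distinct_singular_values y \<longleftrightarrow> \<not> repeated_singular_value y"
  using not_repeated_distinct_svd[OF assms] distinct_not_repeated
  unfolding distinct_singular_values_def by blast

section \<open>Matrices with a repeated singular value form a closed set\<close>

lemma continuous_on_matrix_vector:
  fixes f :: "'a::topological_space \<Rightarrow> real^'q^'p"
  assumes "continuous_on S f" "continuous_on S g"
  shows "continuous_on S (\<lambda>z. f z *v g z)"
proof -
  have "(\<lambda>z. f z *v g z) = (\<lambda>z. \<chi> i. f z $ i \<bullet> g z)"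
    by (simp add: fun_eq_iff vec_eq_iff matrix_vector_mul_component)
  moreover have "continuous_on S (\<lambda>z. \<chi> i. f z $ i \<bullet> g z)"
    using assms by (intro continuous_intros)
  ultimately show ?thesis by (simp only:)
qed

text \<open>The eigenvalue of a unit eigenvector $x$ is $\|y x\|^2$, so it can be eliminated. What remains
is a closed condition on $y$ and a pair ranging over a compact set, and such a condition has a closed
projection.\<close>

lemma repeated_iff_compact:
  "repeated_singular_value y \<longleftrightarrow> (\<exists>z. z \<in> {z. norm (fst z) = 1 \<and> norm (snd z) = 1 \<and> fst z \<bullet> snd z = 0} \<and>
     (z, y) \<in> {(z, y). \<forall>w. (y *v fst z) \<bullet> (y *v w) = (norm (y *v fst z))\<^sup>2 * (fst z \<bullet> w) \<and>
        (y *v snd z) \<bullet> (y *v w) = (norm (y *v fst z))\<^sup>2 * (snd z \<bullet> w)})"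
  (is "?L \<longleftrightarrow> ?R")
proof
  assume ?L
  then obtain l x x' where x: "norm x = 1" "norm x' = 1" "x \<bullet> x' = 0"
    and e: "gram y x = l *\<^sub>R x" "gram y x' = l *\<^sub>R x'" unfolding repeated_singular_value_def by blast
  have "l = (norm (y *v x))\<^sup>2"
    using arg_cong[OF e(1), of "\<lambda>z. z \<bullet> x"] x(1) by (simp add: gram_inner norm_eq_1 power2_norm_eq_inner)
  then show ?R using x e
    by (intro exI[of _ "(x, x')"]) (simp flip: gram_inner)
next
  assume ?R
  then obtain x x' where x: "norm x = 1" "norm x' = 1" "x \<bullet> x' = 0"
    and e: "\<And>w. (y *v x) \<bullet> (y *v w) = (norm (y *v x))\<^sup>2 * (x \<bullet> w)"
      "\<And>w. (y *v x') \<bullet> (y *v w) = (norm (y *v x))\<^sup>2 * (x' \<bullet> w)"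
    unfolding mem_Collect_eq case_prod_conv split_paired_Ex fst_conv snd_conv by blast
  have *: "gram y z = l *\<^sub>R z" if "\<And>w. (y *v z) \<bullet> (y *v w) = l * (z \<bullet> w)" for z l
    by (rule vector_eq_rdot[THEN iffD1]) (simp only: gram_inner inner_scaleR_left that simp_thms)
  show ?L unfolding repeated_singular_value_def using x *[OF e(1)] *[OF e(2)] by (intro exI conjI)
qed

lemma closed_repeated: "closed {y :: real^'q^'p. repeated_singular_value y}"
  unfolding repeated_iff_compact
proof (rule closed_compact_projection)
  have "compact (sphere (0::real^'q) 1 \<times> sphere (0::real^'q) 1 \<inter> {z. fst z \<bullet> snd z = 0})"
    by (intro compact_Int_closed compact_Times compact_sphere closed_Collect_eq continuous_intros)
  moreover have "{z. norm (fst z) = 1 \<and> norm (snd z) = 1 \<and> fst z \<bullet> snd z = 0} =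
     sphere (0::real^'q) 1 \<times> sphere (0::real^'q) 1 \<inter> {z. fst z \<bullet> snd z = 0}"
    by auto
  ultimately show "compact {z :: (real^'q) \<times> (real^'q). norm (fst z) = 1 \<and> norm (snd z) = 1 \<and> fst z \<bullet> snd z = 0}"
    by simp
  show "closed {(z, y::real^'q^'p). \<forall>w. (y *v fst z) \<bullet> (y *v w) = (norm (y *v fst z))\<^sup>2 * (fst z \<bullet> w) \<and>
        (y *v snd z) \<bullet> (y *v w) = (norm (y *v fst z))\<^sup>2 * (snd z \<bullet> w)}"
    unfolding case_prod_beta
    by (intro closed_Collect_all closed_Collect_conj closed_Collect_eq continuous_intros
        continuous_on_matrix_vector)
qed

text \<open>Closedness along segments makes the set of lines that meet the singular set a countable union
of closed sets, hence Borel.\<close>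

lemma closed_repeated_segment: "closed {y :: real^'q^'p. \<exists>t. t \<in> {a..b} \<and> repeated_singular_value (y + t *\<^sub>R e)}"
proof -
  have "closed ((\<lambda>z::real \<times> (real^'q^'p). snd z + fst z *\<^sub>R e) -` {y. repeated_singular_value y})"
    by (intro closed_vimage closed_repeated continuous_intros)
  then have "closed {(t::real, y). repeated_singular_value (y + t *\<^sub>R e)}"
    unfolding vimage_def case_prod_beta mem_Collect_eq .
  from closed_compact_projection[OF compact_Icc this, of a b]
  show ?thesis by simp
qed

section \<open>Perturbation of the top singular subspace\<close>

text \<open>The orthogonal projection onto the span of $w_1, \ldots, w_r$ when these are orthonormal.\<close>

definition frame_proj :: "nat \<Rightarrow> (nat \<Rightarrow> real^'q) \<Rightarrow> real^'q \<Rightarrow> real^'q" where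
  "frame_proj r w x = (\<Sum>m=1..r. (w m \<bullet> x) *\<^sub>R w m)"

lemma linear_frame_proj: "linear (frame_proj r w)"
  unfolding frame_proj_def
  by (intro linearI) (simp_all add: inner_add_right scaleR_add_left sum.distrib scaleR_sum_right)

lemma frame_proj_inner: "frame_proj r w x \<bullet> z = (\<Sum>m=1..r. (w m \<bullet> x) * (w m \<bullet> z))"
  by (simp add: frame_proj_def inner_sum_left)

lemma frame_proj_sym: "frame_proj r w x \<bullet> z = x \<bullet> frame_proj r w z"
  by (simp only: frame_proj_inner inner_commute[of x] mult.commute)

lemma orthonormal_on_subset: "orthonormal_on K u \<Longrightarrow> L \<subseteq> K \<Longrightarrow> orthonormal_on L u"
  unfolding orthonormal_on_def by blast

lemma frame_proj_basis:
  assumes "orthonormal_on K w" "{1..r} \<subseteq> K" "k \<in> K"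
  shows "frame_proj r w (w k) = (if k \<in> {1..r} then w k else 0)"
proof -
  have "frame_proj r w (w k) = (\<Sum>m=1..r. if m = k then w k else 0)"
    unfolding frame_proj_def using assms(2,3) by (intro sum.cong) (auto simp: orthonormal_onD[OF assms(1)])
  then show ?thesis by simp
qed

lemma frame_proj_idem:
  assumes "orthonormal_on {1..r} w"
  shows "frame_proj r w (frame_proj r w x) = frame_proj r w x"
proof -
  have "frame_proj r w (frame_proj r w x) = (\<Sum>m=1..r. (w m \<bullet> x) *\<^sub>R frame_proj r w (w m))"
    by (subst (2) frame_proj_def) (simp only: linear_sum[OF linear_frame_proj] linear_scale[OF linear_frame_proj])
  also have "\<dots> = frame_proj r w x"
    unfolding frame_proj_def[of r w x] by (intro sum.cong) (auto simp: frame_proj_basis[OF assms])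
  finally show ?thesis .
qed

lemma frame_proj_inner_frame_proj:
  assumes "orthonormal_on {1..r} w"
  shows "frame_proj r w x \<bullet> frame_proj r w z = frame_proj r w x \<bullet> z"
  by (metis frame_proj_idem[OF assms] frame_proj_sym)

lemma frame_proj_diag_bounds:
  assumes "orthonormal_on {1..r} w"
  shows "0 \<le> frame_proj r w x \<bullet> x" "frame_proj r w x \<bullet> x \<le> x \<bullet> x"
proof -
  let ?p = "frame_proj r w x"
  have e: "?p \<bullet> x = ?p \<bullet> ?p" using frame_proj_inner_frame_proj[OF assms] by simp
  then show "0 \<le> ?p \<bullet> x" by simp
  have "0 \<le> (x - ?p) \<bullet> (x - ?p)" by simp
  then show "?p \<bullet> x \<le> x \<bullet> x"
    using e by (simp add: inner_diff_left inner_diff_right inner_commute)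
qed

text \<open>The trace of a projection is its rank, whatever basis is used to compute it.\<close>

lemma frame_proj_trace:
  fixes v w :: "nat \<Rightarrow> real^'q"
  assumes "orthonormal_on {1..CARD('q)} v" "orthonormal_on {1..r} w"
  shows "(\<Sum>k=1..CARD('q). frame_proj r w (v k) \<bullet> v k) = real r"
proof -
  have "(\<Sum>k=1..CARD('q). frame_proj r w (v k) \<bullet> v k) = (\<Sum>m=1..r. \<Sum>k=1..CARD('q). (w m \<bullet> v k) * (w m \<bullet> v k))"
    by (simp only: frame_proj_inner) (rule sum.swap)
  also have "\<dots> = (\<Sum>m=1..r. w m \<bullet> w m)"
    by (rule sum.cong[OF refl], rule orthonormal_parseval[OF assms(1), symmetric])
  also have "\<dots> = (\<Sum>m=1..r. 1)" by (intro sum.cong) (auto simp: orthonormal_onD[OF assms(2)])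
  finally show ?thesis by simp
qed

text \<open>$\sum_{m \le r} \|y w_m\|^2$ is the trace of $A$ times the projection onto the frame $w$, here
evaluated in the eigenbasis of $A$.\<close>

lemma energy_eq:
  fixes y :: "real^'q^'p"
  assumes "is_svd y d u v"
  shows "(\<Sum>m=1..r. (norm (y *v w m))\<^sup>2) = (\<Sum>k=1..CARD('q). (d k)\<^sup>2 * (frame_proj r w (v k) \<bullet> v k))"
proof -
  have on: "orthonormal_on {1..CARD('q)} v" using assms unfolding is_svd_def by auto
  have "(norm (y *v x))\<^sup>2 = (\<Sum>k=1..CARD('q). (d k)\<^sup>2 * ((x \<bullet> v k) * (x \<bullet> v k)))" for x
  proof -
    have "(norm (y *v x))\<^sup>2 = gram y x \<bullet> x" by (simp add: gram_inner power2_norm_eq_inner)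
    also have "\<dots> = (\<Sum>k=1..CARD('q). (gram y x \<bullet> v k) * (x \<bullet> v k))"
      by (rule orthonormal_parseval[OF on])
    also have "\<dots> = (\<Sum>k=1..CARD('q). (d k)\<^sup>2 * ((x \<bullet> v k) * (x \<bullet> v k)))"
      by (intro sum.cong) (auto simp: gram_symmetric svd_gram[OF assms])
    finally show ?thesis .
  qed
  then have "(\<Sum>m=1..r. (norm (y *v w m))\<^sup>2) = (\<Sum>m=1..r. \<Sum>k=1..CARD('q). (d k)\<^sup>2 * ((w m \<bullet> v k) * (w m \<bullet> v k)))"
    by simp
  also have "\<dots> = (\<Sum>k=1..CARD('q). \<Sum>m=1..r. (d k)\<^sup>2 * ((w m \<bullet> v k) * (w m \<bullet> v k)))"
    by (rule sum.swap)
  finally show ?thesis by (simp only: frame_proj_inner sum_distrib_left)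
qed

lemma distinct_svdD:
  fixes y :: "real^'q^'p"
  assumes "is_distinct_svd y d u v"
  shows "is_svd y d u v" "orthonormal_on {1..CARD('q)} v" "orthonormal_on {1..CARD('q)} u"
    "\<And>k. k \<in> {1..CARD('q)} \<Longrightarrow> 0 \<le> d k"
    "\<And>k l. 1 \<le> k \<Longrightarrow> k < l \<Longrightarrow> l \<le> CARD('q) \<Longrightarrow> d l < d k"
    "\<And>k l. 1 \<le> k \<Longrightarrow> k < l \<Longrightarrow> l \<le> CARD('q) \<Longrightarrow> (d l)\<^sup>2 < (d k)\<^sup>2"
    "\<And>k l. 1 \<le> k \<Longrightarrow> k \<le> l \<Longrightarrow> l \<le> CARD('q) \<Longrightarrow> (d l)\<^sup>2 \<le> (d k)\<^sup>2"
proof -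
  show *: "is_svd y d u v" "orthonormal_on {1..CARD('q)} v" "orthonormal_on {1..CARD('q)} u"
    and nn: "\<And>k. k \<in> {1..CARD('q)} \<Longrightarrow> 0 \<le> d k"
    using assms unfolding is_distinct_svd_def is_svd_def by auto
  show lt: "d l < d k" if "1 \<le> k" "k < l" "l \<le> CARD('q)" for k l
    using that assms unfolding is_distinct_svd_def by auto
  show lt2: "(d l)\<^sup>2 < (d k)\<^sup>2" if "1 \<le> k" "k < l" "l \<le> CARD('q)" for k l
    using lt[OF that] nn[of l] that by (intro power_strict_mono) auto
  show "(d l)\<^sup>2 \<le> (d k)\<^sup>2" if "1 \<le> k" "k \<le> l" "l \<le> CARD('q)" for k l
    using lt2[of k l] that by (cases "k = l") auto
qed

text \<open>Ky Fan's maximum principle with a quantitative gap. With $p_k = \langle P_w v_k, v_k \rangle \in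
[0,1]$ and $\sum_k p_k = r$, the mass $s = \sum_{k \le r} (1 - p_k)$ that $P_w$ misses on the top $r$ directions
reappears on the others; each unit that is moved costs at least $d_r^2 - d_{r+1}^2$.\<close>

lemma ky_fan_gap:
  fixes y :: "real^'q^'p"
  assumes svd: "is_distinct_svd y d u v" and w: "orthonormal_on {1..r} w"
    and r: "1 \<le> r" "r < CARD('q)"
  shows "((d r)\<^sup>2 - (d (r+1))\<^sup>2) * (\<Sum>k=1..r. 1 - frame_proj r w (v k) \<bullet> v k)
     \<le> (\<Sum>k=1..r. (norm (y *v v k))\<^sup>2) - (\<Sum>m=1..r. (norm (y *v w m))\<^sup>2)"
    and "(\<Sum>k=r+1..CARD('q). frame_proj r w (v k) \<bullet> v k) = (\<Sum>k=1..r. 1 - frame_proj r w (v k) \<bullet> v k)"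
proof -
  note D = distinct_svdD[OF svd]
  define p where "p k = frame_proj r w (v k) \<bullet> v k" for k
  have U: "{1..CARD('q)} = {1..r} \<union> {r+1..CARD('q)}" using r by auto
  have split: "(\<Sum>k=1..CARD('q). f k) = (\<Sum>k=1..r. f k) + (\<Sum>k=r+1..CARD('q). f k)" for f :: "nat \<Rightarrow> real"
    unfolding U by (rule sum.union_disjoint) auto
  have p: "0 \<le> p k" "p k \<le> 1" if "k \<in> {1..CARD('q)}" for k
    using frame_proj_diag_bounds[OF w, of "v k"] orthonormal_onD[OF D(2) that that] by (auto simp: p_def)
  show s: "(\<Sum>k=r+1..CARD('q). frame_proj r w (v k) \<bullet> v k) = (\<Sum>k=1..r. 1 - frame_proj r w (v k) \<bullet> v k)"
    using frame_proj_trace[OF D(2) w] split[of p] by (simp add: p_def sum_subtractf)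
  have "norm (u k) = 1" if "k \<in> {1..CARD('q)}" for k
    using orthonormal_onD[OF D(3) that that] by (simp add: norm_eq_1)
  then have "(\<Sum>k=1..r. (norm (y *v v k))\<^sup>2) = (\<Sum>k=1..r. (d k)\<^sup>2)"
    using r by (intro sum.cong) (auto simp: svd_matrix_vector[OF D(1)])
  moreover have "(\<Sum>m=1..r. (norm (y *v w m))\<^sup>2) = (\<Sum>k=1..r. (d k)\<^sup>2 * p k) + (\<Sum>k=r+1..CARD('q). (d k)\<^sup>2 * p k)"
    unfolding energy_eq[OF D(1)] split by (simp add: p_def)
  moreover have "(d r)\<^sup>2 * (\<Sum>k=1..r. 1 - p k) \<le> (\<Sum>k=1..r. (d k)\<^sup>2 * (1 - p k))"
    unfolding sum_distrib_left using r p D(7) by (intro sum_mono mult_right_mono) auto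
  moreover have "(\<Sum>k=r+1..CARD('q). (d k)\<^sup>2 * p k) \<le> (d (r+1))\<^sup>2 * (\<Sum>k=r+1..CARD('q). p k)"
    unfolding sum_distrib_left using r p D(7) by (intro sum_mono mult_right_mono) auto
  ultimately show "((d r)\<^sup>2 - (d (r+1))\<^sup>2) * (\<Sum>k=1..r. 1 - frame_proj r w (v k) \<bullet> v k)
     \<le> (\<Sum>k=1..r. (norm (y *v v k))\<^sup>2) - (\<Sum>m=1..r. (norm (y *v w m))\<^sup>2)"
    using s unfolding p_def[symmetric] by (simp add: left_diff_distrib right_diff_distrib sum_subtractf)
qed

text \<open>By idempotence $\|P_w v_k\|^2 = p_k$, so the squared distance is $1 - p_k$ for $k \le r$ and
$p_k$ for $k > r$; both are summands of the missing mass.\<close>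

lemma frame_proj_dist_le:
  fixes y :: "real^'q^'p"
  assumes svd: "is_distinct_svd y d u v" and w: "orthonormal_on {1..r} w"
    and r: "1 \<le> r" "r < CARD('q)" and k: "k \<in> {1..CARD('q)}"
  shows "(norm (frame_proj r w (v k) - frame_proj r v (v k)))\<^sup>2 \<le> (\<Sum>k=1..r. 1 - frame_proj r w (v k) \<bullet> v k)"
proof -
  note D = distinct_svdD[OF svd]
  define p where "p k = frame_proj r w (v k) \<bullet> v k" for k
  have p: "0 \<le> p k" "p k \<le> 1" if "k \<in> {1..CARD('q)}" for k
    using frame_proj_diag_bounds[OF w, of "v k"] orthonormal_onD[OF D(2) that that] by (auto simp: p_def)
  have sq: "frame_proj r w (v k) \<bullet> frame_proj r w (v k) = p k" using frame_proj_inner_frame_proj[OF w] by (simp add: p_def)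
  have vk: "v k \<bullet> v k = 1" using orthonormal_onD[OF D(2) k k] by simp
  have tv: "frame_proj r v (v k) = (if k \<in> {1..r} then v k else 0)"
    using frame_proj_basis[OF D(2) _ k] r by auto
  show ?thesis
  proof (cases "k \<le> r")
    case True
    have "(norm (frame_proj r w (v k) - frame_proj r v (v k)))\<^sup>2 = 1 - p k"
      using True k by (simp add: tv power2_norm_eq_inner inner_diff_left inner_diff_right sq vk inner_commute p_def)
    also have "\<dots> \<le> (\<Sum>k=1..r. 1 - p k)"
      using True k p r by (intro member_le_sum) auto
    finally show ?thesis by (simp add: p_def)
  next
    case False
    have "(norm (frame_proj r w (v k) - frame_proj r v (v k)))\<^sup>2 = p k"
      using False by (simp add: tv power2_norm_eq_inner sq)
    also have "\<dots> \<le> (\<Sum>k=r+1..CARD('q). p k)"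
      using False k p r by (intro member_le_sum) auto
    finally show ?thesis using ky_fan_gap(2)[OF svd w r] by (simp add: p_def)
  qed
qed

lemma norm_square_diff_le:
  fixes y y' :: "real^'q^'p"
  assumes "norm x = 1"
  shows "(norm (y *v x))\<^sup>2 - (norm (y' *v x))\<^sup>2 \<le> norm (y - y') * (norm y + norm y')"
proof -
  have "(norm (y *v x))\<^sup>2 - (norm (y' *v x))\<^sup>2 =
     (norm (y *v x) - norm (y' *v x)) * (norm (y *v x) + norm (y' *v x))"
    by (simp add: power2_eq_square algebra_simps)
  also have "\<dots> \<le> norm (y - y') * (norm y + norm y')"
  proof (rule mult_mono)
    have "norm (y *v x) - norm (y' *v x) \<le> norm (y *v x - y' *v x)" by (rule norm_triangle_ineq2)
    also have "\<dots> = norm ((y - y') *v x)" by (simp add: matrix_vector_mult_diff_rdistrib)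
    also have "\<dots> \<le> norm (y - y')" using norm_matrix_vector_le[of "y - y'" x] assms by simp
    finally show "norm (y *v x) - norm (y' *v x) \<le> norm (y - y')" .
    show "norm (y *v x) + norm (y' *v x) \<le> norm y + norm y'"
      using norm_matrix_vector_le[of y x] norm_matrix_vector_le[of y' x] assms by simp
  qed auto
  finally show ?thesis .
qed

text \<open>The single estimate behind well-definedness and continuity of the top projection. It is a
bound of order $1/2$ in $\|y - y'\|$, but continuity is all that the derivative argument needs.\<close>

lemma frame_proj_perturbation:
  fixes y y' :: "real^'q^'p"
  assumes svd: "is_distinct_svd y d u v" and svd': "is_distinct_svd y' d' u' v'"
    and r: "1 \<le> r" "r < CARD('q)" and k: "k \<in> {1..CARD('q)}"
  shows "((d r)\<^sup>2 - (d (r+1))\<^sup>2) * (norm (frame_proj r v' (v k) - frame_proj r v (v k)))\<^sup>2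
    \<le> 2 * r * (norm (y - y') * (norm y + norm y'))"
proof -
  note D = distinct_svdD[OF svd] and D' = distinct_svdD[OF svd']
  let ?N = "norm (y - y') * (norm y + norm y')"
  have on: "orthonormal_on {1..r} v" "orthonormal_on {1..r} v'"
    using D(2) D'(2) r by (auto elim!: orthonormal_on_subset)
  have n: "norm (v m) = 1" "norm (v' m) = 1" if "m \<in> {1..r}" for m
    using on that by (auto simp: orthonormal_on_def norm_eq_1)
  have gap: "0 \<le> (d r)\<^sup>2 - (d (r+1))\<^sup>2" "0 \<le> (d' r)\<^sup>2 - (d' (r+1))\<^sup>2"
    using D(7)[of r "r+1"] D'(7)[of r "r+1"] r by auto
  have "((d r)\<^sup>2 - (d (r+1))\<^sup>2) * (norm (frame_proj r v' (v k) - frame_proj r v (v k)))\<^sup>2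
     \<le> ((d r)\<^sup>2 - (d (r+1))\<^sup>2) * (\<Sum>k=1..r. 1 - frame_proj r v' (v k) \<bullet> v k)"
    using frame_proj_dist_le[OF svd on(2) r k] gap by (intro mult_left_mono) auto
  also have "\<dots> \<le> (\<Sum>k=1..r. (norm (y *v v k))\<^sup>2) - (\<Sum>m=1..r. (norm (y *v v' m))\<^sup>2)"
    by (rule ky_fan_gap[OF svd on(2) r])
  \<comment> \<open>Both energies move by at most $r \|y - y'\| (\|y\| + \|y'\|)$ when $y$ is replaced by $y'$, and for $y'$ itself the frame $v'$ is optimal.\<close>
  also have "\<dots> \<le> ((\<Sum>k=1..r. (norm (y' *v v k))\<^sup>2) + r * ?N) - ((\<Sum>m=1..r. (norm (y' *v v' m))\<^sup>2) - r * ?N)"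
  proof (rule diff_mono)
    have "(\<Sum>k=1..r. (norm (y *v v k))\<^sup>2) \<le> (\<Sum>k=1..r. (norm (y' *v v k))\<^sup>2 + ?N)"
      using norm_square_diff_le[OF n(1), of _ y y'] by (intro sum_mono) (simp add: diff_le_eq add.commute)
    then show "(\<Sum>k=1..r. (norm (y *v v k))\<^sup>2) \<le> (\<Sum>k=1..r. (norm (y' *v v k))\<^sup>2) + r * ?N"
      by (simp add: sum.distrib)
    have "(\<Sum>k=1..r. (norm (y' *v v' k))\<^sup>2) \<le> (\<Sum>k=1..r. (norm (y *v v' k))\<^sup>2 + ?N)"
      using norm_square_diff_le[OF n(2), of _ y' y]
      by (intro sum_mono) (simp add: diff_le_eq add.commute norm_minus_commute)
    then show "(\<Sum>m=1..r. (norm (y' *v v' m))\<^sup>2) - r * ?N \<le> (\<Sum>m=1..r. (norm (y *v v' m))\<^sup>2)"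
      by (simp add: sum.distrib)
  qed
  also have "\<dots> \<le> 2 * real r * ?N"
  proof -
    have "0 \<le> (\<Sum>k=1..r. 1 - frame_proj r v (v' k) \<bullet> v' k)"
    proof (rule sum_nonneg)
      fix k assume k: "k \<in> {1..r}"
      show "0 \<le> 1 - frame_proj r v (v' k) \<bullet> v' k"
        using frame_proj_diag_bounds(2)[OF on(1), of "v' k"] orthonormal_onD[OF on(2) k k] by simp
    qed
    then have "0 \<le> ((d' r)\<^sup>2 - (d' (r+1))\<^sup>2) * (\<Sum>k=1..r. 1 - frame_proj r v (v' k) \<bullet> v' k)"
      using gap by simp
    also have "\<dots> \<le> (\<Sum>k=1..r. (norm (y' *v v' k))\<^sup>2) - (\<Sum>m=1..r. (norm (y' *v v m))\<^sup>2)"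
      by (rule ky_fan_gap[OF svd' on(1) r])
    finally show ?thesis by simp
  qed
  finally show ?thesis .
qed

lemma linear_eq_on_orthonormal:
  fixes v :: "nat \<Rightarrow> real^'q"
  assumes "orthonormal_on {1..CARD('q)} v" "linear f" "linear g"
    and "\<And>k. k \<in> {1..CARD('q)} \<Longrightarrow> f (v k) = g (v k)"
  shows "f = g"
proof
  fix x
  have "f (\<Sum>k=1..CARD('q). (x \<bullet> v k) *\<^sub>R v k) = g (\<Sum>k=1..CARD('q). (x \<bullet> v k) *\<^sub>R v k)"
    by (simp only: linear_sum[OF assms(2)] linear_sum[OF assms(3)] linear_scale[OF assms(2)] linear_scale[OF assms(3)])
      (simp add: assms(4))
  then show "f x = g x" unfolding orthonormal_expand[OF assms(1)] .
qed

text \<open>The case $y' = y$ of the perturbation bound: its right-hand side vanishes and the gap is positive.\<close>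

lemma frame_proj_unique:
  fixes y :: "real^'q^'p"
  assumes svd: "is_distinct_svd y d u v" and svd': "is_distinct_svd y d' u' v'"
    and r: "1 \<le> r" "r < CARD('q)"
  shows "frame_proj r v' = frame_proj r v"
proof (rule linear_eq_on_orthonormal[OF distinct_svdD(2)[OF svd] linear_frame_proj linear_frame_proj])
  fix k assume k: "k \<in> {1..CARD('q)}"
  have "(d (r+1))\<^sup>2 < (d r)\<^sup>2" using distinct_svdD(6)[OF svd, of r "r+1"] r by simp
  then show "frame_proj r v' (v k) = frame_proj r v (v k)"
    using frame_proj_perturbation[OF svd svd' r k] by (simp add: mult_le_0_iff)
qed

section \<open>The estimator as a matrix times a projection\<close>

text \<open>An arbitrary choice that only matters through the projection onto its first $r$ members, which is
the same for every choice.\<close>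

definition right_singular_vectors :: "real^'q^'p \<Rightarrow> nat \<Rightarrow> real^'q" where
  "right_singular_vectors y = (SOME v. \<exists>d u. is_distinct_svd y d u v)"

definition top_projection :: "nat \<Rightarrow> real^'q^'p \<Rightarrow> real^'q \<Rightarrow> real^'q" where
  "top_projection r y = frame_proj r (right_singular_vectors y)"

lemma top_projection_eq:
  assumes svd: "is_distinct_svd (y::real^'q^'p) d u v" and r: "1 \<le> r" "r < CARD('q)"
  shows "top_projection r y = frame_proj r v"
proof -
  have "\<exists>d u. is_distinct_svd y d u (right_singular_vectors y)"
    unfolding right_singular_vectors_def using someI_ex[of "\<lambda>v. \<exists>d u. is_distinct_svd y d u v"] svd by blast
  then show ?thesis unfolding top_projection_def using frame_proj_unique[OF svd _ r] by blast
qed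

lemma truncated_svd_apply:
  fixes y :: "real^'q^'p"
  assumes svd: "is_svd y d u v" and r: "r < CARD('q)"
  shows "(\<Sum>k=1..r. d k *\<^sub>R outer_product (u k) (v k)) *v x = y *v frame_proj r v x"
proof -
  have "(\<Sum>k=1..r. d k *\<^sub>R outer_product (u k) (v k)) *v x = (\<Sum>k=1..r. (v k \<bullet> x) *\<^sub>R (y *v v k))"
    unfolding sum_matrix_vector
  proof (rule sum.cong)
    fix k assume "k \<in> {1..r}"
    then have "k \<in> {1..CARD('q)}" using r by auto
    then show "(d k *\<^sub>R outer_product (u k) (v k)) *v x = (v k \<bullet> x) *\<^sub>R (y *v v k)"
      by (simp add: scaleR_matrix_vector outer_product_mult svd_matrix_vector[OF svd] mult.commute)
  qed simp
  also have "\<dots> = y *v frame_proj r v x"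
    unfolding frame_proj_def by (simp only: linear_sum[OF matrix_vector_mul_linear] matrix_vector_mult_scaleR)
  finally show ?thesis .
qed

lemma estimator_eq_truncated:
  fixes y :: "real^'q^'p"
  assumes svd: "is_distinct_svd y d u v" and r: "1 \<le> r" "r < CARD('q)"
  shows "reduced_rank_estimator r y = (\<Sum>k=1..r. d k *\<^sub>R outer_product (u k) (v k))"
proof -
  have "m = (\<Sum>k=1..r. d k *\<^sub>R outer_product (u k) (v k))"
    if "is_distinct_svd y d' u' v'" "m = (\<Sum>k=1..r. d' k *\<^sub>R outer_product (u' k) (v' k))" for m d' u' v'
    unfolding matrix_eq using that(2) truncated_svd_apply[OF distinct_svdD(1)[OF svd] r(2)]
      truncated_svd_apply[OF distinct_svdD(1)[OF that(1)] r(2)] frame_proj_unique[OF svd that(1) r] by simp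
  then have "(THE m. \<exists>d u v. is_distinct_svd y d u v \<and> m = (\<Sum>k=1..r. d k *\<^sub>R outer_product (u k) (v k)))
      = (\<Sum>k=1..r. d k *\<^sub>R outer_product (u k) (v k))"
    using svd by (intro the_equality) blast+
  moreover have "distinct_singular_values y" using svd unfolding distinct_singular_values_def by blast
  ultimately show ?thesis unfolding reduced_rank_estimator_def by simp
qed

lemma estimator_apply:
  fixes y :: "real^'q^'p"
  assumes svd: "is_distinct_svd y d u v" and r: "1 \<le> r" "r < CARD('q)"
  shows "reduced_rank_estimator r y *v x = y *v top_projection r y x"
  unfolding estimator_eq_truncated[OF assms] truncated_svd_apply[OF distinct_svdD(1)[OF svd] r(2)]
    top_projection_eq[OF assms] ..

lemma matrix_entry: "y $ i $ j = (y *v axis j 1) $ i" for y :: "real^'q^'p"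
  by (simp add: matrix_vector_mul_component inner_axis)

lemma estimator_entry:
  fixes y :: "real^'q^'p"
  assumes "CARD('q) \<le> CARD('p)" "\<not> repeated_singular_value y" "1 \<le> r" "r < CARD('q)"
  shows "reduced_rank_estimator r y $ i $ j = (y *v top_projection r y (axis j 1)) $ i"
  using not_repeated_distinct_svd[OF assms(1,2)] estimator_apply assms(3,4) matrix_entry by metis

section \<open>Derivative of the top projection\<close>

lemma eventually_not_repeated:
  assumes "(Y \<longlongrightarrow> y) F" "\<not> repeated_singular_value y"
  shows "\<forall>\<^sub>F t in F. \<not> repeated_singular_value (Y t :: real^'q^'p)"
proof -
  have "open (- {y :: real^'q^'p. repeated_singular_value y})" using closed_repeated by (simp add: closed_def)
  from topological_tendstoD[OF assms(1) this] assms(2) show ?thesis by simp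
qed

lemma top_projection_tendsto:
  fixes y :: "real^'q^'p"
  assumes Y: "(Y \<longlongrightarrow> y) F" and svd: "is_distinct_svd y d u v" and pq: "CARD('q) \<le> CARD('p)"
    and r: "1 \<le> r" "r < CARD('q)" and k: "k \<in> {1..CARD('q)}"
  shows "((\<lambda>t. top_projection r (Y t) (v k)) \<longlongrightarrow> top_projection r y (v k)) F"
proof -
  define gap where "gap = (d r)\<^sup>2 - (d (r+1))\<^sup>2"
  have gap: "0 < gap" using distinct_svdD(6)[OF svd, of r "r+1"] r by (simp add: gap_def)
  have bound: "norm (top_projection r y' (v k) - top_projection r y (v k)) \<le> sqrt (2 * real r * (norm (y - y') * (norm y + norm y')) / gap)"
    if nr: "\<not> repeated_singular_value y'" for y'
  proof (rule real_le_rsqrt)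
    obtain d' u' v' where svd': "is_distinct_svd y' d' u' v'"
      using not_repeated_distinct_svd[OF pq nr] by blast
    show "(norm (top_projection r y' (v k) - top_projection r y (v k)))\<^sup>2 \<le> 2 * real r * (norm (y - y') * (norm y + norm y')) / gap"
      using frame_proj_perturbation[OF svd svd' r k] gap
      unfolding top_projection_eq[OF svd r] top_projection_eq[OF svd' r] gap_def[symmetric] by (simp add: field_simps)
  qed
  have "((\<lambda>t. sqrt (2 * real r * (norm (y - Y t) * (norm y + norm (Y t))) / gap)) \<longlongrightarrow>
      sqrt (2 * real r * (norm (y - y) * (norm y + norm y)) / gap)) F"
    by (intro tendsto_intros Y) (use gap in auto)
  then have lim: "((\<lambda>t. sqrt (2 * real r * (norm (y - Y t) * (norm y + norm (Y t))) / gap)) \<longlongrightarrow> 0) F"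
    by simp
  have "((\<lambda>t. top_projection r (Y t) (v k) - top_projection r y (v k)) \<longlongrightarrow> 0) F"
    by (rule Lim_null_comparison[OF _ lim])
      (rule eventually_mono[OF eventually_not_repeated[OF Y distinct_not_repeated[OF svd]] bound])
  then show ?thesis by (simp add: LIM_zero_iff)
qed

text \<open>The top projection is built from eigenvectors of the Gram operator, so the two commute.\<close>

lemma top_projection_gram_commute:
  fixes y :: "real^'q^'p"
  assumes svd: "is_distinct_svd y d u v" and r: "1 \<le> r" "r < CARD('q)"
  shows "top_projection r y x \<bullet> gram y z = gram y x \<bullet> top_projection r y z"
proof -
  have g: "v m \<bullet> gram y x = (d m)\<^sup>2 * (v m \<bullet> x)" if "m \<in> {1..r}" for m x
  proof -
    have "v m \<bullet> gram y x = gram y (v m) \<bullet> x" by (rule gram_symmetric[symmetric])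
    then show ?thesis
      using that r svd_gram[OF distinct_svdD(1)[OF svd], of m] by simp
  qed
  have "top_projection r y x \<bullet> gram y z = (\<Sum>m=1..r. (v m \<bullet> x) * ((d m)\<^sup>2 * (v m \<bullet> z)))"
    unfolding top_projection_eq[OF svd r] frame_proj_inner by (intro sum.cong) (auto simp: g)
  moreover have "gram y x \<bullet> top_projection r y z = (\<Sum>m=1..r. (v m \<bullet> z) * ((d m)\<^sup>2 * (v m \<bullet> x)))"
    unfolding top_projection_eq[OF svd r] inner_commute[of "gram y x"] frame_proj_inner
    by (intro sum.cong) (auto simp: g)
  ultimately show ?thesis by (simp add: mult_ac)
qed

text \<open>The commutator identity for $P' = P(y')$: in $\langle P' v_k, v_l \rangle (d_k^2 - d_l^2)$ replace
$d_k^2 v_k$ by $A v_k = A' v_k - (A' - A) v_k$, likewise for $l$, and let the $A'$ terms cancel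
because $P'$ commutes with $A'$. The identity is exact, not a first-order expansion.\<close>

lemma top_projection_offdiag:
  fixes y y' :: "real^'q^'p"
  assumes svd: "is_distinct_svd y d u v" and svd': "is_distinct_svd y' d' u' v'"
    and r: "1 \<le> r" "r < CARD('q)" and k: "k \<in> {1..CARD('q)}" and l: "l \<in> {1..CARD('q)}"
  shows "((d k)\<^sup>2 - (d l)\<^sup>2) * (top_projection r y' (v k) \<bullet> v l) =
    (gram y' (v l) - gram y (v l)) \<bullet> top_projection r y' (v k) - (gram y' (v k) - gram y (v k)) \<bullet> top_projection r y' (v l)"
proof -
  have sym: "v k \<bullet> top_projection r y' (v l) = top_projection r y' (v k) \<bullet> v l"
    unfolding top_projection_eq[OF svd' r] by (simp add: frame_proj_sym)
  have "gram y' (v l) \<bullet> top_projection r y' (v k) = gram y' (v k) \<bullet> top_projection r y' (v l)"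
    using top_projection_gram_commute[OF svd' r, of "v k" "v l"] by (simp add: inner_commute)
  then show ?thesis
    by (simp add: inner_diff_left svd_gram[OF distinct_svdD(1)[OF svd] k] svd_gram[OF distinct_svdD(1)[OF svd] l]
        sym left_diff_distrib inner_commute[of "v l"])
qed

text \<open>The bilinear form of the derivative $h^T y + y^T h$ of $y \mapsto y^T y$ in direction $h$.\<close>

definition gram_derivative :: "real^'q^'p \<Rightarrow> real^'q^'p \<Rightarrow> real^'q \<Rightarrow> real^'q \<Rightarrow> real" where
  "gram_derivative y h x z = (h *v x) \<bullet> (y *v z) + (y *v x) \<bullet> (h *v z)"

lemma gram_derivative_commute: "gram_derivative y h x z = gram_derivative y h z x"
  by (simp add: gram_derivative_def inner_commute)

lemma gram_line:
  fixes y h :: "real^'q^'p"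
  shows "(gram (y + t *\<^sub>R h) x - gram y x) \<bullet> z = t * (gram_derivative y h x z + t * ((h *v x) \<bullet> (h *v z)))"
  by (simp add: inner_diff_left gram_inner gram_derivative_def matrix_vector_mult_add_rdistrib scaleR_matrix_vector
      inner_add_left inner_add_right algebra_simps)

lemma line_tendsto: "((\<lambda>t. y + t *\<^sub>R h) \<longlongrightarrow> y) (at (0::real))" for y :: "'a::real_normed_vector"
proof -
  have "((\<lambda>t. y + t *\<^sub>R h) \<longlongrightarrow> y + 0 *\<^sub>R h) (at (0::real))"
    by (intro tendsto_intros)
  then show ?thesis by simp
qed

text \<open>Divide the commutator identity by $t$. The factor $A' - A$ is of order $t$, so the limit
needs only continuity of the projection.\<close>

lemma top_projection_offdiag_deriv:
  fixes y h :: "real^'q^'p"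
  assumes svd: "is_distinct_svd y d u v" and pq: "CARD('q) \<le> CARD('p)"
    and r: "1 \<le> r" "r < CARD('q)" and k: "k \<in> {1..CARD('q)}" and l: "l \<in> {1..CARD('q)}" and kl: "k \<noteq> l"
  shows "((\<lambda>t. (top_projection r (y + t *\<^sub>R h) (v k) \<bullet> v l) / t) \<longlongrightarrow>
     ((if k \<le> r then 1 else 0) - (if l \<le> r then 1 else 0)) * gram_derivative y h (v k) (v l) / ((d k)\<^sup>2 - (d l)\<^sup>2)) (at 0)"
proof -
  let ?P = "\<lambda>t. top_projection r (y + t *\<^sub>R h)"
  note D = distinct_svdD[OF svd]
  have ne: "(d k)\<^sup>2 - (d l)\<^sup>2 \<noteq> 0"
    using D(6)[of k l] D(6)[of l k] k l kl by (auto simp: neq_iff)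
  have P0: "top_projection r y (v m) = (if m \<le> r then v m else 0)" if "m \<in> {1..CARD('q)}" for m
    using frame_proj_basis[OF D(2) _ that] r that unfolding top_projection_eq[OF svd r] by auto
  have lim: "((\<lambda>t. ?P t (v m)) \<longlongrightarrow> (if m \<le> r then v m else 0)) (at 0)" if "m \<in> {1..CARD('q)}" for m
    using top_projection_tendsto[OF line_tendsto svd pq r that, of h] P0[OF that] by simp
  let ?N = "\<lambda>t. (gram_derivative y h (v l) (?P t (v k)) + t * ((h *v v l) \<bullet> (h *v ?P t (v k))))
       - (gram_derivative y h (v k) (?P t (v l)) + t * ((h *v v k) \<bullet> (h *v ?P t (v l))))"
  let ?Q = "\<lambda>t. ?N t / ((d k)\<^sup>2 - (d l)\<^sup>2)"
  have mv: "((\<lambda>t. a *v ?P t (v m)) \<longlongrightarrow> a *v (if m \<le> r then v m else 0)) (at 0)"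
    if "m \<in> {1..CARD('q)}" for m and a :: "real^'q^'p"
    by (rule bounded_linear.tendsto[OF matrix_vector_mul_bounded_linear lim[OF that]])
  have "(?Q \<longlongrightarrow> ((gram_derivative y h (v l) (if k \<le> r then v k else 0) + 0 * ((h *v v l) \<bullet> (h *v (if k \<le> r then v k else 0))))
       - (gram_derivative y h (v k) (if l \<le> r then v l else 0) + 0 * ((h *v v k) \<bullet> (h *v (if l \<le> r then v l else 0))))) / ((d k)\<^sup>2 - (d l)\<^sup>2)) (at 0)"
    unfolding gram_derivative_def by (intro tendsto_intros mv k l ne)
  moreover have "gram_derivative y h x 0 = 0" "gram_derivative y h 0 x = 0" for x by (simp_all add: gram_derivative_def)
  ultimately have Q: "(?Q \<longlongrightarrow> ((if k \<le> r then 1 else 0) - (if l \<le> r then 1 else 0)) * gram_derivative y h (v k) (v l) / ((d k)\<^sup>2 - (d l)\<^sup>2)) (at 0)"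
    by (auto simp: gram_derivative_commute[of y h "v l"] split: if_splits)
  have "\<forall>\<^sub>F t in at 0. \<not> repeated_singular_value (y + t *\<^sub>R h)"
    by (rule eventually_not_repeated[OF line_tendsto distinct_not_repeated[OF svd]])
  then have "\<forall>\<^sub>F t in at 0. ?Q t = (?P t (v k) \<bullet> v l) / t"
    using eventually_neq_at_within[of 0 0 UNIV]
  proof eventually_elim
    case (elim t)
    obtain d' u' v' where svd': "is_distinct_svd (y + t *\<^sub>R h) d' u' v'"
      using not_repeated_distinct_svd[OF pq elim(1)] by blast
    have "((d k)\<^sup>2 - (d l)\<^sup>2) * (?P t (v k) \<bullet> v l) = t * ?N t"
      unfolding top_projection_offdiag[OF svd svd' r k l] gram_line by (simp only: right_diff_distrib)
    then show ?case using ne elim(2) by (simp add: frac_eq_eq mult.commute)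
  qed
  then show ?thesis using Q by (rule Lim_transform_eventually[rotated])
qed

text \<open>For $k = l$ the right-hand side is $0$: the diagonal entries are stationary because a projection is idempotent.\<close>

lemma top_projection_deriv:
  fixes y h :: "real^'q^'p"
  assumes svd: "is_distinct_svd y d u v" and pq: "CARD('q) \<le> CARD('p)"
    and r: "1 \<le> r" "r < CARD('q)" and k: "k \<in> {1..CARD('q)}" and l: "l \<in> {1..CARD('q)}"
  shows "((\<lambda>t. top_projection r (y + t *\<^sub>R h) (v k) \<bullet> v l) has_real_derivative
     ((if k \<le> r then 1 else 0) - (if l \<le> r then 1 else 0)) * gram_derivative y h (v k) (v l) / ((d k)\<^sup>2 - (d l)\<^sup>2)) (at 0)"
proof -
  let ?K = "{1..CARD('q)}"
  let ?p = "\<lambda>t k l. top_projection r (y + t *\<^sub>R h) (v k) \<bullet> v l"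
  note D = distinct_svdD[OF svd]
  have P0: "top_projection r y (v m) = (if m \<le> r then v m else 0)" if "m \<in> {1..CARD('q)}" for m
    using frame_proj_basis[OF D(2) _ that] r that unfolding top_projection_eq[OF svd r] by auto
  show ?thesis
  proof (cases "k = l")
    case False
    then have "top_projection r y (v k) \<bullet> v l = 0" using orthonormal_onD[OF D(2) k l] P0[OF k] by simp
    then show ?thesis
      using top_projection_offdiag_deriv[OF svd pq r k l False, of h] by (simp add: DERIV_def)
  next
    case True
    \<comment> \<open>Idempotence gives $p_{kk} (1 - p_{kk}) = \sum_{m \ne k} p_{km}^2$ with $p_{km} = O(t)$, and the factor that does not tend to 0 is divided out.\<close>
    define \<epsilon> where "\<epsilon> = (if k \<le> r then 1 else 0 :: real)"
    have vk: "v k \<bullet> v k = 1" using orthonormal_onD[OF D(2) k k] by simp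
    have lim: "((\<lambda>t. ?p t k k) \<longlongrightarrow> \<epsilon>) (at 0)"
      using tendsto_inner[OF top_projection_tendsto[OF line_tendsto svd pq r k, of h] tendsto_const[of "v k"]] P0[OF k] vk
      by (simp add: \<epsilon>_def split: if_splits)
    have lim0: "((\<lambda>t. ?p t k m * (?p t k m / t)) \<longlongrightarrow> 0) (at 0)" if m: "m \<in> ?K - {k}" for m
    proof -
      have "((\<lambda>t. ?p t k m) \<longlongrightarrow> top_projection r y (v k) \<bullet> v m) (at 0)"
        by (intro tendsto_inner top_projection_tendsto[OF line_tendsto svd pq r k] tendsto_const)
      moreover have "top_projection r y (v k) \<bullet> v m = 0" using orthonormal_onD[OF D(2) k, of m] m P0[OF k] by simp
      ultimately have "((\<lambda>t. ?p t k m) \<longlongrightarrow> 0) (at 0)" by simp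
      from tendsto_mult[OF this top_projection_offdiag_deriv[OF svd pq r k, of m h]] m
      show ?thesis by simp
    qed
    have "((\<lambda>t. (\<Sum>m\<in>?K - {k}. ?p t k m * (?p t k m / t)) / (1 - \<epsilon> - ?p t k k)) \<longlongrightarrow> 0 / (1 - \<epsilon> - \<epsilon>)) (at 0)"
      by (intro tendsto_divide tendsto_null_sum lim0 tendsto_diff tendsto_const lim) (auto simp: \<epsilon>_def)
    then have lim1: "((\<lambda>t. (\<Sum>m\<in>?K - {k}. ?p t k m * (?p t k m / t)) / (1 - \<epsilon> - ?p t k k)) \<longlongrightarrow> 0) (at 0)"
      by simp
    have "\<forall>\<^sub>F t in at 0. \<not> repeated_singular_value (y + t *\<^sub>R h)"
      by (rule eventually_not_repeated[OF line_tendsto distinct_not_repeated[OF svd]])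
    moreover have "\<forall>\<^sub>F t in at 0. 1 - \<epsilon> - ?p t k k \<noteq> 0"
      by (rule tendsto_imp_eventually_ne[of _ "1 - \<epsilon> - \<epsilon>"]) (intro tendsto_intros lim, auto simp: \<epsilon>_def)
    ultimately have "\<forall>\<^sub>F t in at 0. (\<Sum>m\<in>?K - {k}. ?p t k m * (?p t k m / t)) / (1 - \<epsilon> - ?p t k k)
       = (if k \<le> r then 1 else 1) * ((?p t k k - \<epsilon>) / t)"
    proof eventually_elim
      case (elim t)
      obtain d' u' v' where svd': "is_distinct_svd (y + t *\<^sub>R h) d' u' v'"
        using not_repeated_distinct_svd[OF pq elim(1)] by blast
      have on': "orthonormal_on {1..r} v'"
        using distinct_svdD(2)[OF svd'] r by (auto elim!: orthonormal_on_subset)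
      have "?p t k k = top_projection r (y + t *\<^sub>R h) (v k) \<bullet> top_projection r (y + t *\<^sub>R h) (v k)"
        unfolding top_projection_eq[OF svd' r] by (simp add: frame_proj_inner_frame_proj[OF on'])
      also have "\<dots> = (\<Sum>m\<in>?K. ?p t k m * ?p t k m)"
        by (rule orthonormal_parseval[OF D(2)])
      also have "\<dots> = ?p t k k * ?p t k k + (\<Sum>m\<in>?K - {k}. ?p t k m * ?p t k m)"
        using k by (intro sum.remove) auto
      finally have e: "(\<Sum>m\<in>?K - {k}. ?p t k m * ?p t k m) = ?p t k k * (1 - ?p t k k)"
        by (simp add: algebra_simps)
      have "?p t k k * (1 - ?p t k k) = (1 - \<epsilon> - ?p t k k) * (?p t k k - \<epsilon>)"
        by (simp add: \<epsilon>_def algebra_simps)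
      then have "(\<Sum>m\<in>?K - {k}. ?p t k m * (?p t k m / t)) = (1 - \<epsilon> - ?p t k k) * ((?p t k k - \<epsilon>) / t)"
        using e by (simp flip: sum_divide_distrib)
      then show ?case using elim(2) by simp
    qed
    then have "((\<lambda>t. (?p t k k - \<epsilon>) / t) \<longlongrightarrow> 0) (at 0)"
      using lim1 by (auto intro: Lim_transform_eventually)
    moreover have "top_projection r y (v k) \<bullet> v k = \<epsilon>" using P0[OF k] vk by (simp add: \<epsilon>_def)
    ultimately show ?thesis using True by (simp add: DERIV_def)
  qed
qed

section \<open>Partial derivatives and divergence of the estimator\<close>

lemma unit_matrix_apply: "(axis i (axis j 1) :: real^'q^'p) *v x = (x $ j) *\<^sub>R axis i 1"
proof -
  have "((axis i (axis j 1) :: real^'q^'p) *v x) $ m = ((x $ j) *\<^sub>R axis i 1) $ m" for m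
    by (cases "m = i") (simp add: matrix_vector_mul_component inner_axis',
        simp add: matrix_vector_mul_component axis_def)
  then show ?thesis by (simp add: vec_eq_iff)
qed

text \<open>By the product rule the derivative of $(y + t E_{ij}) P(t)$ at entry $(i,j)$ is $P_{jj}$ plus the
contribution of the derivative of $P$. Each pair $k \le r < l$ enters the latter twice, as $(k,l)$ and as $(l,k)$, and
the two contributions combine to a perfect square. Its sign is what drives the integration by
parts later on.\<close>

lemma estimator_partial:
  fixes y :: "real^'q^'p"
  assumes svd: "is_distinct_svd y d u v" and pq: "CARD('q) \<le> CARD('p)"
    and r: "1 \<le> r" "r < CARD('q)"
  shows "(coord_section (reduced_rank_estimator r) y i j has_real_derivative
    (\<Sum>k=1..r. (v k $ j)\<^sup>2) +
    (\<Sum>k=1..r. \<Sum>l=r+1..CARD('q). (d k * u k $ i * v l $ j + d l * u l $ i * v k $ j)\<^sup>2 / ((d k)\<^sup>2 - (d l)\<^sup>2))) (at 0)"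
proof -
  let ?K = "{1..CARD('q)}" and ?h = "axis i (axis j 1) :: real^'q^'p"
  note D = distinct_svdD[OF svd]
  define a where "a k = v k $ j" for k
  define b where "b k = d k * u k $ i" for k
  define \<epsilon> where "\<epsilon> k = (if k \<le> r then 1 else 0 :: real)" for k
  let ?p = "\<lambda>t k l. top_projection r (y + t *\<^sub>R ?h) (v k) \<bullet> v l"
  have yv: "(y *v v k) $ i = b k" if "k \<in> ?K" for k
    by (simp add: svd_matrix_vector[OF D(1) that] b_def)
  have ytv: "((y + t *\<^sub>R ?h) *v v k) $ i = b k + t * a k" if "k \<in> ?K" for k t
    using yv[OF that] by (simp add: matrix_vector_mult_add_rdistrib scaleR_matrix_vector unit_matrix_apply a_def)
  have dg: "gram_derivative y ?h (v k) (v l) = a k * b l + b k * a l" if "k \<in> ?K" "l \<in> ?K" for k l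
    using yv that by (simp add: gram_derivative_def unit_matrix_apply a_def inner_axis inner_axis')
  have P0: "?p 0 k l = (if k = l then \<epsilon> k else 0)" if "k \<in> ?K" "l \<in> ?K" for k l
    using frame_proj_basis[OF D(2) _ that(1), of r] r that orthonormal_onD[OF D(2) that]
    unfolding top_projection_eq[OF svd r] \<epsilon>_def by (auto simp: top_projection_eq[OF svd r])
  \<comment> \<open>The derivative of $p_{kl}$; it is antisymmetric in numerator and denominator, hence symmetric.\<close>
  define c where "c k l = (\<epsilon> k - \<epsilon> l) * (a k * b l + b k * a l) / ((d k)\<^sup>2 - (d l)\<^sup>2)" for k l
  define F where "F t = (\<Sum>k\<in>?K. \<Sum>l\<in>?K. a k * (?p t k l * (b l + t * a l)))" for t
  have pd: "((\<lambda>t. ?p t k l) has_real_derivative c k l) (at 0)" if "k \<in> ?K" "l \<in> ?K" for k l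
    using top_projection_deriv[OF svd pq r that, of ?h] dg[OF that] by (simp add: c_def \<epsilon>_def)
  have "(F has_real_derivative
      (\<Sum>k\<in>?K. \<Sum>l\<in>?K. a k * (c k l * b l + a l * ?p 0 k l))) (at 0)"
    unfolding F_def
  proof (intro DERIV_sum DERIV_cmult)
    fix k l assume "k \<in> ?K" "l \<in> ?K"
    have "((\<lambda>t. b l + t * a l) has_real_derivative a l) (at 0)"
      by (auto intro!: derivative_eq_intros)
    from DERIV_mult[OF pd[OF \<open>k \<in> ?K\<close> \<open>l \<in> ?K\<close>] this]
    show "((\<lambda>t. ?p t k l * (b l + t * a l)) has_real_derivative c k l * b l + a l * ?p 0 k l) (at 0)"
      by simp
  qed
  also have "(\<Sum>k\<in>?K. \<Sum>l\<in>?K. a k * (c k l * b l + a l * ?p 0 k l)) =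
     (\<Sum>k=1..r. (a k)\<^sup>2) + (\<Sum>k=1..r. \<Sum>l=r+1..CARD('q). (b k * a l + b l * a k)\<^sup>2 / ((d k)\<^sup>2 - (d l)\<^sup>2))"
  proof -
    have U: "?K = {1..r} \<union> {r+1..CARD('q)}" using r by auto
    have split: "(\<Sum>k\<in>?K. f k) = (\<Sum>k=1..r. f k) + (\<Sum>k=r+1..CARD('q). f k)" for f :: "nat \<Rightarrow> real"
      unfolding U by (rule sum.union_disjoint) auto
    have "(\<Sum>k\<in>?K. \<Sum>l\<in>?K. a k * (a l * ?p 0 k l)) = (\<Sum>k\<in>?K. \<Sum>l\<in>?K. if k = l then \<epsilon> k * (a k)\<^sup>2 else 0)"
      by (intro sum.cong refl) (simp only: P0, simp add: power2_eq_square)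
    also have "\<dots> = (\<Sum>k=1..r. (a k)\<^sup>2)"
      unfolding split by (auto simp: \<epsilon>_def)
    finally have 1: "(\<Sum>k\<in>?K. \<Sum>l\<in>?K. a k * (a l * ?p 0 k l)) = (\<Sum>k=1..r. (a k)\<^sup>2)" .
    have z: "(\<Sum>k=1..r. \<Sum>l=1..r. a k * (c k l * b l)) = 0"
      "(\<Sum>k=r+1..CARD('q). \<Sum>l=r+1..CARD('q). a k * (c k l * b l)) = 0"
      by (auto intro!: sum.neutral simp: c_def \<epsilon>_def)
    have "(\<Sum>k\<in>?K. \<Sum>l\<in>?K. a k * (c k l * b l)) =
       (\<Sum>k=1..r. \<Sum>l=r+1..CARD('q). a k * (c k l * b l)) + (\<Sum>k=r+1..CARD('q). \<Sum>l=1..r. a k * (c k l * b l))"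
      unfolding split sum.distrib z by simp
    also have "(\<Sum>k=r+1..CARD('q). \<Sum>l=1..r. a k * (c k l * b l)) = (\<Sum>l=1..r. \<Sum>k=r+1..CARD('q). a k * (c k l * b l))"
      by (rule sum.swap)
    also have "(\<Sum>k=1..r. \<Sum>l=r+1..CARD('q). a k * (c k l * b l)) + (\<Sum>l=1..r. \<Sum>k=r+1..CARD('q). a k * (c k l * b l))
      = (\<Sum>k=1..r. \<Sum>l=r+1..CARD('q). a k * (c k l * b l) + a l * (c l k * b k))"
      by (simp add: sum.distrib)
    also have "\<dots> = (\<Sum>k=1..r. \<Sum>l=r+1..CARD('q). (b k * a l + b l * a k)\<^sup>2 / ((d k)\<^sup>2 - (d l)\<^sup>2))"
    proof (intro sum.cong refl)
      fix k l assume k: "k \<in> {1..r}" and l: "l \<in> {r+1..CARD('q)}"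
      have lk: "c k l = (b k * a l + b l * a k) / ((d k)\<^sup>2 - (d l)\<^sup>2)"
        using k l by (simp add: c_def \<epsilon>_def algebra_simps)
      have "c l k = - (b k * a l + b l * a k) / - ((d k)\<^sup>2 - (d l)\<^sup>2)"
        using k l by (simp add: c_def \<epsilon>_def algebra_simps)
      also have "\<dots> = c k l" unfolding minus_divide_divide lk ..
      finally have "a k * (c k l * b l) + a l * (c l k * b k) = (b k * a l + b l * a k) * c k l"
        by (simp add: algebra_simps)
      then show "a k * (c k l * b l) + a l * (c l k * b k) = (b k * a l + b l * a k)\<^sup>2 / ((d k)\<^sup>2 - (d l)\<^sup>2)"
        unfolding lk by (simp add: power2_eq_square)
    qed
    finally show ?thesis using 1 by (simp only: distrib_left sum.distrib)
  qed
  finally have dF: "(F has_real_derivative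
     (\<Sum>k=1..r. (a k)\<^sup>2) + (\<Sum>k=1..r. \<Sum>l=r+1..CARD('q). (b k * a l + b l * a k)\<^sup>2 / ((d k)\<^sup>2 - (d l)\<^sup>2))) (at 0)" .
  have eq: "F t = coord_section (reduced_rank_estimator r) y i j t" if nr: "\<not> repeated_singular_value (y + t *\<^sub>R ?h)" for t
  proof -
    let ?y = "y + t *\<^sub>R ?h"
    obtain d' u' v' where svd': "is_distinct_svd ?y d' u' v'"
      using not_repeated_distinct_svd[OF pq nr] by blast
    have lin: "linear (top_projection r ?y)" unfolding top_projection_eq[OF svd' r] by (rule linear_frame_proj)
    have "top_projection r ?y (axis j 1) = top_projection r ?y (\<Sum>k\<in>?K. a k *\<^sub>R v k)"
      using orthonormal_expand[OF D(2), of "axis j 1"] by (simp add: a_def inner_axis')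
    also have "\<dots> = (\<Sum>k\<in>?K. a k *\<^sub>R top_projection r ?y (v k))"
      by (simp only: linear_sum[OF lin] linear_scale[OF lin])
    also have "\<dots> = (\<Sum>k\<in>?K. a k *\<^sub>R (\<Sum>l\<in>?K. ?p t k l *\<^sub>R v l))"
      by (simp only: orthonormal_expand[OF D(2)])
    finally have "?y *v top_projection r ?y (axis j 1) = (\<Sum>k\<in>?K. a k *\<^sub>R (\<Sum>l\<in>?K. ?p t k l *\<^sub>R (?y *v v l)))"
      by (simp only: linear_sum[OF matrix_vector_mul_linear] matrix_vector_mult_scaleR)
    then have "(?y *v top_projection r ?y (axis j 1)) $ i = (\<Sum>k\<in>?K. a k * (\<Sum>l\<in>?K. ?p t k l * (?y *v v l) $ i))"
      by simp
    also have "\<dots> = F t" unfolding F_def sum_distrib_left by (intro sum.cong refl) (simp only: ytv)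
    finally show ?thesis
      unfolding coord_section_def using estimator_entry[OF pq nr r] by simp
  qed
  have "\<forall>\<^sub>F t in at 0. \<not> repeated_singular_value (y + t *\<^sub>R ?h)"
    by (rule eventually_not_repeated[OF line_tendsto distinct_not_repeated[OF svd]])
  then have "\<forall>\<^sub>F t in nhds 0. F t = coord_section (reduced_rank_estimator r) y i j t"
    unfolding eventually_nhds_conv_at
    using eq[of 0] distinct_not_repeated[OF svd] by (auto elim!: eventually_mono simp: eq)
  from DERIV_cong_ev[OF refl this refl] dF show ?thesis unfolding a_def b_def by blast
qed

lemma sum_swap4:
  "(\<Sum>i\<in>I. \<Sum>j\<in>J. \<Sum>k\<in>K. \<Sum>l\<in>L. f i j k l) = (\<Sum>k\<in>K. \<Sum>l\<in>L. \<Sum>i\<in>I. \<Sum>j\<in>J. f i j k l)"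
  for f :: "_ \<Rightarrow> _ \<Rightarrow> _ \<Rightarrow> _ \<Rightarrow> real"
proof -
  have "(\<Sum>i\<in>I. \<Sum>j\<in>J. \<Sum>k\<in>K. \<Sum>l\<in>L. f i j k l) = (\<Sum>i\<in>I. \<Sum>k\<in>K. \<Sum>l\<in>L. \<Sum>j\<in>J. f i j k l)"
  proof (rule sum.cong[OF refl])
    fix i
    have "(\<Sum>j\<in>J. \<Sum>k\<in>K. \<Sum>l\<in>L. f i j k l) = (\<Sum>k\<in>K. \<Sum>j\<in>J. \<Sum>l\<in>L. f i j k l)"
      by (rule sum.swap)
    also have "\<dots> = (\<Sum>k\<in>K. \<Sum>l\<in>L. \<Sum>j\<in>J. f i j k l)"
      by (rule sum.cong[OF refl], rule sum.swap)
    finally show "(\<Sum>j\<in>J. \<Sum>k\<in>K. \<Sum>l\<in>L. f i j k l) = (\<Sum>k\<in>K. \<Sum>l\<in>L. \<Sum>j\<in>J. f i j k l)" .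
  qed
  also have "\<dots> = (\<Sum>k\<in>K. \<Sum>i\<in>I. \<Sum>l\<in>L. \<Sum>j\<in>J. f i j k l)"
    by (rule sum.swap)
  also have "\<dots> = (\<Sum>k\<in>K. \<Sum>l\<in>L. \<Sum>i\<in>I. \<Sum>j\<in>J. f i j k l)"
    by (rule sum.cong[OF refl], rule sum.swap)
  finally show ?thesis .
qed

text \<open>Summation over $i$ and $j$ turns products of coordinates into inner products. The mixed term
$2 d_k d_l \langle u_k, u_l \rangle \langle v_k, v_l \rangle$ vanishes.\<close>

lemma divergence_estimator:
  fixes y :: "real^'q^'p"
  assumes svd: "is_distinct_svd y d u v" and pq: "CARD('q) \<le> CARD('p)"
    and r: "1 \<le> r" "r < CARD('q)"
  shows "divergence (reduced_rank_estimator r) y =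
         real CARD('p) * real r +
         (\<Sum>k=1..r. \<Sum>l=r+1..CARD('q). ((d k)\<^sup>2 + (d l)\<^sup>2) / ((d k)\<^sup>2 - (d l)\<^sup>2))"
proof -
  note D = distinct_svdD[OF svd]
  have "divergence (reduced_rank_estimator r) y = (\<Sum>i\<in>UNIV. \<Sum>j\<in>UNIV. (\<Sum>k=1..r. (v k $ j)\<^sup>2) +
    (\<Sum>k=1..r. \<Sum>l=r+1..CARD('q). (d k * u k $ i * v l $ j + d l * u l $ i * v k $ j)\<^sup>2 / ((d k)\<^sup>2 - (d l)\<^sup>2)))"
    unfolding divergence_def using estimator_partial[OF assms] DERIV_imp_deriv by (intro sum.cong refl) blast
  also have "\<dots> = (\<Sum>i\<in>(UNIV::'p set). \<Sum>k=1..r. \<Sum>j\<in>(UNIV::'q set). (v k $ j)\<^sup>2) +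
    (\<Sum>k=1..r. \<Sum>l=r+1..CARD('q). (\<Sum>i\<in>UNIV. \<Sum>j\<in>UNIV. (d k * u k $ i * v l $ j + d l * u l $ i * v k $ j)\<^sup>2) / ((d k)\<^sup>2 - (d l)\<^sup>2))"
    unfolding sum.distrib sum_divide_distrib
    by (rule arg_cong2[where f = "(+)"], rule sum.cong[OF refl], rule sum.swap, rule sum_swap4)
  also have "(\<Sum>i\<in>(UNIV::'p set). \<Sum>k=1..r. \<Sum>j\<in>(UNIV::'q set). (v k $ j)\<^sup>2) = real CARD('p) * real r"
  proof -
    have "(\<Sum>j\<in>(UNIV::'q set). (v k $ j)\<^sup>2) = 1" if "k \<in> {1..r}" for k
      using orthonormal_onD[OF D(2), of k k] that r by (simp add: inner_vec_def power2_eq_square)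
    then show ?thesis by simp
  qed
  also have "(\<Sum>k=1..r. \<Sum>l=r+1..CARD('q). (\<Sum>i\<in>UNIV. \<Sum>j\<in>UNIV. (d k * u k $ i * v l $ j + d l * u l $ i * v k $ j)\<^sup>2) / ((d k)\<^sup>2 - (d l)\<^sup>2))
    = (\<Sum>k=1..r. \<Sum>l=r+1..CARD('q). ((d k)\<^sup>2 + (d l)\<^sup>2) / ((d k)\<^sup>2 - (d l)\<^sup>2))"
  proof (intro sum.cong refl arg_cong2[of _ _ _ _ "(/)"])
    fix k l assume k: "k \<in> {1..r}" and l: "l \<in> {r+1..CARD('q)}"
    have K: "k \<in> {1..CARD('q)}" "l \<in> {1..CARD('q)}" "k \<noteq> l" using k l r by auto
    have sep: "(\<Sum>i\<in>UNIV. \<Sum>j\<in>UNIV. c * ((f i * g i) * (f' j * g' j))) =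
        c * ((\<Sum>i\<in>UNIV. f i * g i) * (\<Sum>j\<in>UNIV. f' j * g' j))"
      for f g :: "'p \<Rightarrow> real" and f' g' :: "'q \<Rightarrow> real" and c
      by (simp only: sum_product) (simp only: sum_distrib_left)
    have "(\<Sum>i\<in>UNIV. \<Sum>j\<in>UNIV. (d k * u k $ i * v l $ j + d l * u l $ i * v k $ j)\<^sup>2)
      = (\<Sum>i\<in>UNIV. \<Sum>j\<in>UNIV. (d k)\<^sup>2 * ((u k $ i * u k $ i) * (v l $ j * v l $ j))
           + (2 * d k * d l * ((u k $ i * u l $ i) * (v k $ j * v l $ j))
           + (d l)\<^sup>2 * ((u l $ i * u l $ i) * (v k $ j * v k $ j))))"
      by (intro sum.cong refl) (simp add: power2_eq_square algebra_simps)
    also have "\<dots> = (d k)\<^sup>2 * ((u k \<bullet> u k) * (v l \<bullet> v l)) + (2 * d k * d l * ((u k \<bullet> u l) * (v k \<bullet> v l))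
        + (d l)\<^sup>2 * ((u l \<bullet> u l) * (v k \<bullet> v k)))"
      unfolding sum.distrib sep by (simp add: inner_vec_def)
    also have "\<dots> = (d k)\<^sup>2 + (d l)\<^sup>2"
      using orthonormal_onD[OF D(2)] orthonormal_onD[OF D(3)] K by simp
    finally show "(\<Sum>i\<in>UNIV. \<Sum>j\<in>UNIV. (d k * u k $ i * v l $ j + d l * u l $ i * v k $ j)\<^sup>2) = (d k)\<^sup>2 + (d l)\<^sup>2" .
  qed
  finally show ?thesis .
qed

section \<open>Null sets by slicing\<close>

lemma AE_lborel_exists:
  assumes "AE x in (lborel :: 'a::euclidean_space measure). P x"
  shows "\<exists>x. P x"
proof (rule ccontr)
  assume "\<not> ?thesis"
  then have "AE x in (lborel :: 'a measure). False" using assms by simp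
  then have "UNIV \<in> null_sets (lborel :: 'a measure)" by (simp add: AE_iff_null)
  then show False by (simp add: null_sets_def)
qed

lemma AE_lborel_affine:
  fixes a :: "'a::euclidean_space"
  assumes "N \<in> sets borel" "c \<noteq> 0" "AE y in lborel. a + c *\<^sub>R y \<notin> N"
  shows "AE y in lborel. y \<notin> N"
proof -
  have m: "(\<lambda>y. a + c *\<^sub>R y) \<in> measurable lborel borel" by measurable
  have "AE y in distr lborel borel (\<lambda>y. a + c *\<^sub>R y). y \<notin> N"
    using assms(1,3) by (subst AE_distr_iff[OF m]) auto
  then have "AE y in density (distr lborel borel (\<lambda>y. a + c *\<^sub>R y)) (\<lambda>_. \<bar>c\<bar>^DIM('a)). y \<notin> N"
    by (subst AE_density) auto
  then show ?thesis by (subst lborel_affine[OF assms(2), of a])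
qed

text \<open>Fubini without choosing coordinates: by Tonelli some single translate of $N$ by $\iota z$ is null,
and Lebesgue measure is translation invariant.\<close>

lemma AE_lborel_fibres:
  fixes N :: "'a::euclidean_space set" and \<iota> :: "'b::euclidean_space \<Rightarrow> 'a"
  assumes N[measurable]: "N \<in> sets borel" and \<iota>[measurable]: "\<iota> \<in> borel_measurable borel"
    and AE: "AE y in lborel. AE z in lborel. y + \<iota> z \<notin> N"
  shows "AE y in lborel. y \<notin> N"
proof -
  have "{x \<in> space (lborel \<Otimes>\<^sub>M lborel). fst x + \<iota> (snd x) \<notin> N} \<in> sets (lborel \<Otimes>\<^sub>M lborel)"
    by measurable
  from lborel_pair.AE_commute[OF this] AE have "AE z in lborel. AE y in lborel. y + \<iota> z \<notin> N" by simp
  then obtain z where "AE y in lborel. y + \<iota> z \<notin> N" using AE_lborel_exists by blast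
  then show ?thesis using AE_lborel_affine[OF N, where c = 1 and a = "\<iota> z"] by (simp add: add.commute)
qed

text \<open>The same idea with contractions towards $a$ in place of translations. It makes the zero set of a
polynomial null as soon as the polynomial is nonzero at one point $a$, since then its restriction to every
segment ending in $a$ is a nonzero polynomial in one variable.\<close>

lemma AE_lborel_segments:
  fixes N :: "'a::euclidean_space set" and a :: 'a
  assumes N[measurable]: "N \<in> sets borel" and cnt: "\<And>y. countable {t. (1 - t) *\<^sub>R y + t *\<^sub>R a \<in> N}"
  shows "AE y in lborel. y \<notin> N"
proof -
  have "AE t in lborel. (1 - t) *\<^sub>R y + t *\<^sub>R a \<notin> N" for y
    using AE_not_in[OF countable_imp_null_set_lborel[OF cnt[of y]]] by simp
  then have 1: "AE y in (lborel :: 'a measure). AE t in lborel. (1 - t) *\<^sub>R y + t *\<^sub>R a \<notin> N" by simp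
  have "{x \<in> space (lborel \<Otimes>\<^sub>M lborel). (1 - snd x) *\<^sub>R fst x + snd x *\<^sub>R a \<notin> N} \<in> sets (lborel \<Otimes>\<^sub>M lborel)"
    by measurable
  from lborel_pair.AE_commute[OF this] 1 have "AE t in lborel. AE y in (lborel :: 'a measure). (1 - t) *\<^sub>R y + t *\<^sub>R a \<notin> N" by blast
  moreover have "AE t in lborel. t \<noteq> (1::real)"
    using AE_not_in[OF countable_imp_null_set_lborel[of "{1::real}"]] by simp
  ultimately have "AE t in lborel. t \<noteq> 1 \<and> (AE y in (lborel :: 'a measure). (1 - t) *\<^sub>R y + t *\<^sub>R a \<notin> N)"
    by eventually_elim auto
  then obtain t where "t \<noteq> 1" "AE y in (lborel :: 'a measure). (1 - t) *\<^sub>R y + t *\<^sub>R a \<notin> N"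
    using AE_lborel_exists by blast
  then show ?thesis using AE_lborel_affine[OF N, where c = "1 - t" and a = "t *\<^sub>R a"] by (simp add: add.commute)
qed

lemma AE_lborel_negligible:
  assumes "S \<in> sets borel" "negligible S"
  shows "AE x in lborel. x \<notin> S"
proof -
  have "S \<in> null_sets lborel"
    using assms null_sets_completion_iff[of S lborel] by (simp add: negligible_iff_null_sets)
  then show ?thesis by (rule AE_not_in)
qed

section \<open>Generic simplicity of the spectrum\<close>

lemma real_polynomial_finite_roots:
  fixes f :: "real \<Rightarrow> real"
  assumes "real_polynomial_function f" "f s \<noteq> 0"
  shows "finite {t. f t = 0}"
proof -
  obtain a n where f: "f = (\<lambda>x. \<Sum>i\<le>n. a i * x ^ i)"
    using assms(1) unfolding real_polynomial_function_iff_sum by blast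
  have "\<exists>k\<le>n. a k \<noteq> 0"
  proof (rule ccontr)
    assume "\<not> ?thesis"
    then show False using assms(2) by (simp add: f)
  qed
  then show ?thesis unfolding f using polyfun_rootbound_finite by blast
qed

lemma gram_component: "gram y x $ m = (\<Sum>i\<in>UNIV. y $ i $ m * (\<Sum>j\<in>UNIV. y $ i $ j * x $ j))"
  by (simp add: gram_def matrix_vector_mult_def transpose_def)

lemma polynomial_gram_power:
  fixes Y :: "real \<Rightarrow> real^'q^'p"
  assumes "\<And>i j. real_polynomial_function (\<lambda>t. Y t $ i $ j)"
  shows "real_polynomial_function (\<lambda>t. ((gram (Y t)) ^^ n) w $ m)"
proof (induction n arbitrary: m)
  case 0
  then show ?case by (simp add: real_polynomial_function.intros(2))
next
  case (Suc n)
  show ?case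
    unfolding funpow.simps comp_apply gram_component
    by (intro real_polynomial_function_sum real_polynomial_function.intros(4) assms Suc finite)
qed

lemma polynomial_det:
  fixes A :: "real \<Rightarrow> real^'q^'q"
  assumes "\<And>i j. real_polynomial_function (\<lambda>t. A t $ i $ j)"
  shows "real_polynomial_function (\<lambda>t. det (A t))"
  unfolding det_def
  by (intro real_polynomial_function_sum real_polynomial_function.intros(4) real_polynomial_function.intros(2)
      real_polynomial_function_prod assms finite finite_permutations)

text \<open>The rows are iterates of the all-ones vector under the Gram operator; \<open>\<kappa>\<close> numbers the
index type so that the exponents $0, \ldots, q - 1$ can label rows.\<close>

definition krylov :: "('q \<Rightarrow> nat) \<Rightarrow> real^'q^'p \<Rightarrow> real^'q^'q" where
  "krylov \<kappa> y = (\<chi> m. ((gram y) ^^ (\<kappa> m)) (\<chi> j. 1))"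

text \<open>A two-dimensional eigenspace meets every hyperplane.\<close>

lemma repeated_eigenvector_orthogonal:
  assumes "repeated_singular_value y"
  obtains l x where "x \<noteq> 0" "x \<bullet> w = 0" "gram y x = l *\<^sub>R x"
proof -
  obtain l x x' where x: "norm x = 1" "norm x' = 1" "x \<bullet> x' = 0"
    and e: "gram y x = l *\<^sub>R x" "gram y x' = l *\<^sub>R x'" using assms unfolding repeated_singular_value_def by blast
  show ?thesis
  proof (cases "x \<bullet> w = 0")
    case True
    moreover have "x \<noteq> 0" using x(1) by auto
    ultimately show ?thesis using that e(1) by blast
  next
    case False
    \<comment> \<open>The combination of $x$ and $x'$ that is orthogonal to $w$.\<close>
    define z where "z = (x' \<bullet> w) *\<^sub>R x - (x \<bullet> w) *\<^sub>R x'"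
    have "z \<bullet> x' \<noteq> 0" using False x by (simp add: z_def inner_diff_left norm_eq_1)
    then have "z \<noteq> 0" by auto
    moreover have "z \<bullet> w = 0" by (simp add: z_def inner_diff_left)
    moreover have "gram y z = l *\<^sub>R z"
      by (simp add: z_def linear_diff[OF linear_gram] linear_scale[OF linear_gram] e scaleR_diff_right mult.commute)
    ultimately show ?thesis by (rule that)
  qed
qed

lemma det_eq_0_iff_kernel: "det A = 0 \<longleftrightarrow> (\<exists>x. x \<noteq> 0 \<and> A *v x = 0)" for A :: "real^'q^'q"
proof -
  have "det A \<noteq> 0 \<longleftrightarrow> inj ((*v) A)"
    using det_nz_iff_inj[OF matrix_vector_mul_linear[of A]] by (simp only: matrix_of_matrix_vector_mul)
  then show ?thesis unfolding linear_injective_0[OF matrix_vector_mul_linear] by blast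
qed

text \<open>An eigenvector orthogonal to the starting vector is orthogonal to all iterates, hence to all rows.
In this way a repeated eigenvalue becomes the vanishing of one polynomial in the entries of the matrix.\<close>

lemma repeated_imp_krylov_singular:
  assumes "repeated_singular_value y"
  shows "det (krylov \<kappa> y) = 0"
proof -
  obtain l x where x: "x \<noteq> 0" "x \<bullet> (\<chi> j. 1) = 0" "gram y x = l *\<^sub>R x"
    using repeated_eigenvector_orthogonal[OF assms] by blast
  have "x \<bullet> ((gram y) ^^ n) (\<chi> j. 1) = 0" for n
    by (induction n) (use x in \<open>auto simp flip: gram_symmetric\<close>)
  then have "((gram y) ^^ n) (\<chi> j. 1) \<bullet> x = 0" for n by (simp add: inner_commute)
  then have "krylov \<kappa> y *v x = 0"
    by (simp add: vec_eq_iff matrix_vector_mul_component krylov_def)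
  then show ?thesis unfolding det_eq_0_iff_kernel using x(1) by blast
qed

text \<open>For a diagonal Gram operator the Krylov matrix is a Vandermonde matrix. A vector in its left kernel
would be the coefficient vector of a polynomial of degree below $q$ with $q$ distinct roots.\<close>

lemma krylov_diagonal_nonsingular:
  fixes y :: "real^'q^'p"
  assumes diag: "\<And>w m. gram y w $ m = c m * w $ m" and inj: "inj c" and \<kappa>: "bij_betw \<kappa> UNIV {0..<CARD('q)}"
  shows "det (krylov \<kappa> y) \<noteq> 0"
proof
  assume "det (krylov \<kappa> y) = 0"
  then have "det (transpose (krylov \<kappa> y)) = 0" by (simp add: det_transpose)
  then obtain s where s: "s \<noteq> 0" "transpose (krylov \<kappa> y) *v s = 0"
    unfolding det_eq_0_iff_kernel by blast
  have pw: "((gram y) ^^ n) (\<chi> j. 1) $ m = c m ^ n" for n m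
    by (induction n) (auto simp: diag)
  have roots: "(\<Sum>k\<in>UNIV. s $ k * c m ^ \<kappa> k) = 0" for m
    using arg_cong[OF s(2), of "\<lambda>z. z $ m"]
    by (simp add: matrix_vector_mult_def transpose_def krylov_def pw mult.commute)
  let ?n = "CARD('q)" and ?i = "inv_into UNIV \<kappa>"
  define a where "a n = s $ ?i n" for n
  have "(\<Sum>n\<le>?n - 1. a n * c m ^ n) = 0" for m
  proof -
    have "0 < ?n" by simp
    then have "{..?n - 1} = {0..<?n}" by (intro set_eqI) (simp only: atMost_iff atLeastLessThan_iff, arith)
    then have "(\<Sum>n\<le>?n - 1. a n * c m ^ n) = (\<Sum>n\<in>{0..<?n}. a n * c m ^ n)" by simp
    also have "\<dots> = (\<Sum>k\<in>UNIV. a (\<kappa> k) * c m ^ \<kappa> k)"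
      by (rule sum.reindex_bij_betw[OF \<kappa>, symmetric])
    also have "\<dots> = 0"
      using roots[of m] bij_betw_inv_into_left[OF \<kappa>] by (simp add: a_def)
    finally show ?thesis .
  qed
  then have sub: "range c \<subseteq> {x. (\<Sum>n\<le>?n - 1. a n * x ^ n) = 0}" by auto
  obtain k where k: "s $ k \<noteq> 0" using s(1) by (auto simp: vec_eq_iff)
  have "\<kappa> k \<in> {0..<?n}" using \<kappa> by (metis bij_betwE UNIV_I)
  then have k': "\<kappa> k \<le> ?n - 1" by auto
  have ak: "a (\<kappa> k) \<noteq> 0" using k bij_betw_inv_into_left[OF \<kappa>, of k] by (simp add: a_def)
  have nz: "\<exists>n\<le>?n - 1. a n \<noteq> 0" using ak k' by blast
  have "card (range c) \<le> ?n - 1"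
    using card_mono[OF polyfun_rootbound_finite[OF nz] sub] polyfun_rootbound_card[OF nz] by linarith
  moreover have "card (range c) = ?n" using inj by (simp add: card_image)
  moreover have "0 < ?n" by simp
  ultimately show False by linarith
qed

definition zero_row :: "'p \<Rightarrow> real^'q^'p \<Rightarrow> real^'q^'p" where
  "zero_row i y = (\<chi> m. if m = i then 0 else y $ m)"

definition single_row :: "'p \<Rightarrow> real^'q \<Rightarrow> real^'q^'p" where
  "single_row i z = (\<chi> m. if m = i then z else 0)"

text \<open>The diagonal values $\kappa(m)^2$ include $0$, so one column of the matrix may vanish and only
$q - 1$ nonzero rows are used. They fit into the $p - 1$ rows other than row $i$.\<close>

lemma exists_diagonal_gram:
  assumes "CARD('q) \<le> CARD('p)" and \<kappa>: "bij_betw \<kappa> (UNIV::'q set) {0..<CARD('q)}"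
  shows "\<exists>a :: real^'q^'p. \<forall>w m. gram (zero_row i a) w $ m = (real (\<kappa> m))\<^sup>2 * w $ m"
proof -
  obtain j0 where j0: "\<kappa> j0 = 0" using \<kappa>
    by (metis atLeastLessThan_iff bij_betw_imp_surj_on imageE le0 zero_less_card_finite)
  have "card (UNIV - {j0}) \<le> card (UNIV - {i})" using assms(1) by (simp add: card_Diff_singleton)
  then obtain \<phi> where \<phi>: "\<phi> ` (UNIV - {j0}) \<subseteq> UNIV - {i}" "inj_on \<phi> (UNIV - {j0})"
    using card_le_inj[of "UNIV - {j0}" "UNIV - {i}"] by auto
  define a :: "real^'q^'p" where "a = (\<chi> n m. if m \<noteq> j0 \<and> n = \<phi> m then real (\<kappa> m) else 0)"
  have "zero_row i a = a" using \<phi>(1) by (auto simp: zero_row_def a_def vec_eq_iff)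
  moreover have "gram a w $ m = (real (\<kappa> m))\<^sup>2 * w $ m" for w m
  proof (cases "m = j0")
    case True
    then show ?thesis using j0 by (simp add: gram_component a_def)
  next
    case False
    have "a $ \<phi> m $ j * w $ j = (if j = m then real (\<kappa> m) * w $ m else 0)" for j
      using False \<phi>(2) by (auto simp: a_def inj_on_def)
    then have inner: "(\<Sum>j\<in>UNIV. a $ \<phi> m $ j * w $ j) = real (\<kappa> m) * w $ m" by simp
    have "gram a w $ m = (\<Sum>n\<in>UNIV. if n = \<phi> m then real (\<kappa> m) * (\<Sum>j\<in>UNIV. a $ n $ j * w $ j) else 0)"
      unfolding gram_component using False by (intro sum.cong refl) (simp add: a_def)
    also have "\<dots> = real (\<kappa> m) * (real (\<kappa> m) * w $ m)"
      using inner by simp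
    finally show ?thesis by (simp add: power2_eq_square)
  qed
  ultimately show ?thesis by metis
qed

lemma AE_not_repeated_zero_row:
  assumes "CARD('q) \<le> CARD('p)"
  shows "AE y in (lborel :: (real^'q^'p) measure). \<not> repeated_singular_value (zero_row i y)"
proof -
  obtain \<kappa> where \<kappa>: "bij_betw \<kappa> (UNIV::'q set) {0..<CARD('q)}"
    using ex_bij_betw_finite_nat[OF finite] by blast
  obtain a :: "real^'q^'p" where a: "\<And>w m. gram (zero_row i a) w $ m = (real (\<kappa> m))\<^sup>2 * w $ m"
    using exists_diagonal_gram[OF assms \<kappa>] by blast
  have "inj (\<lambda>m. (real (\<kappa> m))\<^sup>2)"
    using bij_betw_imp_inj_on[OF \<kappa>] by (auto simp: inj_on_def)
  then have nz: "det (krylov \<kappa> (zero_row i a)) \<noteq> 0"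
    by (rule krylov_diagonal_nonsingular[OF a _ \<kappa>])
  have lin: "linear (zero_row i :: real^'q^'p \<Rightarrow> real^'q^'p)"
    by (intro linearI) (auto simp: zero_row_def vec_eq_iff)
  have "closed ((zero_row i :: real^'q^'p \<Rightarrow> real^'q^'p) -` {y. repeated_singular_value y})"
    by (intro closed_vimage closed_repeated linear_continuous_on linear_conv_bounded_linear[THEN iffD1] lin)
  then have "{y :: real^'q^'p. repeated_singular_value (zero_row i y)} \<in> sets borel" by (simp add: vimage_def borel_closed)
  then have "AE y in (lborel :: (real^'q^'p) measure). y \<notin> {y. repeated_singular_value (zero_row i y)}"
  proof (rule AE_lborel_segments[where a = a])
    fix y
    let ?Y = "\<lambda>t. zero_row i ((1 - t) *\<^sub>R y + t *\<^sub>R a)"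
    have "real_polynomial_function (\<lambda>t::real. (1 - t) * b + t * c)" for b c
      by (intro real_polynomial_function.intros(3,4) real_polynomial_function_diff
          real_polynomial_function.intros(2) real_polynomial_function.intros(1)[OF bounded_linear_ident])
    then have "real_polynomial_function (\<lambda>t. ?Y t $ m $ j)" for m j
      by (cases "m = i") (simp_all add: zero_row_def real_polynomial_function.intros(2))
    then have "real_polynomial_function (\<lambda>t. det (krylov \<kappa> (?Y t)))"
      by (intro polynomial_det) (simp add: krylov_def polynomial_gram_power)
    then have "finite {t. det (krylov \<kappa> (?Y t)) = 0}"
      by (rule real_polynomial_finite_roots[of _ 1]) (use nz in simp)
    moreover have "{t. (1 - t) *\<^sub>R y + t *\<^sub>R a \<in> {y. repeated_singular_value (zero_row i y)}} \<subseteq> {t. det (krylov \<kappa> (?Y t)) = 0}"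
      using repeated_imp_krylov_singular by auto
    ultimately show "countable {t. (1 - t) *\<^sub>R y + t *\<^sub>R a \<in> {y. repeated_singular_value (zero_row i y)}}"
      using countable_finite finite_subset by blast
  qed
  then show ?thesis by simp
qed

section \<open>Almost no coordinate line meets the singular set\<close>

text \<open>The level set $-1$ of a form that is homogeneous of degree 2 meets each ray from the origin at
most once.\<close>

lemma negligible_quadric:
  fixes K G :: "'a::euclidean_space \<Rightarrow> 'a"
  assumes "linear K" "linear G"
  shows "negligible {z. K z \<bullet> G (K z) = -1}"
proof (rule starlike_negligible[where a = 0])
  have "continuous_on UNIV K" "continuous_on UNIV (\<lambda>z. G (K z))"
    using assms linear_compose[OF assms]
    by (auto intro!: linear_continuous_on simp: comp_def simp flip: linear_conv_bounded_linear)
  then show "closed {z. K z \<bullet> G (K z) = -1}"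
    by (intro closed_Collect_eq continuous_on_inner continuous_on_const)
  fix c x assume c: "0 + c *\<^sub>R x \<in> {z. K z \<bullet> G (K z) = -1}" "0 \<le> c" "0 + x \<in> {z. K z \<bullet> G (K z) = -1}"
  then have "c * c = 1" by (simp add: linear_scale[OF assms(1)] linear_scale[OF assms(2)])
  then show "c = 1" using c(2) by (auto simp: square_eq_1_iff)
qed

lemma gram_single_row:
  assumes "y $ i = 0"
  shows "gram (y + single_row i z) w = gram y w + (z \<bullet> w) *\<^sub>R z"
proof (rule vector_eq_rdot[THEN iffD1], rule allI)
  fix u
  have sr: "single_row i z *v x = (z \<bullet> x) *\<^sub>R axis i 1" for x
    by (simp add: vec_eq_iff matrix_vector_mul_component single_row_def axis_def)
  have y0: "(y *v x) $ i = 0" for x by (simp add: matrix_vector_mul_component assms)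
  show "gram (y + single_row i z) w \<bullet> u = (gram y w + (z \<bullet> w) *\<^sub>R z) \<bullet> u"
    by (simp add: gram_inner matrix_vector_mult_add_rdistrib sr inner_add_left inner_add_right
        inner_axis inner_axis' y0)
qed

lemma countable_gram_eigenvalues:
  fixes y :: "real^'q^'p"
  shows "countable {l. \<exists>x. norm x = 1 \<and> gram y x = l *\<^sub>R x}" (is "countable ?L")
proof -
  define X where "X l = (SOME x. norm x = 1 \<and> gram y x = l *\<^sub>R x)" for l
  have X: "norm (X l) = 1 \<and> gram y (X l) = l *\<^sub>R X l" if "l \<in> ?L" for l
    unfolding X_def by (rule someI_ex) (use that in auto)
  have orth: "X l \<bullet> X m = 0" if "l \<in> ?L" "m \<in> ?L" "l \<noteq> m" for l m
  proof -
    have "l * (X l \<bullet> X m) = gram y (X l) \<bullet> X m" using X[OF that(1)] by simp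
    also have "\<dots> = m * (X l \<bullet> X m)" unfolding gram_symmetric using X[OF that(2)] by simp
    finally show ?thesis using that(3) by simp
  qed
  have inj: "inj_on X ?L"
  proof (rule inj_onI, rule ccontr)
    fix l m assume lm: "l \<in> ?L" "m \<in> ?L" "X l = X m" "l \<noteq> m"
    then have "X l \<bullet> X l = 0" using orth[OF lm(1,2,4)] by simp
    then show False using X[OF lm(1)] by simp
  qed
  have "pairwise orthogonal (X ` ?L)"
    unfolding pairwise_def orthogonal_def using orth by blast
  then have "finite (X ` ?L)" by (rule pairwise_orthogonal_imp_finite)
  then show ?thesis using finite_imageD[OF _ inj] countable_finite by blast
qed

text \<open>A two-dimensional eigenspace of $B + z z^T$ contains a vector orthogonal to $z$, which is then an
eigenvector of $B$. Since $B$ has simple spectrum, $z$ is not orthogonal to the whole eigenspace, and the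
complementary direction, scaled to $\langle z, g \rangle = -1$, solves $(B - l) g = z$.\<close>

lemma repeated_rank_one:
  fixes y0 :: "real^'q^'p"
  assumes y0: "y0 $ i = 0" "\<not> repeated_singular_value y0" and rep: "repeated_singular_value (y0 + single_row i z)"
  obtains l x g where "norm x = 1" "gram y0 x = l *\<^sub>R x" "z \<bullet> x = 0" "g \<bullet> x = 0" "z \<bullet> g = -1"
    "gram y0 g - l *\<^sub>R g = z"
proof -
  let ?y = "y0 + single_row i z"
  obtain l x x' where x: "norm x = 1" "norm x' = 1" "x \<bullet> x' = 0"
    and e: "gram ?y x = l *\<^sub>R x" "gram ?y x' = l *\<^sub>R x'" using rep unfolding repeated_singular_value_def by blast
  define \<alpha> \<beta> where "\<alpha> = z \<bullet> x" and "\<beta> = z \<bullet> x'"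
  note g = gram_single_row[OF y0(1)] and lin = linear_gram
  have e0: "gram y0 x = l *\<^sub>R x - \<alpha> *\<^sub>R z" "gram y0 x' = l *\<^sub>R x' - \<beta> *\<^sub>R z"
    using e unfolding g \<alpha>_def \<beta>_def by (auto simp: eq_diff_eq)
  have n0: "\<alpha>\<^sup>2 + \<beta>\<^sup>2 > 0"
  proof -
    have "\<alpha> \<noteq> 0 \<or> \<beta> \<noteq> 0"
    proof (rule ccontr)
      assume "\<not> ?thesis"
      then have "repeated_singular_value y0" using e0 x unfolding repeated_singular_value_def by auto
      then show False using y0 by simp
    qed
    then show ?thesis by (simp add: sum_power2_gt_zero_iff)
  qed
  define s where "s = \<alpha>\<^sup>2 + \<beta>\<^sup>2"
  \<comment> \<open>An orthogonal basis of the eigenspace: $w$ is orthogonal to the row, $v$ is parallel to the projection of the row.\<close>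
  define w where "w = (1 / sqrt s) *\<^sub>R (\<beta> *\<^sub>R x - \<alpha> *\<^sub>R x')"
  define v where "v = (- 1 / s) *\<^sub>R (\<alpha> *\<^sub>R x + \<beta> *\<^sub>R x')"
  have xx: "x \<bullet> x = 1" "x' \<bullet> x' = 1" "x' \<bullet> x = 0" using x by (auto simp: norm_eq_1 inner_commute)
  have s: "s > 0" using n0 by (simp add: s_def)
  show ?thesis
  proof (rule that[of w l v])
    have "(\<beta> *\<^sub>R x - \<alpha> *\<^sub>R x') \<bullet> (\<beta> *\<^sub>R x - \<alpha> *\<^sub>R x') = s"
      by (simp add: inner_diff_left inner_diff_right xx x(3) s_def power2_eq_square)
    then have "norm (\<beta> *\<^sub>R x - \<alpha> *\<^sub>R x') = sqrt s" by (simp add: norm_eq_sqrt_inner)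
    then show "norm w = 1" using s by (simp add: w_def)
    show "gram y0 w = l *\<^sub>R w"
      unfolding w_def by (simp add: linear_scale[OF lin] linear_diff[OF lin] e0 algebra_simps)
    show "z \<bullet> w = 0" by (simp add: w_def inner_diff_right \<alpha>_def \<beta>_def)
    show "v \<bullet> w = 0"
      by (simp add: v_def w_def inner_diff_right inner_add_left xx x(3))
    have "z \<bullet> v = (- 1 / s) * s"
      by (simp add: v_def inner_add_right s_def power2_eq_square flip: \<alpha>_def \<beta>_def)
    then show "z \<bullet> v = -1" using s by simp
    have "gram y0 (\<alpha> *\<^sub>R x + \<beta> *\<^sub>R x') = l *\<^sub>R (\<alpha> *\<^sub>R x + \<beta> *\<^sub>R x') - s *\<^sub>R z"
      by (simp add: linear_scale[OF lin] linear_add[OF lin] e0 s_def power2_eq_square algebra_simps)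
    then have "gram y0 v - l *\<^sub>R v = (- 1 / s) *\<^sub>R (l *\<^sub>R (\<alpha> *\<^sub>R x + \<beta> *\<^sub>R x') - s *\<^sub>R z)
        - l *\<^sub>R ((- 1 / s) *\<^sub>R (\<alpha> *\<^sub>R x + \<beta> *\<^sub>R x'))"
      unfolding v_def linear_scale[OF lin] by (simp only:)
    also have "\<dots> = z" using s by (simp add: scaleR_diff_right del: scaleR_add_right)
    finally show "gram y0 v - l *\<^sub>R v = z" .
  qed
qed

text \<open>Two equations hold for $z' = z + t e$ when the singular set is met. If $x$ is orthogonal to $e$, the
first one, $\langle z', x \rangle = 0$, already is an equation on $z$. Otherwise it determines $t$, so that $z'$ is a
linear function of $z$, and the second one says that a quadratic form in $z$ equals $-1$. There are
countably many eigenvalues.\<close>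

lemma negligible_row_line_repeated:
  fixes y0 :: "real^'q^'p"
  assumes y0: "y0 $ i = 0" "\<not> repeated_singular_value y0"
  shows "negligible {z. \<exists>t. repeated_singular_value (y0 + single_row i (z + t *\<^sub>R e))}"
proof -
  define L where "L = {l. \<exists>x. norm x = 1 \<and> gram y0 x = l *\<^sub>R x}"
  define X where "X l = (SOME x. norm x = 1 \<and> gram y0 x = l *\<^sub>R x)" for l
  have X: "norm (X l) = 1" "gram y0 (X l) = l *\<^sub>R X l" if "l \<in> L" for l
    using someI_ex[of "\<lambda>x. norm x = 1 \<and> gram y0 x = l *\<^sub>R x"] that unfolding L_def X_def by auto
  have simple: "x = 0" if "l \<in> L" "gram y0 x = l *\<^sub>R x" "x \<bullet> X l = 0" for l x
  proof (rule ccontr)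
    assume "x \<noteq> 0"
    then have "repeated_singular_value y0" unfolding repeated_singular_value_def
      using that X[OF that(1)]
      by (intro exI[of _ l] exI[of _ "X l"] exI[of _ "(1 / norm x) *\<^sub>R x"])
        (auto simp: linear_scale[OF linear_gram] inner_commute)
    then show False using y0 by simp
  qed
  \<comment> \<open>$B - l$ made invertible by adding the projection onto its kernel; both agree on vectors orthogonal to the kernel.\<close>
  define T where "T l v = gram y0 v - l *\<^sub>R v + (v \<bullet> X l) *\<^sub>R X l" for l v
  have linT: "linear (T l)" for l
    unfolding T_def
    by (intro linearI) (auto simp: linear_add[OF linear_gram] linear_scale[OF linear_gram] algebra_simps inner_add_left)
  have injT: "inj (T l)" if l: "l \<in> L" for l
    unfolding linear_injective_0[OF linT]
  proof (intro allI impI)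
    fix v assume T0: "T l v = 0"
    have "gram y0 v \<bullet> X l = l * (v \<bullet> X l)" unfolding gram_symmetric using X[OF l] by simp
    then have "T l v \<bullet> X l = v \<bullet> X l"
      using X(1)[OF l] by (simp add: T_def inner_add_left inner_diff_left norm_eq_1)
    then have "v \<bullet> X l = 0" using T0 by simp
    moreover from this have "gram y0 v = l *\<^sub>R v" using T0 by (simp add: T_def)
    ultimately show "v = 0" using simple[OF l] by blast
  qed
  have "\<exists>G. linear G \<and> (\<forall>v. G (T l v) = v)" if "l \<in> L" for l
    using linear_injective_left_inverse[OF linT injT[OF that]] by (auto simp: fun_eq_iff)
  then obtain G where G: "\<And>l. l \<in> L \<Longrightarrow> linear (G l)" "\<And>l v. l \<in> L \<Longrightarrow> G l (T l v) = v"
    by metis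
  \<comment> \<open>The point where the line through $z$ in direction $e$ meets the hyperplane orthogonal to \<open>X l\<close>.\<close>
  define K where "K l z = z - ((z \<bullet> X l) / (e \<bullet> X l)) *\<^sub>R e" for l z
  have linK: "linear (K l)" for l
    unfolding K_def by (intro linearI) (auto simp: inner_add_left add_divide_distrib algebra_simps)
  define S where "S l = (if e \<bullet> X l = 0 then {z. X l \<bullet> z = 0} else {z. K l z \<bullet> G l (K l z) = -1})" for l
  have "{z. \<exists>t. repeated_singular_value (y0 + single_row i (z + t *\<^sub>R e))} \<subseteq> \<Union> (S ` L)"
  proof safe
    fix z t assume rep: "repeated_singular_value (y0 + single_row i (z + t *\<^sub>R e))"
    define z' where "z' = z + t *\<^sub>R e"
    obtain l x g where x: "norm x = 1" "gram y0 x = l *\<^sub>R x" "z' \<bullet> x = 0" "g \<bullet> x = 0" "z' \<bullet> g = -1"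
      "gram y0 g - l *\<^sub>R g = z'"
      using repeated_rank_one[OF y0 rep] unfolding z'_def by blast
    have l: "l \<in> L" using x unfolding L_def by blast
    have "x - (x \<bullet> X l) *\<^sub>R X l = 0"
      using X[OF l] x
      by (intro simple[OF l]) (simp_all add: linear_diff[OF linear_gram] linear_scale[OF linear_gram]
          scaleR_diff_right inner_diff_left norm_eq_1 mult.commute)
    then have xX: "x = (x \<bullet> X l) *\<^sub>R X l" by simp
    then have "x \<bullet> X l \<noteq> 0" using x(1) by auto
    then have zX: "z' \<bullet> X l = 0" "g \<bullet> X l = 0"
      using x(3,4) xX by (metis inner_scaleR_right mult_eq_0_iff)+
    have "T l g = z'" using x(6) zX by (simp add: T_def)
    then have g: "g = G l z'" using G(2)[OF l] by metis
    have "z \<in> S l"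
    proof (cases "e \<bullet> X l = 0")
      case True
      then show ?thesis using zX(1) by (simp add: S_def z'_def inner_add_left inner_add_right inner_commute)
    next
      case False
      have "t = - (z \<bullet> X l) / (e \<bullet> X l)"
        using zX(1) False by (simp add: z'_def inner_add_left field_simps)
      then have "z' = K l z" by (simp add: z'_def K_def)
      then show ?thesis using False x(5) g by (simp add: S_def)
    qed
    then show "z \<in> \<Union> (S ` L)" using l by blast
  qed
  moreover have "negligible (\<Union> (S ` L))"
  proof (rule negligible_countable_Union)
    show "countable (S ` L)" unfolding L_def by (intro countable_image countable_gram_eigenvalues)
    fix A assume "A \<in> S ` L"
    then obtain l where l: "l \<in> L" "A = S l" by blast
    have "X l \<noteq> 0" using X(1)[OF l(1)] by auto
    then show "negligible A" unfolding l(2) S_def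
      using negligible_hyperplane[of "X l" 0] negligible_quadric[OF linK G(1)[OF l(1)]] by auto
  qed
  ultimately show ?thesis by (rule negligible_subset[rotated])
qed

text \<open>The set of matrices whose line meets the singular set is split along row $i$: for almost every $y$ the
remaining rows have a Gram operator with simple spectrum, and for such a $y$ almost every row $z$ is good.\<close>

lemma AE_line_not_repeated:
  assumes "CARD('q) \<le> CARD('p)"
  shows "AE y in (lborel :: (real^'q^'p) measure). \<forall>t. \<not> repeated_singular_value (y + t *\<^sub>R axis i (axis j 1))"
proof -
  let ?e = "axis i (axis j 1) :: real^'q^'p"
  define N where "N = {y :: real^'q^'p. \<exists>t. repeated_singular_value (y + t *\<^sub>R ?e)}"
  have N_eq: "N = (\<Union>n::nat. {y. \<exists>t. t \<in> {- real n..real n} \<and> repeated_singular_value (y + t *\<^sub>R ?e)})"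
  proof -
    have "\<exists>n::nat. t \<in> {- real n..real n}" for t :: real
    proof -
      obtain n where "\<bar>t\<bar> \<le> real n" using real_arch_simple by blast
      then have "t \<in> {- real n..real n}" by (simp add: abs_le_iff)
      then show ?thesis ..
    qed
    then show ?thesis unfolding N_def by blast
  qed
  have "{y. \<exists>t. t \<in> {- real n..real n} \<and> repeated_singular_value (y + t *\<^sub>R ?e)} \<in> sets borel" for n :: nat
    by (rule borel_closed[OF closed_repeated_segment])
  then have Nb: "N \<in> sets borel" unfolding N_eq by (intro sets.countable_UN) blast
  have lin: "linear (single_row i :: real^'q \<Rightarrow> real^'q^'p)"
    by (intro linearI) (auto simp: single_row_def vec_eq_iff)
  then have \<iota>: "(single_row i :: real^'q \<Rightarrow> real^'q^'p) \<in> borel_measurable borel"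
    by (intro borel_measurable_continuous_onI linear_continuous_on) (simp add: linear_conv_bounded_linear)
  have "AE y in (lborel :: (real^'q^'p) measure). AE z in lborel. y + single_row i z \<notin> N"
    using AE_not_repeated_zero_row[OF assms, of i]
  proof eventually_elim
    case (elim y)
    let ?B = "{z. \<exists>t. repeated_singular_value (zero_row i y + single_row i (z + t *\<^sub>R axis j 1))}"
    have "negligible ?B"
      by (rule negligible_row_line_repeated[OF _ elim]) (simp add: zero_row_def)
    then have "negligible ((+) (- (y $ i)) ` ?B)" by (rule negligible_translation)
    moreover have "{z. y + single_row i z \<in> N} \<subseteq> (+) (- (y $ i)) ` ?B"
    proof
      fix z assume "z \<in> {z. y + single_row i z \<in> N}"
      then obtain t where t: "repeated_singular_value (y + single_row i z + t *\<^sub>R ?e)" unfolding N_def by blast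
      have "y + single_row i z + t *\<^sub>R ?e = zero_row i y + single_row i (y $ i + z + t *\<^sub>R axis j 1)"
        by (auto simp: vec_eq_iff zero_row_def single_row_def axis_def)
      then have "y $ i + z \<in> ?B" using t by auto
      then show "z \<in> (+) (- (y $ i)) ` ?B" by (rule rev_image_eqI) simp
    qed
    ultimately have "negligible {z. y + single_row i z \<in> N}" by (rule negligible_subset)
    moreover have "{z. y + single_row i z \<in> N} \<in> sets borel"
    proof -
      have "(\<lambda>z. y + single_row i z) \<in> borel_measurable borel" using \<iota> by measurable
      from measurable_sets[OF this Nb] show ?thesis by (simp add: vimage_def)
    qed
    ultimately show "AE z in lborel. y + single_row i z \<notin> N"
      using AE_lborel_negligible[of "{z. y + single_row i z \<in> N}"] by simp
  qed
  from AE_lborel_fibres[OF Nb \<iota> this] show ?thesis by (simp add: N_def)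
qed

section \<open>Stein identity on a line and integration over parallel lines\<close>

lemma normal_density_has_derivative:
  assumes "\<sigma> > 0"
  shows "(normal_density m \<sigma> has_real_derivative - ((t - m) / \<sigma>\<^sup>2 * normal_density m \<sigma> t)) (at t)"
proof -
  define C where "C = 1 / sqrt (2 * pi * \<sigma>\<^sup>2)"
  have nd: "normal_density m \<sigma> = (\<lambda>t. C * exp (- (t - m)\<^sup>2 / (2 * \<sigma>\<^sup>2)))"
    by (simp add: fun_eq_iff normal_density_def C_def)
  have "((\<lambda>t. - (t - m)\<^sup>2 / (2 * \<sigma>\<^sup>2)) has_real_derivative - ((t - m) / \<sigma>\<^sup>2)) (at t)"
    using assms by (auto intro!: derivative_eq_intros simp: field_simps power2_eq_square)
  from DERIV_cmult[OF DERIV_fun_exp[OF this], of C] show ?thesis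
    unfolding nd by (simp add: mult_ac)
qed

lemma linear_times_normal_density_tendsto_0:
  assumes "\<sigma> > 0" "0 \<le> a" "0 \<le> b"
  shows "(\<lambda>n. (a + b * real n) * normal_density m \<sigma> (real n)) \<longlonglongrightarrow> 0"
    and "(\<lambda>n. (a + b * real n) * normal_density m \<sigma> (- real n)) \<longlonglongrightarrow> 0"
proof -
  have c: "2 * \<sigma>\<^sup>2 > 0" using assms by simp
  have *: "(\<lambda>n. (a + b * real n) * exp (- (s * real n - m)\<^sup>2 / c)) \<longlonglongrightarrow> 0"
    if "c > 0" "s = 1 \<or> s = -1" for c s :: real
    using that by (elim disjE; simp; real_asymp)
  from tendsto_mult_left_zero[OF *[OF c, of 1], of "1 / sqrt (2 * pi * \<sigma>\<^sup>2)"]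
  show "(\<lambda>n. (a + b * real n) * normal_density m \<sigma> (real n)) \<longlonglongrightarrow> 0"
    by (simp add: normal_density_def)
  from tendsto_mult_left_zero[OF *[OF c, of "-1"], of "1 / sqrt (2 * pi * \<sigma>\<^sup>2)"]
  show "(\<lambda>n. (a + b * real n) * normal_density m \<sigma> (- real n)) \<longlonglongrightarrow> 0"
    by (simp add: normal_density_def)
qed

text \<open>Integration by parts of $F' \rho$ against the normal density $\rho$, with $\rho' = - \rho (t - m) / \sigma^2$.
Since $h = F' \ge 0$, monotone convergence on $[-n, n]$ yields the integral of $h \rho$
even when $h$ is unbounded. The two parts of the integrand $F \rho (t - m) / \sigma^2$ are kept apart so
that all integrals are of nonnegative functions and can be integrated over parallel lines by
Tonelli's theorem.\<close>

lemma stein_line: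
  fixes F h :: "real \<Rightarrow> real"
  assumes \<sigma>: "\<sigma> > 0" and F: "\<And>t. (F has_real_derivative h t) (at t)"
    and h[measurable]: "h \<in> borel_measurable borel" and h0: "\<And>t. 0 \<le> h t"
    and growth: "\<And>t. \<bar>F t\<bar> \<le> a + b * \<bar>t\<bar>" and ab: "0 \<le> a" "0 \<le> b"
  shows "(\<integral>\<^sup>+t. ennreal (h t * normal_density m \<sigma> t) \<partial>lborel) +
      (\<integral>\<^sup>+t. ennreal (- (F t * ((t - m) / \<sigma>\<^sup>2) * normal_density m \<sigma> t)) \<partial>lborel) =
    (\<integral>\<^sup>+t. ennreal (F t * ((t - m) / \<sigma>\<^sup>2) * normal_density m \<sigma> t) \<partial>lborel)"
proof -
  let ?\<rho> = "normal_density m \<sigma>"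
  define w where "w t = F t * ((t - m) / \<sigma>\<^sup>2) * ?\<rho> t" for t
  have contF: "continuous_on S F" for S
    using F by (auto intro!: continuous_at_imp_continuous_on DERIV_isCont)
  have cont\<rho>: "continuous_on S ?\<rho>" for S
    using normal_density_has_derivative[OF \<sigma>] by (auto intro!: continuous_at_imp_continuous_on DERIV_isCont)
  have contw: "continuous_on S w" for S
    unfolding w_def using \<sigma> by (intro continuous_intros contF cont\<rho>) auto
  have [measurable]: "w \<in> borel_measurable borel" "F \<in> borel_measurable borel"
    using contw contF by (auto intro: borel_measurable_continuous_onI)
  have int_w: "integrable lborel w"
  proof (rule Bochner_Integration.integrable_bound)
    show "integrable lborel (\<lambda>t. ((a + b * \<bar>m\<bar>) * (?\<rho> t * \<bar>t - m\<bar> ^ 1) + b * (?\<rho> t * \<bar>t - m\<bar> ^ 2)) / \<sigma>\<^sup>2)"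
      by (intro integrable_divide Bochner_Integration.integrable_add integrable_mult_right integrable_normal_moment_abs \<sigma>)
    show "AE t in lborel. norm (w t) \<le> norm (((a + b * \<bar>m\<bar>) * (?\<rho> t * \<bar>t - m\<bar> ^ 1) + b * (?\<rho> t * \<bar>t - m\<bar> ^ 2)) / \<sigma>\<^sup>2)"
    proof (rule AE_I2)
      fix t
      have "\<bar>F t\<bar> \<le> a + b * \<bar>m\<bar> + b * \<bar>t - m\<bar>"
      proof -
        have "\<bar>t\<bar> \<le> \<bar>m\<bar> + \<bar>t - m\<bar>" by linarith
        then have "b * \<bar>t\<bar> \<le> b * (\<bar>m\<bar> + \<bar>t - m\<bar>)" using ab by (intro mult_left_mono)
        then show ?thesis using growth[of t] by (simp add: distrib_left)
      qed
      then have "\<bar>F t\<bar> * (\<bar>t - m\<bar> * ?\<rho> t / \<sigma>\<^sup>2) \<le> (a + b * \<bar>m\<bar> + b * \<bar>t - m\<bar>) * (\<bar>t - m\<bar> * ?\<rho> t / \<sigma>\<^sup>2)"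
        by (intro mult_right_mono) auto
      also have "\<dots> = ((a + b * \<bar>m\<bar>) * (?\<rho> t * \<bar>t - m\<bar> ^ 1) + b * (?\<rho> t * \<bar>t - m\<bar> ^ 2)) / \<sigma>\<^sup>2"
        by (simp add: algebra_simps add_divide_distrib power2_eq_square)
      also have "\<bar>F t\<bar> * (\<bar>t - m\<bar> * ?\<rho> t / \<sigma>\<^sup>2) = norm (w t)"
        by (simp add: w_def abs_mult)
      finally show "norm (w t) \<le> norm (((a + b * \<bar>m\<bar>) * (?\<rho> t * \<bar>t - m\<bar> ^ 1) + b * (?\<rho> t * \<bar>t - m\<bar> ^ 2)) / \<sigma>\<^sup>2)"
        unfolding real_norm_def by (rule order_trans[OF _ abs_ge_self])
    qed
  qed measurable
  define I where "I n = (\<integral>\<^sup>+t. indicator {- real n..real n} t * ennreal (h t * ?\<rho> t) \<partial>lborel)" for n :: nat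
  \<comment> \<open>The value of the integral of $h \rho$ over $[-n, n]$ according to the fundamental theorem of calculus.\<close>
  define J where "J n = F n * ?\<rho> n - F (- real n) * ?\<rho> (- real n) + (\<integral>t. indicator {- real n..real n} t *\<^sub>R w t \<partial>lborel)" for n :: nat
  have I_J: "I n = ennreal (J n) \<and> 0 \<le> J n" for n
  proof -
    let ?S = "{- real n..real n}"
    have si: "set_integrable lborel ?S w"
      unfolding set_integrable_def using int_w by (intro integrable_mult_indicator) auto
    have 1: "((\<lambda>t. h t * ?\<rho> t - w t) has_integral F n * ?\<rho> n - F (- real n) * ?\<rho> (- real n)) ?S"
    proof (rule fundamental_theorem_of_calculus)
      fix t
      have "((\<lambda>t. F t * ?\<rho> t) has_real_derivative h t * ?\<rho> t + - ((t - m) / \<sigma>\<^sup>2 * ?\<rho> t) * F t) (at t)"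
        by (rule DERIV_mult[OF F normal_density_has_derivative[OF \<sigma>]])
      then show "((\<lambda>t. F t * ?\<rho> t) has_vector_derivative h t * ?\<rho> t - w t) (at t within ?S)"
        by (simp add: has_real_derivative_iff_has_vector_derivative w_def mult_ac has_vector_derivative_at_within)
    qed simp
    have 2: "(w has_integral (\<integral>t. indicator ?S t *\<^sub>R w t \<partial>lborel)) ?S"
      using integrable_integral[OF set_borel_integral_eq_integral(1)[OF si]]
      unfolding set_borel_integral_eq_integral(2)[OF si, symmetric] set_lebesgue_integral_def .
    have J: "((\<lambda>t. h t * ?\<rho> t) has_integral J n) ?S"
      using has_integral_add[OF 1 2] by (simp add: J_def)
    have "0 \<le> J n" using has_integral_nonneg[OF J] h0 by simp
    moreover from nn_integral_has_integral_lebesgue[OF _ J] h0 have "I n = ennreal (J n)"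
      by (simp add: I_def ennreal_mult' flip: ennreal_indicator)
    ultimately show ?thesis by simp
  qed
  have lim1: "(\<lambda>n. F (real n) * ?\<rho> (real n)) \<longlonglongrightarrow> 0"
  proof (rule Lim_null_comparison[OF always_eventually linear_times_normal_density_tendsto_0(1)[OF \<sigma> ab]], intro allI)
    fix n show "norm (F (real n) * ?\<rho> (real n)) \<le> (a + b * real n) * ?\<rho> (real n)"
      using growth[of "real n"] by (simp add: abs_mult mult_right_mono)
  qed
  have lim2: "(\<lambda>n. F (- real n) * ?\<rho> (- real n)) \<longlonglongrightarrow> 0"
  proof (rule Lim_null_comparison[OF always_eventually linear_times_normal_density_tendsto_0(2)[OF \<sigma> ab]], intro allI)
    fix n show "norm (F (- real n) * ?\<rho> (- real n)) \<le> (a + b * real n) * ?\<rho> (- real n)"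
      using growth[of "- real n"] by (simp add: abs_mult mult_right_mono)
  qed
  have ind: "(\<lambda>n. indicator {- real n..real n} t :: 'b::{topological_space, zero_neq_one}) \<longlonglongrightarrow> 1" for t :: real
  proof (rule tendsto_eventually)
    obtain N where "\<bar>t\<bar> \<le> real N" using real_arch_simple by blast
    then show "\<forall>\<^sub>F n in sequentially. (indicator {- real n..real n} t :: 'b) = 1"
      by (intro eventually_sequentiallyI[of N]) (auto simp: indicator_def abs_le_iff)
  qed
  have lim3: "(\<lambda>n. \<integral>t. indicator {- real n..real n} t *\<^sub>R w t \<partial>lborel) \<longlonglongrightarrow> (\<integral>t. w t \<partial>lborel)"
  proof (rule integral_dominated_convergence[where w = "\<lambda>t. norm (w t)"])
    show "AE t in lborel. (\<lambda>n. indicator {- real n..real n} t *\<^sub>R w t) \<longlonglongrightarrow> w t"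
    proof (rule AE_I2)
      fix t
      show "(\<lambda>n. indicator {- real n..real n} t *\<^sub>R w t) \<longlonglongrightarrow> w t"
        using tendsto_scaleR[OF ind[of t] tendsto_const[of "w t"]] by simp
    qed
  qed (use int_w in \<open>auto simp: indicator_def\<close>)
  have J_lim: "J \<longlonglongrightarrow> (\<integral>t. w t \<partial>lborel)"
    unfolding J_def using tendsto_add[OF tendsto_diff[OF lim1 lim2] lim3] by simp
  have "I = (\<lambda>n. ennreal (J n))" using I_J by blast
  then have "I \<longlonglongrightarrow> ennreal (\<integral>t. w t \<partial>lborel)"
    using tendsto_ennrealI[OF J_lim] by simp
  moreover have "I \<longlonglongrightarrow> (\<integral>\<^sup>+t. ennreal (h t * ?\<rho> t) \<partial>lborel)"
  proof -
    have "(\<lambda>n. \<integral>\<^sup>+t. indicator {- real n..real n} t * ennreal (h t * ?\<rho> t) \<partial>lborel) \<longlonglongrightarrow>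
        (\<integral>\<^sup>+t. 1 * ennreal (h t * ?\<rho> t) \<partial>lborel)"
    proof (rule nn_integral_LIMSEQ)
      show "incseq (\<lambda>n t. indicator {- real n..real n} t * ennreal (h t * ?\<rho> t))"
        by (auto simp: incseq_def le_fun_def indicator_def)
      fix t
      show "(\<lambda>n. indicator {- real n..real n} t * ennreal (h t * ?\<rho> t)) \<longlonglongrightarrow> 1 * ennreal (h t * ?\<rho> t)"
      proof (rule tendsto_eventually)
        obtain N where "\<bar>t\<bar> \<le> real N" using real_arch_simple by blast
        then show "\<forall>\<^sub>F n in sequentially. indicator {- real n..real n} t * ennreal (h t * ?\<rho> t) = 1 * ennreal (h t * ?\<rho> t)"
          by (intro eventually_sequentiallyI[of N]) (auto simp: indicator_def abs_le_iff)
      qed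
    qed measurable
    then show ?thesis by (simp add: I_def[abs_def])
  qed
  ultimately have Ih: "(\<integral>\<^sup>+t. ennreal (h t * ?\<rho> t) \<partial>lborel) = ennreal (\<integral>t. w t \<partial>lborel)"
    using LIMSEQ_unique by fastforce
  have nonneg: "0 \<le> (\<integral>t. w t \<partial>lborel)"
    using LIMSEQ_le_const[OF J_lim] I_J by blast
  define A B where "A = enn2real (\<integral>\<^sup>+t. ennreal (w t) \<partial>lborel)" and "B = enn2real (\<integral>\<^sup>+t. ennreal (- w t) \<partial>lborel)"
  have AB: "(\<integral>\<^sup>+t. ennreal (w t) \<partial>lborel) = ennreal A" "(\<integral>\<^sup>+t. ennreal (- w t) \<partial>lborel) = ennreal B" "0 \<le> B"
    using int_w by (auto simp: A_def B_def real_integrable_def less_top)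
  have "(\<integral>t. w t \<partial>lborel) = A - B"
    unfolding A_def B_def by (rule real_lebesgue_integral_def[OF int_w])
  then have "ennreal (\<integral>t. w t \<partial>lborel) + ennreal B = ennreal A"
    using nonneg AB(3) by (simp flip: ennreal_plus)
  then show ?thesis unfolding Ih AB(1,2)[symmetric] unfolding w_def .
qed

lemma nn_integral_lborel_translate:
  fixes g :: "'a::euclidean_space \<Rightarrow> ennreal"
  assumes [measurable]: "g \<in> borel_measurable borel"
  shows "(\<integral>\<^sup>+y. g (y + c) \<partial>lborel) = (\<integral>\<^sup>+y. g y \<partial>lborel)"
proof -
  have "(\<integral>\<^sup>+y. g y \<partial>lborel) = (\<integral>\<^sup>+y. g y \<partial>distr lborel borel ((+) c))"
    by (simp add: lborel_distr_plus)
  also have "\<dots> = (\<integral>\<^sup>+y. g (c + y) \<partial>lborel)"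
    by (rule nn_integral_distr) auto
  finally show ?thesis by (simp add: add.commute)
qed

text \<open>Every line parallel to $e$ meets the slab $0 \le \langle y, e \rangle < 1$ in a segment of length 1, so
integrating over the slab and then along lines counts each point with weight 1. This replaces a
splitting of the space into a line and a hyperplane.\<close>

lemma nn_integral_slab:
  fixes \<Phi> :: "'a::euclidean_space \<Rightarrow> ennreal"
  assumes \<Phi>[measurable]: "\<Phi> \<in> borel_measurable borel" and e: "e \<bullet> e = 1"
  shows "(\<integral>\<^sup>+y. \<Phi> y \<partial>lborel) =
    (\<integral>\<^sup>+y. indicator {0..<1} (y \<bullet> e) * (\<integral>\<^sup>+t. \<Phi> (y + t *\<^sub>R e) \<partial>lborel) \<partial>lborel)"
proof -
  let ?I = "indicator {0..<1} :: real \<Rightarrow> ennreal"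
  have "(\<integral>\<^sup>+y. ?I (y \<bullet> e) * (\<integral>\<^sup>+t. \<Phi> (y + t *\<^sub>R e) \<partial>lborel) \<partial>lborel) =
      (\<integral>\<^sup>+y. (\<integral>\<^sup>+t. ?I (y \<bullet> e) * \<Phi> (y + t *\<^sub>R e) \<partial>lborel) \<partial>lborel)"
    by (simp add: nn_integral_cmult)
  also have "\<dots> = (\<integral>\<^sup>+t. (\<integral>\<^sup>+y. ?I (y \<bullet> e) * \<Phi> (y + t *\<^sub>R e) \<partial>lborel) \<partial>lborel)"
    by (rule lborel_pair.Fubini') measurable
  also have "\<dots> = (\<integral>\<^sup>+t. (\<integral>\<^sup>+y. ?I (y \<bullet> e - t) * \<Phi> y \<partial>lborel) \<partial>lborel)"
  proof (rule nn_integral_cong)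
    fix t :: real
    have "(\<integral>\<^sup>+y. ?I ((y + t *\<^sub>R e) \<bullet> e - t) * \<Phi> (y + t *\<^sub>R e) \<partial>lborel) = (\<integral>\<^sup>+y. ?I (y \<bullet> e - t) * \<Phi> y \<partial>lborel)"
      by (rule nn_integral_lborel_translate[where g = "\<lambda>y. ?I (y \<bullet> e - t) * \<Phi> y"]) measurable
    then show "(\<integral>\<^sup>+y. ?I (y \<bullet> e) * \<Phi> (y + t *\<^sub>R e) \<partial>lborel) = (\<integral>\<^sup>+y. ?I (y \<bullet> e - t) * \<Phi> y \<partial>lborel)"
      by (simp add: inner_add_left e)
  qed
  also have "\<dots> = (\<integral>\<^sup>+y. (\<integral>\<^sup>+t. ?I (y \<bullet> e - t) * \<Phi> y \<partial>lborel) \<partial>lborel)"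
    by (rule lborel_pair.Fubini') measurable
  also have "\<dots> = (\<integral>\<^sup>+y. \<Phi> y \<partial>lborel)"
  proof (rule nn_integral_cong)
    fix y :: 'a
    have "?I (y \<bullet> e - t) = indicator {y \<bullet> e - 1<..y \<bullet> e} t" for t
      by (auto simp: indicator_def)
    then have "(\<integral>\<^sup>+t. ?I (y \<bullet> e - t) \<partial>lborel) = 1" by simp
    then show "(\<integral>\<^sup>+t. ?I (y \<bullet> e - t) * \<Phi> y \<partial>lborel) = \<Phi> y"
      by (subst nn_integral_multc) auto
  qed
  finally show ?thesis ..
qed

section \<open>Gaussian matrices\<close>

lemma inner_unit_matrix: "y \<bullet> axis i (axis j 1) = y $ i $ j" for y :: "real^'q^'p"
  by (simp add: inner_axis)

lemma bij_unit_matrices: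
  "bij_betw (\<lambda>(i, j). axis i (axis j 1)) (UNIV :: ('p \<times> 'q) set) (Basis :: (real^'q^'p) set)"
  unfolding bij_betw_def
proof
  show "inj (\<lambda>(i, j). axis i (axis j 1) :: real^'q^'p)"
    by (auto simp: inj_on_def axis_eq_axis)
  show "range (\<lambda>(i, j). axis i (axis j 1)) = (Basis :: (real^'q^'p) set)"
    by (auto simp: Basis_vec_def)
qed

lemma ball_Basis_matrix: "(\<forall>b\<in>(Basis :: (real^'q^'p) set). P b) \<longleftrightarrow> (\<forall>i j. P (axis i (axis j 1)))"
  unfolding bij_betw_imp_surj_on[OF bij_unit_matrices, symmetric] by auto

lemma borel_measurable_matrix:
  fixes f :: "'w \<Rightarrow> real^'q^'p"
  assumes "\<And>i j. (\<lambda>x. f x $ i $ j) \<in> borel_measurable M"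
  shows "f \<in> borel_measurable M"
proof -
  have "\<forall>b\<in>Basis. (\<lambda>x. f x \<bullet> b) \<in> borel_measurable M"
    unfolding ball_Basis_matrix inner_unit_matrix using assms by blast
  then show ?thesis by (rule borel_measurable_euclidean_space[THEN iffD2])
qed

lemma measurable_entry[measurable]: "(\<lambda>y :: real^'q^'p. y $ i $ j) \<in> borel_measurable borel"
  by (intro borel_measurable_continuous_onI continuous_intros)

abbreviation (input) matrix_of :: "('p \<times> 'q \<Rightarrow> real) \<Rightarrow> real^'q^'p" where
  "matrix_of f \<equiv> (\<chi> i j. f (i, j))"

lemma measurable_matrix_of: "matrix_of \<in> borel_measurable (\<Pi>\<^sub>M ij\<in>(UNIV :: ('p::finite \<times> 'q::finite) set). (borel :: real measure))"
  by (rule borel_measurable_matrix) simp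

text \<open>Identifies Lebesgue measure on matrices with the product measure over index pairs, in which
independence of the entries is expressed.\<close>

lemma lborel_matrix:
  "distr (\<Pi>\<^sub>M ij\<in>(UNIV :: ('p::finite \<times> 'q::finite) set). lborel) borel matrix_of = lborel"
proof (rule lborel_eqI[symmetric])
  interpret product_sigma_finite "\<lambda>_::'p \<times> 'q. lborel :: real measure" ..
  have m: "matrix_of \<in> measurable (\<Pi>\<^sub>M ij\<in>(UNIV :: ('p \<times> 'q) set). lborel) borel"
    using measurable_matrix_of by (simp cong: measurable_cong_sets sets_PiM_cong)
  fix l u :: "real^'q^'p"
  assume le: "\<And>b. b \<in> Basis \<Longrightarrow> l \<bullet> b \<le> u \<bullet> b"
  have le': "l $ i $ j \<le> u $ i $ j" for i j
    using le[unfolded Ball_def[symmetric]] ball_Basis_matrix[of "\<lambda>b. l \<bullet> b \<le> u \<bullet> b"] le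
    unfolding inner_unit_matrix by blast
  have "matrix_of -` box l u \<inter> space (\<Pi>\<^sub>M ij\<in>UNIV. lborel) =
      (\<Pi>\<^sub>E ij\<in>UNIV. {l $ fst ij $ snd ij <..< u $ fst ij $ snd ij})"
    unfolding box_def ball_Basis_matrix inner_unit_matrix by (auto simp: space_PiM PiE_def Pi_def)
  then have "emeasure (distr (\<Pi>\<^sub>M ij\<in>UNIV. lborel) borel matrix_of) (box l u) =
      (\<Prod>ij\<in>UNIV. emeasure lborel {l $ fst ij $ snd ij <..< u $ fst ij $ snd ij})"
    by (simp add: emeasure_distr[OF m] emeasure_PiM)
  also have "\<dots> = (\<Prod>ij\<in>UNIV. ennreal ((u - l) $ fst ij $ snd ij))"
    using le' by simp
  also have "\<dots> = ennreal (\<Prod>ij\<in>UNIV. (u - l) $ fst ij $ snd ij)"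
    using le' by (intro prod_ennreal) simp
  also have "(\<Prod>ij\<in>UNIV. (u - l) $ fst ij $ snd ij) = (\<Prod>ij\<in>UNIV. (u - l) \<bullet> (case ij of (i, j) \<Rightarrow> axis i (axis j 1)))"
    by (intro prod.cong refl) (simp add: case_prod_beta inner_unit_matrix del: vector_minus_component)
  also have "\<dots> = (\<Prod>b\<in>Basis. (u - l) \<bullet> b)"
    by (rule prod.reindex_bij_betw[OF bij_unit_matrices])
  finally show "emeasure (distr (\<Pi>\<^sub>M ij\<in>UNIV. lborel) borel matrix_of) (box l u) = (\<Prod>b\<in>Basis. (u - l) \<bullet> b)" .
qed simp

definition gaussian :: "real^'q^'p \<Rightarrow> real \<Rightarrow> real^'q^'p \<Rightarrow> real" where
  "gaussian \<mu> \<sigma> y = (\<Prod>ij\<in>UNIV. normal_density (\<mu> $ fst ij $ snd ij) \<sigma> (y $ fst ij $ snd ij))"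

lemma measurable_gaussian[measurable]: "gaussian \<mu> \<sigma> \<in> borel_measurable borel"
  unfolding gaussian_def[abs_def] by measurable

text \<open>Independence says that the entries have the product distribution, and a product of densities is a
density of the product.\<close>

lemma distributed_gaussian_matrix:
  fixes Y :: "'w \<Rightarrow> real^'q^'p"
  assumes "prob_space M"
    and indep: "prob_space.indep_vars M (\<lambda>_. borel) (\<lambda>(i, j) \<omega>. Y \<omega> $ i $ j) (UNIV :: ('p \<times> 'q) set)"
    and distr: "\<And>i j. distributed M lborel (\<lambda>\<omega>. Y \<omega> $ i $ j) (\<lambda>x. ennreal (normal_density (\<mu> $ i $ j) \<sigma> x))"
  shows "distributed M lborel Y (\<lambda>y. ennreal (gaussian \<mu> \<sigma> y))"
proof -
  interpret prob_space M by fact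
  interpret product_sigma_finite "\<lambda>_::'p \<times> 'q. lborel :: real measure" ..
  let ?X = "\<lambda>ij \<omega>. Y \<omega> $ fst ij $ snd ij" and ?n = "\<lambda>ij. normal_density (\<mu> $ fst ij $ snd ij) \<sigma>"
  let ?I = "UNIV :: ('p \<times> 'q) set"
  have rv: "?X ij \<in> borel_measurable M" for ij
    using distributed_measurable[OF distr[of "fst ij" "snd ij"]] by simp
  have Ym[measurable]: "Y \<in> borel_measurable M"
    by (rule borel_measurable_matrix) (use rv in auto)
  have "(\<lambda>(i, j) \<omega>. Y \<omega> $ i $ j) = ?X" by (simp add: fun_eq_iff split_beta)
  then have "indep_vars (\<lambda>_. borel) ?X ?I" using indep by (simp only:)
  then have "distr M (\<Pi>\<^sub>M ij\<in>?I. borel) (\<lambda>\<omega>. \<lambda>ij\<in>?I. ?X ij \<omega>) = (\<Pi>\<^sub>M ij\<in>?I. distr M borel (?X ij))"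
    using indep_vars_iff_distr_eq_PiM'[of ?I ?X "\<lambda>_. borel"] rv by simp
  also have "\<dots> = (\<Pi>\<^sub>M ij\<in>?I. density lborel (?n ij))"
  proof (rule PiM_cong[OF refl])
    fix ij :: "'p \<times> 'q"
    have "distr M borel (?X ij) = distr M lborel (?X ij)" by (rule distr_cong) auto
    then show "distr M borel (?X ij) = density lborel (?n ij)"
      using distributed_distr_eq_density[OF distr[of "fst ij" "snd ij"]] by simp
  qed
  also have "\<dots> = density (\<Pi>\<^sub>M ij\<in>?I. lborel) (\<lambda>f. \<Prod>ij\<in>?I. ennreal (?n ij (f ij)))"
  proof -
    have "prob_space (density lborel (?n ij))" for ij
      using prob_space_distr[of "?X ij" lborel] rv[of ij] distributed_distr_eq_density[OF distr[of "fst ij" "snd ij"]] by simp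
    then interpret P: product_sigma_finite "\<lambda>ij. density lborel (?n ij)"
      by (intro product_sigma_finite.intro prob_space_imp_sigma_finite)
    show ?thesis
    proof (rule P.PiM_eqI[symmetric])
      show "sets (density (\<Pi>\<^sub>M ij\<in>?I. lborel) (\<lambda>f. \<Prod>ij\<in>?I. ennreal (?n ij (f ij)))) =
          sets (\<Pi>\<^sub>M ij\<in>?I. density lborel (?n ij))"
        by (simp cong: sets_PiM_cong)
      fix A :: "'p \<times> 'q \<Rightarrow> real set"
      assume A: "\<And>ij. ij \<in> ?I \<Longrightarrow> A ij \<in> sets (density lborel (?n ij))"
      then have [measurable]: "A ij \<in> sets borel" for ij by simp
      have "Pi\<^sub>E ?I A \<in> sets (\<Pi>\<^sub>M ij\<in>?I. lborel)" by (rule sets_PiM_I_finite) auto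
      then have "emeasure (density (\<Pi>\<^sub>M ij\<in>?I. lborel) (\<lambda>f. \<Prod>ij\<in>?I. ennreal (?n ij (f ij)))) (Pi\<^sub>E ?I A) =
          (\<integral>\<^sup>+f. (\<Prod>ij\<in>?I. ennreal (?n ij (f ij))) * indicator (Pi\<^sub>E ?I A) f \<partial>(\<Pi>\<^sub>M ij\<in>?I. lborel))"
        by (intro emeasure_density) auto
      also have "\<dots> = (\<integral>\<^sup>+f. (\<Prod>ij\<in>?I. ennreal (?n ij (f ij)) * indicator (A ij) (f ij)) \<partial>(\<Pi>\<^sub>M ij\<in>?I. lborel))"
      proof (rule nn_integral_cong)
        fix f :: "'p \<times> 'q \<Rightarrow> real"
        have "(indicator (Pi\<^sub>E ?I A) f :: ennreal) = (\<Prod>ij\<in>?I. indicator (A ij) (f ij))"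
        proof (cases "\<forall>ij. f ij \<in> A ij")
          case True
          then show ?thesis by (simp add: PiE_def Pi_def del: split_paired_All)
        next
          case False
          then obtain ij where "f ij \<notin> A ij" by blast
          then have "(\<Prod>ij\<in>?I. indicator (A ij) (f ij) :: ennreal) = 0"
            by (intro prod_zero bexI[of _ ij]) simp_all
          then show ?thesis using \<open>f ij \<notin> A ij\<close> by (auto simp: PiE_def Pi_def indicator_def)
        qed
        then show "(\<Prod>ij\<in>?I. ennreal (?n ij (f ij))) * indicator (Pi\<^sub>E ?I A) f =
            (\<Prod>ij\<in>?I. ennreal (?n ij (f ij)) * indicator (A ij) (f ij))"
          by (simp add: prod.distrib)
      qed
      also have "\<dots> = (\<Prod>ij\<in>?I. \<integral>\<^sup>+x. ennreal (?n ij x) * indicator (A ij) x \<partial>lborel)"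
        by (rule product_nn_integral_prod) auto
      also have "\<dots> = (\<Prod>ij\<in>?I. emeasure (density lborel (?n ij)) (A ij))"
        by (intro prod.cong refl emeasure_density[symmetric]) auto
      finally show "emeasure (density (\<Pi>\<^sub>M ij\<in>?I. lborel) (\<lambda>f. \<Prod>ij\<in>?I. ennreal (?n ij (f ij)))) (Pi\<^sub>E ?I A) =
          (\<Prod>ij\<in>?I. emeasure (density lborel (?n ij)) (A ij))" .
    qed simp
  qed
  also have "\<dots> = density (\<Pi>\<^sub>M ij\<in>?I. lborel) (\<lambda>f. ennreal (gaussian \<mu> \<sigma> (matrix_of f)))"
    by (simp add: gaussian_def prod_ennreal case_prod_beta)
  finally have X: "distr M (\<Pi>\<^sub>M ij\<in>?I. borel) (\<lambda>\<omega>. \<lambda>ij\<in>?I. ?X ij \<omega>) =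
      density (\<Pi>\<^sub>M ij\<in>?I. lborel) (\<lambda>f. ennreal (gaussian \<mu> \<sigma> (matrix_of f)))" .
  have Xm: "(\<lambda>\<omega>. \<lambda>ij\<in>?I. ?X ij \<omega>) \<in> measurable M (\<Pi>\<^sub>M ij\<in>?I. borel)"
    using rv by (intro measurable_restrict) auto
  have mo: "matrix_of \<in> measurable (\<Pi>\<^sub>M ij\<in>?I. lborel) borel"
    using measurable_matrix_of by (simp cong: measurable_cong_sets sets_PiM_cong)
  have "distr M lborel Y = distr M borel Y" by (rule distr_cong) auto
  also have "\<dots> = distr (distr M (\<Pi>\<^sub>M ij\<in>?I. borel) (\<lambda>\<omega>. \<lambda>ij\<in>?I. ?X ij \<omega>)) borel matrix_of"
    by (subst distr_distr[OF measurable_matrix_of Xm]) (auto intro!: distr_cong simp: vec_eq_iff)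
  also have "\<dots> = density (distr (\<Pi>\<^sub>M ij\<in>?I. lborel) borel matrix_of) (\<lambda>y. ennreal (gaussian \<mu> \<sigma> y))"
    unfolding X by (subst density_distr[OF _ mo]) auto
  also have "\<dots> = density lborel (\<lambda>y. ennreal (gaussian \<mu> \<sigma> y))" unfolding lborel_matrix ..
  finally show ?thesis unfolding distributed_def by simp
qed

section \<open>Stein identity for the estimator\<close>

lemma norm_top_projection_le:
  assumes "\<not> repeated_singular_value (y::real^'q^'p)" "CARD('q) \<le> CARD('p)" "1 \<le> r" "r < CARD('q)"
  shows "norm (top_projection r y x) \<le> norm x"
proof -
  obtain d u v where svd: "is_distinct_svd y d u v" using not_repeated_distinct_svd assms(1,2) by blast
  have on: "orthonormal_on {1..r} v"
    using distinct_svdD(2)[OF svd] assms(4) by (auto elim!: orthonormal_on_subset)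
  have "(norm (top_projection r y x))\<^sup>2 \<le> (norm x)\<^sup>2"
    using frame_proj_diag_bounds(2)[OF on, of x] frame_proj_inner_frame_proj[OF on, of x x]
    unfolding top_projection_eq[OF svd assms(3,4)] power2_norm_eq_inner by simp
  then show ?thesis by (rule power2_le_imp_le) simp
qed

lemma linear_top_projection: "linear (top_projection r y)"
  unfolding top_projection_def by (rule linear_frame_proj)

context
  fixes r :: nat
  assumes pq: "CARD('q::finite) \<le> CARD('p::finite)" and r: "1 \<le> r" "r < CARD('q)"
begin

lemma estimator_repeated: "repeated_singular_value y \<Longrightarrow> reduced_rank_estimator r (y :: real^'q^'p) = 0"
  using distinct_iff_not_repeated[OF pq, of y] unfolding reduced_rank_estimator_def by simp

lemma estimator_entry_bound: "\<bar>reduced_rank_estimator r (y :: real^'q^'p) $ i $ j\<bar> \<le> norm y"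
proof (cases "repeated_singular_value y")
  case True
  then show ?thesis by (simp add: estimator_repeated)
next
  case False
  have "\<bar>reduced_rank_estimator r y $ i $ j\<bar> \<le> norm (y *v top_projection r y (axis j 1))"
    unfolding estimator_entry[OF pq False r] by (rule component_le_norm_cart)
  also have "\<dots> \<le> norm y * norm (top_projection r y (axis j 1))" by (rule norm_matrix_vector_le)
  also have "\<dots> \<le> norm y * 1"
    using norm_top_projection_le[OF False pq r, of "axis j 1"] by (intro mult_left_mono) auto
  finally show ?thesis by simp
qed

text \<open>Continuity at $y$ is known on the right singular vectors of $y$, and the projections of all nearby
matrices are linear.\<close>

lemma continuous_on_top_projection: "continuous_on {y :: real^'q^'p. \<not> repeated_singular_value y} (\<lambda>y. top_projection r y x)"
  unfolding continuous_on_def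
proof
  fix y :: "real^'q^'p" assume "y \<in> {y. \<not> repeated_singular_value y}"
  then obtain d u v where svd: "is_distinct_svd y d u v" using not_repeated_distinct_svd[OF pq] by blast
  note on = distinct_svdD(2)[OF svd]
  have "top_projection r y' x = (\<Sum>k=1..CARD('q). (x \<bullet> v k) *\<^sub>R top_projection r y' (v k))" for y' :: "real^'q^'p"
    using arg_cong[OF orthonormal_expand[OF on, of x], of "top_projection r y'"]
    by (simp only: linear_sum[OF linear_top_projection] linear_scale[OF linear_top_projection])
  moreover have "((\<lambda>y'. \<Sum>k=1..CARD('q). (x \<bullet> v k) *\<^sub>R top_projection r y' (v k)) \<longlongrightarrow>
      (\<Sum>k=1..CARD('q). (x \<bullet> v k) *\<^sub>R top_projection r y (v k))) (at y within {y. \<not> repeated_singular_value y})"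
    by (intro tendsto_intros top_projection_tendsto[OF _ svd pq r])
  ultimately show "((\<lambda>y. top_projection r y x) \<longlongrightarrow> top_projection r y x) (at y within {y. \<not> repeated_singular_value y})" by simp
qed

lemma measurable_estimator_entry: "(\<lambda>y :: real^'q^'p. reduced_rank_estimator r y $ i $ j) \<in> borel_measurable borel"
proof -
  have eq: "(\<lambda>y :: real^'q^'p. reduced_rank_estimator r y $ i $ j) =
      (\<lambda>y. if y \<in> {y. repeated_singular_value y} then 0 else (y *v top_projection r y (axis j 1)) $ i)"
    by (auto simp: fun_eq_iff estimator_repeated estimator_entry[OF pq _ r])
  have "- {y :: real^'q^'p. repeated_singular_value y} = {y. \<not> repeated_singular_value y}" by auto
  then show ?thesis unfolding eq
    by (intro borel_measurable_continuous_on_if borel_closed closed_repeated)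
      (auto intro!: continuous_intros continuous_on_matrix_vector continuous_on_top_projection)
qed

text \<open>Where singular values coincide the partial derivative need not exist and \<^const>\<open>deriv\<close> is
unspecified; the value 0 makes the function nonnegative and measurable everywhere.\<close>

definition estimator_deriv :: "'p \<Rightarrow> 'q \<Rightarrow> real^'q^'p \<Rightarrow> real" where
  "estimator_deriv i j y = (if repeated_singular_value y then 0 else deriv (coord_section (reduced_rank_estimator r) y i j) 0)"

lemma has_estimator_deriv:
  assumes "\<not> repeated_singular_value y"
  shows "(coord_section (reduced_rank_estimator r) y i j has_real_derivative estimator_deriv i j y) (at 0)"
proof -
  obtain d u v where svd: "is_distinct_svd y d u v" using not_repeated_distinct_svd[OF pq assms] by blast
  show ?thesis
    using estimator_partial[OF svd pq r, of i j] DERIV_imp_deriv[OF estimator_partial[OF svd pq r, of i j]] assms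
    by (simp add: estimator_deriv_def)
qed

lemma estimator_deriv_nonneg: "0 \<le> estimator_deriv i j y"
proof (cases "repeated_singular_value y")
  case False
  obtain d u v where svd: "is_distinct_svd y d u v" using not_repeated_distinct_svd[OF pq False] by blast
  have "0 \<le> (\<Sum>k=1..r. (v k $ j)\<^sup>2) +
    (\<Sum>k=1..r. \<Sum>l=r+1..CARD('q). (d k * u k $ i * v l $ j + d l * u l $ i * v k $ j)\<^sup>2 / ((d k)\<^sup>2 - (d l)\<^sup>2))"
  proof (intro add_nonneg_nonneg sum_nonneg divide_nonneg_nonneg)
    fix k l assume "k \<in> {1..r}" "l \<in> {r+1..CARD('q)}"
    then show "0 \<le> (d k)\<^sup>2 - (d l)\<^sup>2" using distinct_svdD(7)[OF svd, of k l] by auto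
  qed auto
  also have "\<dots> = estimator_deriv i j y"
    using DERIV_imp_deriv[OF estimator_partial[OF svd pq r, of i j]] False by (simp add: estimator_deriv_def)
  finally show ?thesis .
qed (simp add: estimator_deriv_def)

text \<open>A pointwise limit of difference quotients.\<close>

lemma measurable_estimator_deriv: "estimator_deriv i j \<in> borel_measurable borel"
proof (rule borel_measurable_LIMSEQ_real)
  let ?e = "axis i (axis j 1) :: real^'q^'p" and ?f = "\<lambda>y :: real^'q^'p. reduced_rank_estimator r y $ i $ j"
  let ?u = "\<lambda>n y. if repeated_singular_value y then 0 else (?f (y + (1 / real (Suc n)) *\<^sub>R ?e) - ?f y) / (1 / real (Suc n))"
  have s: "{y :: real^'q^'p. repeated_singular_value y} \<in> sets borel" by (rule borel_closed[OF closed_repeated])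
  note [measurable] = measurable_estimator_entry
  show "?u n \<in> borel_measurable borel" for n
    by (rule measurable_If) (use s in \<open>auto simp: pred_def\<close>)
  fix y :: "real^'q^'p"
  show "(\<lambda>n. ?u n y) \<longlonglongrightarrow> estimator_deriv i j y"
  proof (cases "repeated_singular_value y")
    case False
    have "((\<lambda>t. (?f (y + t *\<^sub>R ?e) - ?f y) / t) \<longlongrightarrow> estimator_deriv i j y) (at 0)"
      using has_estimator_deriv[OF False, of i j] unfolding DERIV_def coord_section_def by simp
    moreover have "filterlim (\<lambda>n. 1 / real (Suc n)) (at 0) sequentially"
      unfolding filterlim_at using LIMSEQ_inverse_real_of_nat by (simp add: inverse_eq_divide)
    ultimately have "(\<lambda>n. (?f (y + (1 / real (Suc n)) *\<^sub>R ?e) - ?f y) / (1 / real (Suc n))) \<longlonglongrightarrow> estimator_deriv i j y"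
      by (rule filterlim_compose)
    then show ?thesis using False by simp
  qed (simp add: estimator_deriv_def)
qed

text \<open>On almost every line in direction $E_{ij}$ the estimator is differentiable throughout, and the Gaussian
density is a constant times a normal density in the line parameter. Linear growth of the estimator
is the bound $\|y P\| \le \|y\|$.\<close>

lemma stein_estimator:
  fixes \<mu> :: "real^'q^'p" and i :: 'p and j :: 'q
  assumes \<sigma>: "\<sigma> > 0"
  defines "w \<equiv> \<lambda>y. reduced_rank_estimator r y $ i $ j * ((y $ i $ j - \<mu> $ i $ j) / \<sigma>\<^sup>2)"
  shows "(\<integral>\<^sup>+y. ennreal (gaussian \<mu> \<sigma> y) * ennreal (estimator_deriv i j y) \<partial>lborel) +
     (\<integral>\<^sup>+y. ennreal (gaussian \<mu> \<sigma> y) * ennreal (- w y) \<partial>lborel) =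
     (\<integral>\<^sup>+y. ennreal (gaussian \<mu> \<sigma> y) * ennreal (w y) \<partial>lborel)"
proof -
  let ?e = "axis i (axis j 1) :: real^'q^'p" and ?f = "\<lambda>y :: real^'q^'p. reduced_rank_estimator r y $ i $ j"
  note [measurable] = measurable_estimator_entry measurable_estimator_deriv
  have [measurable]: "w \<in> borel_measurable borel" unfolding w_def by measurable
  have ee: "?e \<bullet> ?e = 1" by (simp add: inner_unit_matrix)
  have ent: "(y + t *\<^sub>R ?e) $ i $ j = y $ i $ j + t" for y :: "real^'q^'p" and t by simp
  define L where "L \<Phi> y = (\<integral>\<^sup>+t. ennreal (gaussian \<mu> \<sigma> (y + t *\<^sub>R ?e)) * ennreal (\<Phi> (y + t *\<^sub>R ?e)) \<partial>lborel)"
    for \<Phi> :: "real^'q^'p \<Rightarrow> real" and y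
  have slab: "(\<integral>\<^sup>+y. ennreal (gaussian \<mu> \<sigma> y) * ennreal (\<Phi> y) \<partial>lborel) =
      (\<integral>\<^sup>+y. indicator {0..<1} (y \<bullet> ?e) * L \<Phi> y \<partial>lborel)"
    if [measurable]: "\<Phi> \<in> borel_measurable borel" for \<Phi> :: "real^'q^'p \<Rightarrow> real"
    unfolding L_def by (rule nn_integral_slab[OF _ ee, of "\<lambda>y. ennreal (gaussian \<mu> \<sigma> y) * ennreal (\<Phi> y)"]) measurable
  have mL: "L \<Phi> \<in> borel_measurable borel" if [measurable]: "\<Phi> \<in> borel_measurable borel" for \<Phi>
    unfolding L_def by measurable
  have line: "L (estimator_deriv i j) y + L (\<lambda>y. - w y) y = L w y"
    if nr: "\<And>t. \<not> repeated_singular_value (y + t *\<^sub>R ?e)" for y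
  proof -
    define m where "m = \<mu> $ i $ j - y $ i $ j"
    \<comment> \<open>The factors of the density that stay constant on the line.\<close>
    define C where "C = (\<Prod>ij\<in>UNIV - {(i, j)}. normal_density (\<mu> $ fst ij $ snd ij) \<sigma> (y $ fst ij $ snd ij))"
    have C0: "0 \<le> C" unfolding C_def by (intro prod_nonneg) auto
    have g: "gaussian \<mu> \<sigma> (y + t *\<^sub>R ?e) = normal_density m \<sigma> t * C" for t
    proof -
      have "gaussian \<mu> \<sigma> (y + t *\<^sub>R ?e) = normal_density (\<mu> $ i $ j) \<sigma> (y $ i $ j + t) *
          (\<Prod>ij\<in>UNIV - {(i, j)}. normal_density (\<mu> $ fst ij $ snd ij) \<sigma> ((y + t *\<^sub>R ?e) $ fst ij $ snd ij))"
        unfolding gaussian_def by (subst prod.remove[of _ "(i, j)"]) auto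
      also have "(\<Prod>ij\<in>UNIV - {(i, j)}. normal_density (\<mu> $ fst ij $ snd ij) \<sigma> ((y + t *\<^sub>R ?e) $ fst ij $ snd ij)) = C"
        unfolding C_def by (intro prod.cong refl) (auto simp: axis_def)
      also have "normal_density (\<mu> $ i $ j) \<sigma> (y $ i $ j + t) = normal_density m \<sigma> t"
        unfolding normal_density_def m_def by (simp add: algebra_simps)
      finally show ?thesis .
    qed
    define F where "F t = C * ?f (y + t *\<^sub>R ?e)" for t
    define h where "h t = C * estimator_deriv i j (y + t *\<^sub>R ?e)" for t
    have w: "w (y + t *\<^sub>R ?e) = ?f (y + t *\<^sub>R ?e) * ((t - m) / \<sigma>\<^sup>2)" for t
      unfolding w_def ent m_def by (simp add: algebra_simps)
    have 1: "L (estimator_deriv i j) y = (\<integral>\<^sup>+t. ennreal (h t * normal_density m \<sigma> t) \<partial>lborel)"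
      unfolding L_def g h_def
      by (intro nn_integral_cong) (simp add: ennreal_mult'[symmetric] estimator_deriv_nonneg C0 mult_ac)
    have 2: "L w y = (\<integral>\<^sup>+t. ennreal (F t * ((t - m) / \<sigma>\<^sup>2) * normal_density m \<sigma> t) \<partial>lborel)"
      unfolding L_def g w F_def
      by (intro nn_integral_cong) (simp add: ennreal_mult'[symmetric] C0 mult_ac)
    have 3: "L (\<lambda>y. - w y) y = (\<integral>\<^sup>+t. ennreal (- (F t * ((t - m) / \<sigma>\<^sup>2) * normal_density m \<sigma> t)) \<partial>lborel)"
      unfolding L_def g w F_def
      by (intro nn_integral_cong) (simp add: ennreal_mult'[symmetric] C0 mult_ac)
    show ?thesis unfolding 1 2 3
    proof (rule stein_line[OF \<sigma>])
      show "(F has_real_derivative h t) (at t)" for t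
      proof -
        have "((\<lambda>s. ?f (y + (s + t) *\<^sub>R ?e)) has_real_derivative estimator_deriv i j (y + t *\<^sub>R ?e)) (at 0)"
          using has_estimator_deriv[OF nr[of t], of i j] unfolding coord_section_def
          by (simp add: scaleR_add_left add.commute add.left_commute)
        then have "((\<lambda>s. ?f (y + s *\<^sub>R ?e)) has_real_derivative estimator_deriv i j (y + t *\<^sub>R ?e)) (at (0 + t))"
          by (subst DERIV_shift)
        then show ?thesis unfolding F_def h_def by (intro DERIV_cmult) simp
      qed
      show "h \<in> borel_measurable borel" unfolding h_def by measurable
      show "0 \<le> h t" for t unfolding h_def using C0 estimator_deriv_nonneg by simp
      show "\<bar>F t\<bar> \<le> C * norm y + C * \<bar>t\<bar>" for t
      proof -
        have "\<bar>?f (y + t *\<^sub>R ?e)\<bar> \<le> norm y + \<bar>t\<bar>"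
          using estimator_entry_bound[of "y + t *\<^sub>R ?e" i j] norm_triangle_ineq[of y "t *\<^sub>R ?e"]
          by (simp add: norm_eq_sqrt_inner[of ?e] ee)
        from mult_left_mono[OF this C0] show ?thesis
          unfolding F_def by (simp add: abs_mult C0 distrib_left)
      qed
    qed (use C0 in auto)
  qed
  have "(\<integral>\<^sup>+y. ennreal (gaussian \<mu> \<sigma> y) * ennreal (estimator_deriv i j y) \<partial>lborel) +
     (\<integral>\<^sup>+y. ennreal (gaussian \<mu> \<sigma> y) * ennreal (- w y) \<partial>lborel) =
     (\<integral>\<^sup>+y. indicator {0..<1} (y \<bullet> ?e) * L (estimator_deriv i j) y + indicator {0..<1} (y \<bullet> ?e) * L (\<lambda>y. - w y) y \<partial>lborel)"
  proof -
    note [measurable] = mL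
    have "(\<lambda>y. - w y) \<in> borel_measurable borel" by measurable
    then show ?thesis
      by (subst nn_integral_add) (auto simp: slab measurable_estimator_deriv)
  qed
  also have "\<dots> = (\<integral>\<^sup>+y. indicator {0..<1} (y \<bullet> ?e) * L w y \<partial>lborel)"
    by (rule nn_integral_cong_AE, use AE_line_not_repeated[OF pq, of i j] in eventually_elim)
      (simp add: line flip: distrib_left)
  finally show ?thesis by (simp add: slab)
qed

end

section \<open>Unbiasedness of the risk estimate\<close>

text \<open>Converts a balance of nonnegative integrals into an identity of integrals; finiteness for $h$ is
forced by integrability of $w$.\<close>

lemma integrable_of_nn_integral_balance:
  fixes h w :: "'w \<Rightarrow> real"
  assumes h[measurable]: "h \<in> borel_measurable M" and h0: "\<And>x. 0 \<le> h x" and w: "integrable M w"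
    and eq: "(\<integral>\<^sup>+x. ennreal (h x) \<partial>M) + (\<integral>\<^sup>+x. ennreal (- w x) \<partial>M) = (\<integral>\<^sup>+x. ennreal (w x) \<partial>M)"
  shows "integrable M h" "(\<integral>x. h x \<partial>M) = (\<integral>x. w x \<partial>M)"
proof -
  define A B where "A = enn2real (\<integral>\<^sup>+x. ennreal (w x) \<partial>M)" and "B = enn2real (\<integral>\<^sup>+x. ennreal (- w x) \<partial>M)"
  have AB: "(\<integral>\<^sup>+x. ennreal (w x) \<partial>M) = ennreal A" "(\<integral>\<^sup>+x. ennreal (- w x) \<partial>M) = ennreal B" "0 \<le> B" "0 \<le> A"
    using w by (auto simp: A_def B_def real_integrable_def less_top)
  have lt: "(\<integral>\<^sup>+x. ennreal (h x) \<partial>M) < \<infinity>"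
    using eq unfolding AB(1,2) by (metis ennreal_less_top infinity_ennreal_def le_add_same_cancel1 order_le_less_trans zero_le ennreal_add_left_cancel_le le_iff_add)
  show ih: "integrable M h" using lt h0 by (intro integrableI_nonneg) auto
  have nh: "(\<integral>\<^sup>+x. ennreal (h x) \<partial>M) = ennreal (\<integral>x. h x \<partial>M)"
    using ih h0 by (intro nn_integral_eq_integral) auto
  have "0 \<le> (\<integral>x. h x \<partial>M)" using h0 by simp
  then have "(\<integral>x. h x \<partial>M) + B = A"
    using eq AB(3,4) unfolding AB(1,2) nh by (simp flip: ennreal_plus)
  moreover have "(\<integral>x. w x \<partial>M) = A - B"
    unfolding A_def B_def by (rule real_lebesgue_integral_def[OF w])
  ultimately show "(\<integral>x. h x \<partial>M) = (\<integral>x. w x \<partial>M)" by simp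
qed

lemma norm_matrix_square: "(norm y)\<^sup>2 = (\<Sum>i\<in>UNIV. \<Sum>j\<in>UNIV. (y $ i $ j)\<^sup>2)" for y :: "real^'q^'p"
  unfolding power2_norm_eq_inner inner_vec_def by (simp add: power2_eq_square)

lemma normal_centered_moments:
  assumes "prob_space M" "\<sigma> > 0" "distributed M lborel X (\<lambda>x. ennreal (normal_density m \<sigma> x))"
  shows "integrable M (\<lambda>\<omega>. X \<omega> - m)" "(\<integral>\<omega>. X \<omega> - m \<partial>M) = 0"
    "integrable M (\<lambda>\<omega>. (X \<omega> - m)\<^sup>2)" "(\<integral>\<omega>. (X \<omega> - m)\<^sup>2 \<partial>M) = \<sigma>\<^sup>2"
proof -
  note mo = normal_moment_odd[OF assms(2), of m 0] normal_moment_even[OF assms(2), of m 1]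
  have i: "integrable M (\<lambda>\<omega>. g (X \<omega>)) \<longleftrightarrow> integrable lborel (\<lambda>x. normal_density m \<sigma> x * g x)"
    if "g \<in> borel_measurable borel" for g :: "real \<Rightarrow> real"
    using distributed_integrable[OF assms(3), of g] that by simp
  have v: "(\<integral>\<omega>. g (X \<omega>) \<partial>M) = (\<integral>x. normal_density m \<sigma> x * g x \<partial>lborel)"
    if "g \<in> borel_measurable borel" for g :: "real \<Rightarrow> real"
    using distributed_integral[OF assms(3), of g] that by simp
  have b1: "has_bochner_integral lborel (\<lambda>x. normal_density m \<sigma> x * (x - m)) 0" using mo(1) by simp
  have b2: "has_bochner_integral lborel (\<lambda>x. normal_density m \<sigma> x * (x - m)\<^sup>2) (\<sigma>\<^sup>2)"
    using mo(2) by (simp add: fact_2 power2_eq_square)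
  show "integrable M (\<lambda>\<omega>. X \<omega> - m)" "(\<integral>\<omega>. X \<omega> - m \<partial>M) = 0"
    using i[of "\<lambda>x. x - m"] v[of "\<lambda>x. x - m"] b1 by (auto simp: has_bochner_integral_iff)
  show "integrable M (\<lambda>\<omega>. (X \<omega> - m)\<^sup>2)" "(\<integral>\<omega>. (X \<omega> - m)\<^sup>2 \<partial>M) = \<sigma>\<^sup>2"
    using i[of "\<lambda>x. (x - m)\<^sup>2"] v[of "\<lambda>x. (x - m)\<^sup>2"] b2 by (auto simp: has_bochner_integral_iff)
qed

theorem theorem1:
  fixes M :: "'w measure"
    and Y :: "'w \<Rightarrow> real^'q^'p"
    and \<mu> :: "real^'q^'p"
    and \<sigma> :: real
    and r :: nat
  assumes "prob_space M"
    and "CARD('q) \<le> CARD('p)"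
    and "1 \<le> r" and "r < CARD('q)"
    and "\<sigma> > 0"
    and "prob_space.indep_vars M (\<lambda>_. borel) (\<lambda>(i, j) \<omega>. Y \<omega> $ i $ j) (UNIV :: ('p \<times> 'q) set)"
    and "\<And>i j. distributed M lborel (\<lambda>\<omega>. Y \<omega> $ i $ j)
                  (\<lambda>x. ennreal (normal_density (\<mu> $ i $ j) \<sigma> x))"
  shows "(AE \<omega> in M. distinct_singular_values (Y \<omega>)) \<and>
    integrable M (\<lambda>\<omega>. SURE \<sigma> r (Y \<omega>)) \<and>
    integrable M (\<lambda>\<omega>. (norm (reduced_rank_estimator r (Y \<omega>) - \<mu>))\<^sup>2) \<and>
    integral\<^sup>L M (\<lambda>\<omega>. SURE \<sigma> r (Y \<omega>)) =
      integral\<^sup>L M (\<lambda>\<omega>. (norm (reduced_rank_estimator r (Y \<omega>) - \<mu>))\<^sup>2) \<and>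
    (\<forall>(y :: real^'q^'p) d u v. is_distinct_svd y d u v \<longrightarrow>
       divergence_exists (reduced_rank_estimator r) y \<and>
       divergence (reduced_rank_estimator r) y =
         real CARD('p) * real r +
         (\<Sum>k=1..r. \<Sum>l=r+1..CARD('q). ((d k)\<^sup>2 + (d l)\<^sup>2) / ((d k)\<^sup>2 - (d l)\<^sup>2)))"
proof -
  interpret prob_space M by fact
  note pq = assms(2) and r = assms(3,4) and \<sigma> = assms(5)
  have dist: "distributed M lborel Y (\<lambda>y. ennreal (gaussian \<mu> \<sigma> y))"
    by (rule distributed_gaussian_matrix[OF assms(1,6,7)])
  have Ym[measurable]: "Y \<in> borel_measurable M" using distributed_measurable[OF dist] by simp
  note [measurable] = measurable_estimator_entry[OF pq r] measurable_estimator_deriv[OF pq r]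
  have "AE y in (lborel :: (real^'q^'p) measure). \<not> repeated_singular_value y"
    \<comment> \<open>Any coordinate direction serves; the point itself is the parameter $t = 0$.\<close>
    using AE_line_not_repeated[OF pq, of undefined undefined] by eventually_elim (metis add.right_neutral scaleR_zero_left)
  moreover have "Measurable.pred lborel (\<lambda>y :: real^'q^'p. \<not> repeated_singular_value y)"
    using borel_comp[OF borel_closed[OF closed_repeated]] by (simp add: pred_def Collect_neg_eq)
  ultimately have AE_Y: "AE \<omega> in M. \<not> repeated_singular_value (Y \<omega>)"
    using distributed_AE2[OF dist, of "\<lambda>y. \<not> repeated_singular_value y"] by auto
  let ?f = "\<lambda>i j \<omega>. reduced_rank_estimator r (Y \<omega>) $ i $ j"
  let ?h = "\<lambda>i j \<omega>. estimator_deriv r i j (Y \<omega>)"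
  let ?X = "\<lambda>i j \<omega>. Y \<omega> $ i $ j - \<mu> $ i $ j"
  note mom = normal_centered_moments[OF assms(1) \<sigma> assms(7)]
  have intY: "integrable M (\<lambda>\<omega>. (norm (Y \<omega>))\<^sup>2)"
  proof -
    have "integrable M (\<lambda>\<omega>. (?X i j \<omega>)\<^sup>2 + 2 * \<mu> $ i $ j * ?X i j \<omega> + (\<mu> $ i $ j)\<^sup>2)" for i j
      using mom[of i j] by simp
    moreover have "(Y \<omega> $ i $ j)\<^sup>2 = (?X i j \<omega>)\<^sup>2 + 2 * \<mu> $ i $ j * ?X i j \<omega> + (\<mu> $ i $ j)\<^sup>2" for i j \<omega>
      by (simp add: power2_eq_square algebra_simps)
    ultimately show ?thesis unfolding norm_matrix_square by simp
  qed
  have fX: "integrable M (\<lambda>\<omega>. ?f i j \<omega> * ?X i j \<omega>)" for i j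
  proof (rule Bochner_Integration.integrable_bound)
    show "integrable M (\<lambda>\<omega>. (norm (Y \<omega>))\<^sup>2 + (?X i j \<omega>)\<^sup>2)" using intY mom(3)[of i j] by simp
    show "AE \<omega> in M. norm (?f i j \<omega> * ?X i j \<omega>) \<le> norm ((norm (Y \<omega>))\<^sup>2 + (?X i j \<omega>)\<^sup>2)"
    proof (rule AE_I2)
      fix \<omega>
      have "\<bar>?f i j \<omega> * ?X i j \<omega>\<bar> \<le> norm (Y \<omega>) * \<bar>?X i j \<omega>\<bar>"
        unfolding abs_mult using estimator_entry_bound[OF pq r, of "Y \<omega>" i j] by (intro mult_right_mono) auto
      also have "\<dots> \<le> (norm (Y \<omega>))\<^sup>2 + (?X i j \<omega>)\<^sup>2"
      proof -
        have "2 * (norm (Y \<omega>) * \<bar>?X i j \<omega>\<bar>) \<le> (norm (Y \<omega>))\<^sup>2 + \<bar>?X i j \<omega>\<bar>\<^sup>2"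
          using sum_squares_bound[of "norm (Y \<omega>)" "\<bar>?X i j \<omega>\<bar>"] by (simp add: mult.assoc)
        moreover have "0 \<le> norm (Y \<omega>) * \<bar>?X i j \<omega>\<bar>" by simp
        ultimately show ?thesis unfolding power2_abs by linarith
      qed
      finally show "norm (?f i j \<omega> * ?X i j \<omega>) \<le> norm ((norm (Y \<omega>))\<^sup>2 + (?X i j \<omega>)\<^sup>2)" by simp
    qed
  qed measurable
  have Yf: "integrable M (\<lambda>\<omega>. (Y \<omega> $ i $ j - ?f i j \<omega>)\<^sup>2)" for i j
  proof (rule Bochner_Integration.integrable_bound)
    show "integrable M (\<lambda>\<omega>. 4 * (norm (Y \<omega>))\<^sup>2)" using intY by simp
    show "AE \<omega> in M. norm ((Y \<omega> $ i $ j - ?f i j \<omega>)\<^sup>2) \<le> norm (4 * (norm (Y \<omega>))\<^sup>2)"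
    proof (rule AE_I2)
      fix \<omega>
      have "\<bar>Y \<omega> $ i $ j\<bar> \<le> norm (Y \<omega>)"
        by (rule order_trans[OF component_le_norm_cart Finite_Cartesian_Product.norm_nth_le])
      then have "\<bar>Y \<omega> $ i $ j - ?f i j \<omega>\<bar> \<le> 2 * norm (Y \<omega>)"
        using estimator_entry_bound[OF pq r, of "Y \<omega>" i j] by linarith
      then have "(Y \<omega> $ i $ j - ?f i j \<omega>)\<^sup>2 \<le> (2 * norm (Y \<omega>))\<^sup>2"
        by (intro iffD1[OF abs_le_square_iff]) simp
      then show "norm ((Y \<omega> $ i $ j - ?f i j \<omega>)\<^sup>2) \<le> norm (4 * (norm (Y \<omega>))\<^sup>2)"
        by (simp add: power_mult_distrib)
    qed
  qed measurable
  have stein: "integrable M (?h i j) \<and> \<sigma>\<^sup>2 * (\<integral>\<omega>. ?h i j \<omega> \<partial>M) = (\<integral>\<omega>. ?f i j \<omega> * ?X i j \<omega> \<partial>M)" for i j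
  proof -
    let ?w = "\<lambda>y. reduced_rank_estimator r y $ i $ j * ((y $ i $ j - \<mu> $ i $ j) / \<sigma>\<^sup>2)"
    have iw: "integrable M (\<lambda>\<omega>. ?w (Y \<omega>))" using integrable_divide[OF fX[of i j], of "\<sigma>\<^sup>2"] by simp
    have nn: "(\<integral>\<^sup>+y. ennreal (gaussian \<mu> \<sigma> y) * ennreal (g y) \<partial>lborel) = (\<integral>\<^sup>+\<omega>. ennreal (g (Y \<omega>)) \<partial>M)"
      if [measurable]: "g \<in> borel_measurable borel" for g :: "real^'q^'p \<Rightarrow> real"
      using distributed_nn_integral[OF dist, of "\<lambda>y. ennreal (g y)"] by simp
    have wm: "?w \<in> borel_measurable borel" "(\<lambda>y. - ?w y) \<in> borel_measurable borel" by measurable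
    have "(\<integral>\<^sup>+\<omega>. ennreal (?h i j \<omega>) \<partial>M) + (\<integral>\<^sup>+\<omega>. ennreal (- ?w (Y \<omega>)) \<partial>M) = (\<integral>\<^sup>+\<omega>. ennreal (?w (Y \<omega>)) \<partial>M)"
      using stein_estimator[OF pq r \<sigma>, where i = i and j = j and \<mu> = \<mu>]
      unfolding nn[OF wm(1)] nn[OF wm(2)] nn[OF measurable_estimator_deriv[OF pq r]] .
    from integrable_of_nn_integral_balance[OF _ _ iw this]
    have "integrable M (?h i j)" "(\<integral>\<omega>. ?h i j \<omega> \<partial>M) = (\<integral>\<omega>. ?f i j \<omega> * ?X i j \<omega> / \<sigma>\<^sup>2 \<partial>M)"
      using estimator_deriv_nonneg[OF pq r] by auto
    then show ?thesis using \<sigma> by simp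
  qed
  \<comment> \<open>A version of the risk estimate that is a sum over entries.\<close>
  define S where "S \<omega> = (\<Sum>i\<in>UNIV. \<Sum>j\<in>UNIV. (Y \<omega> $ i $ j - ?f i j \<omega>)\<^sup>2 - \<sigma>\<^sup>2 + 2 * \<sigma>\<^sup>2 * ?h i j \<omega>)" for \<omega>
  have SURE_eq: "SURE \<sigma> r (Y \<omega>) = (if repeated_singular_value (Y \<omega>) then 0 else S \<omega>)" for \<omega>
  proof (cases "repeated_singular_value (Y \<omega>)")
    case True
    then show ?thesis by (simp add: SURE_def distinct_iff_not_repeated[OF pq])
  next
    case False
    have "divergence (reduced_rank_estimator r) (Y \<omega>) = (\<Sum>i\<in>UNIV. \<Sum>j\<in>UNIV. ?h i j \<omega>)"
      unfolding divergence_def using False by (simp add: estimator_deriv_def[OF pq r])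
    moreover have "(norm (Y \<omega> - reduced_rank_estimator r (Y \<omega>)))\<^sup>2 = (\<Sum>i\<in>UNIV. \<Sum>j\<in>UNIV. (Y \<omega> $ i $ j - ?f i j \<omega>)\<^sup>2)"
      unfolding norm_matrix_square by simp
    ultimately show ?thesis using False
      unfolding SURE_def S_def distinct_iff_not_repeated[OF pq]
      by (simp add: sum.distrib sum_subtractf sum_distrib_left mult_ac)
  qed
  have S_int: "integrable M S" unfolding S_def using Yf stein by (intro Bochner_Integration.integrable_sum) simp
  \<comment> \<open>With $X = Y - \mu$ one has $(\hat\mu - \mu)^2 = (Y - \hat\mu)^2 + 2 \hat\mu X - 2 Y X + X^2$ and $Y X = X^2 + \mu X$.\<close>
  have risk: "(norm (reduced_rank_estimator r (Y \<omega>) - \<mu>))\<^sup>2 =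
      (\<Sum>i\<in>UNIV. \<Sum>j\<in>UNIV. (Y \<omega> $ i $ j - ?f i j \<omega>)\<^sup>2 + 2 * (?f i j \<omega> * ?X i j \<omega>) - (?X i j \<omega>)\<^sup>2 - 2 * \<mu> $ i $ j * ?X i j \<omega>)" for \<omega>
    unfolding norm_matrix_square by (intro sum.cong refl) (simp add: power2_eq_square algebra_simps)
  have term_int: "integrable M (\<lambda>\<omega>. (Y \<omega> $ i $ j - ?f i j \<omega>)\<^sup>2 + 2 * (?f i j \<omega> * ?X i j \<omega>) - (?X i j \<omega>)\<^sup>2 - 2 * \<mu> $ i $ j * ?X i j \<omega>)" for i j
    by (intro Bochner_Integration.integrable_add Bochner_Integration.integrable_diff integrable_mult_right Yf fX mom)
  have risk_int: "integrable M (\<lambda>\<omega>. (norm (reduced_rank_estimator r (Y \<omega>) - \<mu>))\<^sup>2)"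
    unfolding risk by (intro Bochner_Integration.integrable_sum term_int)
  have "(\<integral>\<omega>. (Y \<omega> $ i $ j - ?f i j \<omega>)\<^sup>2 - \<sigma>\<^sup>2 + 2 * \<sigma>\<^sup>2 * ?h i j \<omega> \<partial>M) =
      (\<integral>\<omega>. (Y \<omega> $ i $ j - ?f i j \<omega>)\<^sup>2 + 2 * (?f i j \<omega> * ?X i j \<omega>) - (?X i j \<omega>)\<^sup>2 - 2 * \<mu> $ i $ j * ?X i j \<omega> \<partial>M)" for i j
  proof -
    have "(\<integral>\<omega>. (Y \<omega> $ i $ j - ?f i j \<omega>)\<^sup>2 - \<sigma>\<^sup>2 + 2 * \<sigma>\<^sup>2 * ?h i j \<omega> \<partial>M) =
        (\<integral>\<omega>. (Y \<omega> $ i $ j - ?f i j \<omega>)\<^sup>2 \<partial>M) - \<sigma>\<^sup>2 + 2 * (\<sigma>\<^sup>2 * (\<integral>\<omega>. ?h i j \<omega> \<partial>M))"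
      using Yf[of i j] stein[of i j] by (simp add: prob_space)
    moreover have "(\<integral>\<omega>. (Y \<omega> $ i $ j - ?f i j \<omega>)\<^sup>2 + 2 * (?f i j \<omega> * ?X i j \<omega>) - (?X i j \<omega>)\<^sup>2 - 2 * \<mu> $ i $ j * ?X i j \<omega> \<partial>M) =
        (\<integral>\<omega>. (Y \<omega> $ i $ j - ?f i j \<omega>)\<^sup>2 \<partial>M) + 2 * (\<integral>\<omega>. ?f i j \<omega> * ?X i j \<omega> \<partial>M) - \<sigma>\<^sup>2 - 2 * \<mu> $ i $ j * 0"
    proof -
      have a: "integrable M (\<lambda>\<omega>. (Y \<omega> $ i $ j - ?f i j \<omega>)\<^sup>2 + 2 * (?f i j \<omega> * ?X i j \<omega>))"
        by (intro Bochner_Integration.integrable_add integrable_mult_right Yf fX)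
      have b: "integrable M (\<lambda>\<omega>. (Y \<omega> $ i $ j - ?f i j \<omega>)\<^sup>2 + 2 * (?f i j \<omega> * ?X i j \<omega>) - (?X i j \<omega>)\<^sup>2)"
        by (intro Bochner_Integration.integrable_diff a mom)
      show ?thesis
        by (subst Bochner_Integration.integral_diff[OF b integrable_mult_right[OF mom(1)]],
            subst Bochner_Integration.integral_diff[OF a mom(3)],
            subst Bochner_Integration.integral_add[OF Yf integrable_mult_right[OF fX]])
          (simp only: integral_mult_right_zero mom)
    qed
    ultimately show ?thesis using stein[of i j] by simp
  qed
  then have S_risk: "(\<integral>\<omega>. S \<omega> \<partial>M) = (\<integral>\<omega>. (norm (reduced_rank_estimator r (Y \<omega>) - \<mu>))\<^sup>2 \<partial>M)"
    unfolding risk S_def using Yf stein term_int by (subst (1 2) Bochner_Integration.integral_sum; simp)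
  have [measurable]: "Measurable.pred M (\<lambda>\<omega>. repeated_singular_value (Y \<omega>))"
    using measurable_sets[OF Ym borel_closed[OF closed_repeated]] by (simp add: pred_def vimage_def Int_def conj_commute)
  have [measurable]: "S \<in> borel_measurable M" using S_int by (rule borel_measurable_integrable)
  have SURE_m: "(\<lambda>\<omega>. SURE \<sigma> r (Y \<omega>)) \<in> borel_measurable M"
    unfolding SURE_eq by measurable
  have S_eq: "AE \<omega> in M. SURE \<sigma> r (Y \<omega>) = S \<omega>"
    using AE_Y by eventually_elim (simp add: SURE_eq)
  have "integrable M (\<lambda>\<omega>. SURE \<sigma> r (Y \<omega>))"
    using S_int S_eq SURE_m integrable_cong_AE[of "\<lambda>\<omega>. SURE \<sigma> r (Y \<omega>)" M S] borel_measurable_integrable by blast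
  moreover have "(\<integral>\<omega>. SURE \<sigma> r (Y \<omega>) \<partial>M) = (\<integral>\<omega>. S \<omega> \<partial>M)"
    by (rule integral_cong_AE[OF SURE_m borel_measurable_integrable[OF S_int] S_eq])
  moreover have "AE \<omega> in M. distinct_singular_values (Y \<omega>)"
    using AE_Y by eventually_elim (simp add: distinct_iff_not_repeated[OF pq])
  moreover have "divergence_exists (reduced_rank_estimator r) y" if "is_distinct_svd y d u v" for y :: "real^'q^'p" and d u v
    unfolding divergence_exists_def field_differentiable_def using estimator_partial[OF that pq r] by blast
  ultimately show ?thesis
    using risk_int S_risk divergence_estimator[OF _ pq r] by simp
qed

end
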